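(* Let $k$ be a perfect field of characteristic different from $2$, $G_k=\operatorname{Gal}(\overline{k}/k)$. Let $C$ be a hyperelliptic curve of genus $g$ over $k$ given by the model \[ C:\ \begin{cases} t^2=f(x,y,z)\\ Q(x,y,z):=z^2-ax^2-by^2=0\end{cases} \] with $a,b\in k^\times$ and $f\in k[x,y,z]$ homogeneous of degree $d$, where $d=g+1$ if $g$ is odd and $d=g+2$ if $g$ is even. Let $\xi:G_k\to\operatorname{Aut}(C)$ be a continuous cocycle factoring through $\operatorname{Gal}(L/k)$ for a finite Galois extension $L/k$. For $\sigma\in G_k$ let $\overline{\xi}(\sigma)\in\operatorname{GL}_3(\overline{k})$ be the unique matrix of determinant $1$ satisfying $Q(\overline{\xi}(\sigma)(x,y,z))=Q(x,y,z)$ whose class in $\operatorname{PGL}_3(\overline{k})$ is the projective transformation by which $\xi(\sigma)$ acts on $[x:y:z]$. Then: (a) there exists $M\in\operatorname{GL}_3(\overline{k})$ with $\overline{\xi}(\sigma)=M\cdot{}^\sigma M^{-1}$ for all $\sigma\in G_k$; fix such an $M$. Then $Q(M(x,y,z))\in k[x,y,z]$. (b) there exists $v\in\overline{k}^\times$ such that for every $\sigma\in G_k$ the polynomial ${}^\sigma\big(vf(M(x,y,z))\big)-vf(M(x,y,z))$ is divisible by $Q(M(x,y,z))$ in $\overline{k}[x,y,z]$; fix such a $v$ and a square root $\sqrt v$. Let $L'/k$ be a finite Galois extension containing $L$, the entries of $M$ and $v$, and set $g(x,y,z):=\frac{1}{[L':k]}\sum_{\tau\in\operatorname{Gal}(L'/k)}{}^\tau\big(vf(M(x,y,z))\big)$.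 Then $g\in k[x,y,z]$. (c) Let $C_0:\ t^2=g(x,y,z),\ Q(M(x,y,z))=0$, and $\psi_0:C_0\to C$, $(x,y,z,t)\mapsto(M(x,y,z),t/\sqrt v)$. Then $\psi_0$ is a $\overline{k}$-isomorphism, and for every $\sigma\in G_k$ the element $i(\sigma):=\xi(\sigma)^{-1}\circ\psi_0\circ{}^\sigma\psi_0^{-1}$ lies in $\langle\iota\rangle$; moreover $i:G_k\to\langle\iota\rangle$ is a group homomorphism. (d) Let $e\in k^\times$ be such that $k(\sqrt e)$ is the fixed field of $\ker i$ (with $e=1$ if $i$ is trivial). Then the curve \[ C':\ \begin{cases} e t^2=g(x,y,z)\\ Q(M(x,y,z))=0\end{cases} \] is defined over $k$, and the map $\phi:C'\to C$, $(x,y,z,t)\mapsto (M(x,y,z),\sqrt e\, t/\sqrt v)$, is a $\overline{k}$-isomorphism (a birational equivalence when $g$ is even) satisfying $\phi\circ{}^\sigma\phi^{-1}=\xi(\sigma)$ for all $\sigma\in G_k$; i.e. $C'$ is the twist of $C$ corresponding to $\xi$.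
   Context: A hyperelliptic curve over $k$ is a smooth projective curve of genus $g\ge1$ whose canonical morphism is a degree-$2$ map to a genus-$0$ curve; $\iota$ denotes its hyperelliptic involution, which in the model above is $t\mapsto -t$. The model lives in weighted projective space with $x,y,z$ of weight $1$ and $t$ of weight $d/2$; when $g$ is even this model may be singular and $C$ is identified with the smooth projective curve having the same function field. $\operatorname{Aut}(C)$ is the group of $\overline{k}$-automorphisms of $C$; each acts as $[x:y:z:t]\mapsto[N(x,y,z):\lambda t]$ with $N\in\operatorname{GL}_3(\overline{k})$, $\lambda\in\overline{k}^\times$, where $N(x,y,z)$ denotes the three entries of $N\cdot(x,y,z)^t$. $G_k$ acts on $\operatorname{Aut}(C)$ and on maps between curves by applying $\sigma$ to coefficients (${}^\sigma\alpha=\sigma\circ\alpha\circ\sigma^{-1}$), on matrices entrywise and on polynomials coefficientwise. A cocycle is a map $\xi$ with $\xi(\sigma\tau)=\xi(\sigma)\,{}^\sigma\xi(\tau)$. A twist of $C$ is a curve $C'/k$ with a $\overline{k}$-isomorphism $\phi:C'\to C$; it corresponds to the cocycle $\sigma\mapsto\phi\circ{}^\sigma\phi^{-1}$.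
   Formalization: The degree [L':k] is assumed to be nonzero in k wherever g(x,y,z) is used (the claim on g in (b), and all of (c) and (d)), since 1/[L':k] is undefined when the characteristic of k divides [L':k]. *)

theory Defs
  imports
    "HOL-Analysis.Determinants"
    "HOL-Analysis.Abstract_Topology"
    "HOL-Library.Poly_Mapping"
    "HOL-Library.Numeral_Type"
    "HOL-Algebra.Algebraic_Closure_Type"
    "HOL-Algebra.Bij"
    "HOL-Algebra.Coset"
    "HOL-Algebra.Embedded_Algebras"
    "HOL-Algebra.Generated_Fields"
begin

section \<open>Ternary polynomials\<close>

text \<open>The variables \<open>x\<close>, \<open>y\<close>, \<open>z\<close> are indexed by the elements \<open>1\<close>, \<open>2\<close>, \<open>3\<close> of the three-element
  type \<^typ>\<open>3\<close>, which also indexes the vectors and matrices below.\<close>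

type_synonym 'a mpoly3 = "(3 \<Rightarrow>\<^sub>0 nat) \<Rightarrow>\<^sub>0 'a"

definition const3 :: "'a::zero \<Rightarrow> 'a mpoly3" where
  "const3 c = Poly_Mapping.single 0 c"

definition var3 :: "3 \<Rightarrow> 'a::zero_neq_one mpoly3" where
  "var3 i = Poly_Mapping.single (Poly_Mapping.single i 1) 1"

definition eval3 :: "'a::comm_ring_1 mpoly3 \<Rightarrow> 'a ^ 3 \<Rightarrow> 'a" where
  "eval3 P p = (\<Sum>m\<in>Poly_Mapping.keys P.
     Poly_Mapping.lookup P m * (\<Prod>i\<in>UNIV. (p $ i) ^ Poly_Mapping.lookup m i))"

text \<open>\<open>subst3 N P\<close> is the polynomial \<open>P(N(x,y,z))\<close>.\<close>

definition subst3 :: "'a::comm_ring_1 ^ 3 ^ 3 \<Rightarrow> 'a mpoly3 \<Rightarrow> 'a mpoly3" where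
  "subst3 N P = (\<Sum>m\<in>Poly_Mapping.keys P.
     const3 (Poly_Mapping.lookup P m) *
     (\<Prod>i\<in>UNIV. (\<Sum>j\<in>UNIV. const3 (N $ i $ j) * var3 j) ^ Poly_Mapping.lookup m i))"

definition total_degree :: "(3 \<Rightarrow>\<^sub>0 nat) \<Rightarrow> nat" where
  "total_degree m = (\<Sum>i\<in>UNIV. Poly_Mapping.lookup m i)"

definition homogeneous3 :: "nat \<Rightarrow> 'a::zero mpoly3 \<Rightarrow> bool" where
  "homogeneous3 d P \<longleftrightarrow> (\<forall>m\<in>Poly_Mapping.keys P. total_degree m = d)"

definition conicQ :: "'a::comm_ring_1 \<Rightarrow> 'a \<Rightarrow> 'a mpoly3" where
  "conicQ a b = var3 3 ^ 2 - const3 a * var3 1 ^ 2 - const3 b * var3 2 ^ 2"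


section \<open>Galois theory inside the algebraic closure\<close>

text \<open>The base field is the type \<open>'k\<close>; it is embedded into its algebraic closure
  \<open>'k alg_closure\<close> by \<^const>\<open>to_ac\<close>.\<close>

definition perfect_field :: "'k::field itself \<Rightarrow> bool" where
  "perfect_field _ \<longleftrightarrow>
     (\<forall>p::'k poly. irreducible p \<longrightarrow> rsquarefree (map_poly to_ac p))"

definition base_field :: "'k::field alg_closure set" where
  "base_field = range to_ac"

definition intermediate_field :: "'k::field alg_closure set \<Rightarrow> bool" where
  "intermediate_field E \<longleftrightarrow> base_field \<subseteq> E \<and>
     (\<forall>x\<in>E. \<forall>y\<in>E. x + y \<in> E \<and> x * y \<in> E) \<and> (\<forall>x\<in>E. - x \<in> E \<and> inverse x \<in> E)"

definition adjoin :: "'k::field alg_closure \<Rightarrow> 'k alg_closure set" where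
  "adjoin r = \<Inter>{E. intermediate_field E \<and> r \<in> E}"

definition ext_scale :: "'k::field \<Rightarrow> 'k alg_closure \<Rightarrow> 'k alg_closure" where
  "ext_scale c x = to_ac c * x"

definition finite_ext :: "'k::field alg_closure set \<Rightarrow> bool" where
  "finite_ext E \<longleftrightarrow> intermediate_field E \<and> (\<exists>B. finite B \<and> E = module.span ext_scale B)"

definition ext_degree :: "'k::field alg_closure set \<Rightarrow> nat" where
  "ext_degree E = vector_space.dim ext_scale E"

text \<open>\<open>gal_set E\<close> is \<open>Gal(E/k)\<close>; its elements are functions on \<open>E\<close>, i.e. extensional.\<close>

definition gal_set :: "'k::field alg_closure set \<Rightarrow> ('k alg_closure \<Rightarrow> 'k alg_closure) set" where
  "gal_set E = {\<tau>. \<tau> \<in> extensional E \<and> bij_betw \<tau> E E \<and>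
     (\<forall>x\<in>E. \<forall>y\<in>E. \<tau> (x + y) = \<tau> x + \<tau> y \<and> \<tau> (x * y) = \<tau> x * \<tau> y) \<and>
     (\<forall>x\<in>base_field. \<tau> x = x)}"

definition finite_galois :: "'k::field alg_closure set \<Rightarrow> bool" where
  "finite_galois E \<longleftrightarrow> finite_ext E \<and> {x \<in> E. \<forall>\<tau>\<in>gal_set E. \<tau> x = x} = base_field"

definition abs_gal :: "('k::field alg_closure \<Rightarrow> 'k alg_closure) monoid" where
  "abs_gal = \<lparr>carrier = gal_set UNIV, monoid.mult = (\<circ>), one = id\<rparr>"

definition krull_topology :: "('k::field alg_closure \<Rightarrow> 'k alg_closure) topology" where
  "krull_topology = topology_generated_by
     {{\<tau> \<in> gal_set UNIV. \<forall>x\<in>E. \<tau> x = \<sigma> x} | \<sigma> E. \<sigma> \<in> gal_set UNIV \<and> finite_galois E}"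

definition fixed_field :: "('k::field alg_closure \<Rightarrow> 'k alg_closure) set \<Rightarrow> 'k alg_closure set" where
  "fixed_field H = {x. \<forall>\<sigma>\<in>H. \<sigma> x = x}"

definition gal_vec :: "('a \<Rightarrow> 'a) \<Rightarrow> 'a ^ 3 \<Rightarrow> 'a ^ 3" where
  "gal_vec \<sigma> p = (\<chi> i. \<sigma> (p $ i))"

definition gal_mat :: "('a \<Rightarrow> 'a) \<Rightarrow> 'a ^ 3 ^ 3 \<Rightarrow> 'a ^ 3 ^ 3" where
  "gal_mat \<sigma> N = (\<chi> i j. \<sigma> (N $ i $ j))"

definition gal_poly :: "('a \<Rightarrow> 'a) \<Rightarrow> 'a::zero mpoly3 \<Rightarrow> 'a mpoly3" where
  "gal_poly \<sigma> P = Poly_Mapping.map \<sigma> P"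

definition poly_over_k :: "'k::field alg_closure mpoly3 \<Rightarrow> bool" where
  "poly_over_k P \<longleftrightarrow> (\<forall>m. Poly_Mapping.lookup P m \<in> base_field)"


section \<open>Weighted projective space \<open>P(1,1,1,n)\<close>\<close>

text \<open>A point \<open>[x:y:z:t]\<close>, with \<open>t\<close> of weight \<open>n\<close>, is the set of all its homogeneous coordinates
  \<open>(p, t)\<close>, where \<open>p = (x,y,z)\<close>.\<close>

type_synonym 'a wpoint = "(('a ^ 3) \<times> 'a) set"

definition wpt :: "nat \<Rightarrow> 'a::field ^ 3 \<Rightarrow> 'a \<Rightarrow> 'a wpoint" where
  "wpt n p t = {(c *s p, c ^ n * t) | c. c \<noteq> 0}"

text \<open>\<open>k[x,y,z,t]\<close> is rendered as \<open>k[x,y,z][t]\<close>.\<close>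

definition weval :: "'a::comm_ring_1 mpoly3 poly \<Rightarrow> 'a ^ 3 \<Rightarrow> 'a \<Rightarrow> 'a" where
  "weval P p t = poly (map_poly (\<lambda>A. eval3 A p) P) t"

definition whomogeneous :: "nat \<Rightarrow> nat \<Rightarrow> 'a::comm_ring_1 mpoly3 poly \<Rightarrow> bool" where
  "whomogeneous n m P \<longleftrightarrow>
     (\<forall>i. \<forall>e\<in>Poly_Mapping.keys (Polynomial.coeff P i). total_degree e + n * i = m)"

definition wlocus :: "nat \<Rightarrow> 'a::field mpoly3 poly set \<Rightarrow> 'a wpoint set" where
  "wlocus n S = {wpt n p t | p t. (p \<noteq> 0 \<or> t \<noteq> 0) \<and> (\<forall>P\<in>S. weval P p t = 0)}"

definition locus_over_k :: "nat \<Rightarrow> 'k::field alg_closure wpoint set \<Rightarrow> bool" where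
  "locus_over_k n Z \<longleftrightarrow> (\<exists>S. Z = wlocus n S \<and>
     (\<forall>P\<in>S. (\<exists>m. whomogeneous n m P) \<and> (\<forall>i. poly_over_k (Polynomial.coeff P i))))"

text \<open>The equations \<open>Q = 0\<close> and \<open>e t\<^sup>2 = f\<close> of a double cover of a conic.\<close>

definition model_eqs ::
    "'a::comm_ring_1 \<Rightarrow> 'a mpoly3 \<Rightarrow> 'a mpoly3 \<Rightarrow> 'a mpoly3 poly set" where
  "model_eqs e f Q = {[: Q :], [: - f, 0, const3 e :]}"

definition model :: "nat \<Rightarrow> 'a::field \<Rightarrow> 'a mpoly3 \<Rightarrow> 'a mpoly3 \<Rightarrow> 'a wpoint set" where
  "model n e f Q = wlocus n (model_eqs e f Q)"

text \<open>Morphisms are maps on closed points which, near every point, are given by weighted homogeneous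
  polynomials of degrees \<open>m\<close>, \<open>m\<close>, \<open>m\<close>, \<open>m n\<close> without common zero.  The loci considered
  do not contain the point \<open>[0:0:0:1]\<close>, where the weighted projective space is singular.\<close>

definition regular_map :: "nat \<Rightarrow> 'a::field wpoint set \<Rightarrow> ('a wpoint \<Rightarrow> 'a wpoint) \<Rightarrow> bool" where
  "regular_map n Z \<psi> \<longleftrightarrow> (\<forall>x\<in>Z. \<exists>m (P :: 3 \<Rightarrow> 'a mpoly3 poly) T.
     (\<forall>j. whomogeneous n m (P j)) \<and> whomogeneous n (m * n) T \<and>
     (\<exists>p t. x = wpt n p t \<and> ((\<chi> j. weval (P j) p t) \<noteq> 0 \<or> weval T p t \<noteq> 0)) \<and>
     (\<forall>p t. wpt n p t \<in> Z \<and> ((\<chi> j. weval (P j) p t) \<noteq> 0 \<or> weval T p t \<noteq> 0) \<longrightarrow>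
        \<psi> (wpt n p t) = wpt n (\<chi> j. weval (P j) p t) (weval T p t)))"

definition map_inv :: "'p set \<Rightarrow> 'q set \<Rightarrow> ('p \<Rightarrow> 'q) \<Rightarrow> ('q \<Rightarrow> 'p)" where
  "map_inv Z Y \<psi> = restrict (inv_into Z \<psi>) Y"

definition curve_iso ::
    "nat \<Rightarrow> 'a::field wpoint set \<Rightarrow> 'a wpoint set \<Rightarrow> ('a wpoint \<Rightarrow> 'a wpoint) \<Rightarrow> bool" where
  "curve_iso n Z Y \<psi> \<longleftrightarrow> \<psi> \<in> extensional Z \<and> bij_betw \<psi> Z Y \<and>
     regular_map n Z \<psi> \<and> regular_map n Y (map_inv Z Y \<psi>)"

definition aut_group :: "nat \<Rightarrow> 'a::field wpoint set \<Rightarrow> ('a wpoint \<Rightarrow> 'a wpoint) monoid" where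
  "aut_group n Z = (BijGroup Z)\<lparr>carrier := {\<alpha>. curve_iso n Z Z \<alpha>}\<rparr>"

text \<open>\<open>wlin N l\<close> is \<open>[x:y:z:t] \<mapsto> [N(x,y,z) : l t]\<close>, the image being taken on the set of all
  homogeneous coordinates.\<close>

definition wlin :: "'a::field ^ 3 ^ 3 \<Rightarrow> 'a \<Rightarrow> 'a wpoint \<Rightarrow> 'a wpoint" where
  "wlin N l x = (\<lambda>(p, t). (N *v p, l * t)) ` x"

definition hyp_involution :: "'a::field wpoint set \<Rightarrow> 'a wpoint \<Rightarrow> 'a wpoint" where
  "hyp_involution Z = restrict (wlin (mat 1) (- 1)) Z"

definition involution_group :: "'a::field wpoint set \<Rightarrow> ('a wpoint \<Rightarrow> 'a wpoint) monoid" where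
  "involution_group Z = (BijGroup Z)\<lparr>carrier := generate (BijGroup Z) {hyp_involution Z}\<rparr>"

definition gal_point :: "('a \<Rightarrow> 'a) \<Rightarrow> 'a wpoint \<Rightarrow> 'a wpoint" where
  "gal_point \<sigma> x = (\<lambda>(p, t). (gal_vec \<sigma> p, \<sigma> t)) ` x"

text \<open>The conjugate \<open>\<sigma> \<circ> \<alpha> \<circ> \<sigma>\<^sup>-\<^sup>1\<close> of a map \<open>\<alpha>\<close> with domain \<open>Z\<close> defined over \<open>k\<close>.\<close>

definition gal_map ::
    "('a \<Rightarrow> 'a) \<Rightarrow> 'a wpoint set \<Rightarrow> ('a wpoint \<Rightarrow> 'a wpoint) \<Rightarrow> ('a wpoint \<Rightarrow> 'a wpoint)" where
  "gal_map \<sigma> Z \<alpha> = (\<lambda>x\<in>Z. gal_point \<sigma> (\<alpha> (gal_point (inv_into UNIV \<sigma>) x)))"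

definition cocycle ::
    "nat \<Rightarrow> 'k::field alg_closure wpoint set \<Rightarrow>
     (('k alg_closure \<Rightarrow> 'k alg_closure) \<Rightarrow> 'k alg_closure wpoint \<Rightarrow> 'k alg_closure wpoint) \<Rightarrow> bool"
  where
  "cocycle n Z \<xi> \<longleftrightarrow> \<xi> \<in> carrier abs_gal \<rightarrow> carrier (aut_group n Z) \<and>
     (\<forall>\<sigma>\<in>carrier abs_gal. \<forall>\<tau>\<in>carrier abs_gal.
        \<xi> (\<sigma> \<otimes>\<^bsub>abs_gal\<^esub> \<tau>) = \<xi> \<sigma> \<otimes>\<^bsub>aut_group n Z\<^esub> gal_map \<sigma> Z (\<xi> \<tau>))"

text \<open>The matrix \<open>N\<close> acts on \<open>[x:y:z]\<close> as \<open>\<alpha>\<close> does.  Scaling \<open>N\<close> only changes \<open>t'\<close>, so this depends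
  on the class of \<open>N\<close> in \<open>PGL\<^sub>3\<close> only.\<close>

definition acts_on_conic ::
    "nat \<Rightarrow> 'a::field wpoint set \<Rightarrow> ('a wpoint \<Rightarrow> 'a wpoint) \<Rightarrow> 'a ^ 3 ^ 3 \<Rightarrow> bool" where
  "acts_on_conic n Z \<alpha> N \<longleftrightarrow>
     (\<forall>p t. wpt n p t \<in> Z \<longrightarrow> (\<exists>t'. \<alpha> (wpt n p t) = wpt n (N *v p) t'))"

definition is_normalized_matrix ::
    "nat \<Rightarrow> 'a::field wpoint set \<Rightarrow> 'a mpoly3 \<Rightarrow> ('a wpoint \<Rightarrow> 'a wpoint) \<Rightarrow> 'a ^ 3 ^ 3 \<Rightarrow> bool" where
  "is_normalized_matrix n Z Q \<alpha> N \<longleftrightarrow> det N = 1 \<and> subst3 N Q = Q \<and> acts_on_conic n Z \<alpha> N"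

definition normalized_matrix ::
    "nat \<Rightarrow> 'a::field wpoint set \<Rightarrow> 'a mpoly3 \<Rightarrow> ('a wpoint \<Rightarrow> 'a wpoint) \<Rightarrow> 'a ^ 3 ^ 3" where
  "normalized_matrix n Z Q \<alpha> = (THE N. is_normalized_matrix n Z Q \<alpha> N)"


section \<open>Function fields, genus and hyperellipticity\<close>

text \<open>For a prime ideal \<open>I\<close> generated by weighted homogeneous polynomials, \<open>function_field n I\<close> is the
  function field of the integral subscheme of \<open>P(1,1,1,n)\<close> defined by \<open>I\<close>: the field of fractions
  \<open>A/B\<close> of weighted homogeneous polynomials of equal degree, with \<open>B\<close> outside \<open>I\<close>, modulo \<open>I\<close>.\<close>

definition prime_ideal :: "'r::comm_ring_1 set \<Rightarrow> bool" where
  "prime_ideal I \<longleftrightarrow> module.span (*) I = I \<and> 1 \<notin> I \<and> (\<forall>A B. A * B \<in> I \<longrightarrow> A \<in> I \<or> B \<in> I)"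

definition hfracs ::
    "nat \<Rightarrow> 'a::field mpoly3 poly set \<Rightarrow> ('a mpoly3 poly \<times> 'a mpoly3 poly) set" where
  "hfracs n I = {(A, B). (\<exists>m. whomogeneous n m A \<and> whomogeneous n m B) \<and> B \<notin> I}"

definition hfrac ::
    "nat \<Rightarrow> 'a::field mpoly3 poly set \<Rightarrow> 'a mpoly3 poly \<Rightarrow> 'a mpoly3 poly \<Rightarrow>
     ('a mpoly3 poly \<times> 'a mpoly3 poly) set" where
  "hfrac n I A B = {(A', B'). (A', B') \<in> hfracs n I \<and> A * B' - A' * B \<in> I}"

definition function_field ::
    "nat \<Rightarrow> 'a::field mpoly3 poly set \<Rightarrow> ('a mpoly3 poly \<times> 'a mpoly3 poly) set ring" where
  "function_field n I = \<lparr>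
     carrier = {hfrac n I A B | A B. (A, B) \<in> hfracs n I},
     monoid.mult = (\<lambda>Z Y. \<Union>(A, B)\<in>Z. \<Union>(A', B')\<in>Y. hfrac n I (A * A') (B * B')),
     one = hfrac n I 1 1,
     ring.zero = hfrac n I 0 1,
     add = (\<lambda>Z Y. \<Union>(A, B)\<in>Z. \<Union>(A', B')\<in>Y. hfrac n I (A * B' + A' * B) (B * B'))\<rparr>"

definition constant_field ::
    "nat \<Rightarrow> 'a::field mpoly3 poly set \<Rightarrow> ('a mpoly3 poly \<times> 'a mpoly3 poly) set set" where
  "constant_field n I = {hfrac n I [: const3 c :] 1 | c. True}"

text \<open>In the rest of this section \<open>F\<close> is a function field in one variable over an algebraically closed
  field \<open>K\<close> (a subset of \<open>F\<close>); its places are the closed points of the smooth projective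
  curve with function field \<open>F\<close>, given by their local rings.\<close>

definition places :: "'b ring \<Rightarrow> 'b set \<Rightarrow> 'b set set" where
  "places F K = {V. subring V F \<and> K \<subseteq> V \<and> V \<noteq> carrier F \<and>
     (\<forall>x\<in>carrier F - {\<zero>\<^bsub>F\<^esub>}. x \<in> V \<or> inv\<^bsub>F\<^esub> x \<in> V)}"

definition derivations :: "'b ring \<Rightarrow> 'b set \<Rightarrow> ('b \<Rightarrow> 'b) set" where
  "derivations F K = {D \<in> carrier F \<rightarrow>\<^sub>E carrier F.
     (\<forall>x\<in>carrier F. \<forall>y\<in>carrier F. D (x \<oplus>\<^bsub>F\<^esub> y) = D x \<oplus>\<^bsub>F\<^esub> D y \<and>
        D (x \<otimes>\<^bsub>F\<^esub> y) = (x \<otimes>\<^bsub>F\<^esub> D y) \<oplus>\<^bsub>F\<^esub> (y \<otimes>\<^bsub>F\<^esub> D x)) \<and>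
     (\<forall>c\<in>K. D c = \<zero>\<^bsub>F\<^esub>)}"

text \<open>The Kaehler differentials of \<open>F/K\<close> are identified with functions on the derivations, \<open>dx\<close> being
  \<open>D \<mapsto> D x\<close>.  \<open>differentials F K V\<close> is the \<open>V\<close>-module spanned by all \<open>dx\<close> with \<open>x\<close> in \<open>V\<close>.\<close>

inductive_set differentials :: "'b ring \<Rightarrow> 'b set \<Rightarrow> 'b set \<Rightarrow> (('b \<Rightarrow> 'b) \<Rightarrow> 'b) set"
  for F :: "'b ring" and K :: "'b set" and V :: "'b set" where
    zero: "(\<lambda>D\<in>derivations F K. \<zero>\<^bsub>F\<^esub>) \<in> differentials F K V"
  | step: "\<lbrakk>\<omega> \<in> differentials F K V; u \<in> V; x \<in> V\<rbrakk> \<Longrightarrow>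
      (\<lambda>D\<in>derivations F K. \<omega> D \<oplus>\<^bsub>F\<^esub> (u \<otimes>\<^bsub>F\<^esub> D x)) \<in> differentials F K V"

definition regular_differentials :: "'b ring \<Rightarrow> 'b set \<Rightarrow> (('b \<Rightarrow> 'b) \<Rightarrow> 'b) set" where
  "regular_differentials F K = {\<omega> \<in> differentials F K (carrier F).
     \<forall>V\<in>places F K. \<omega> \<in> differentials F K V}"

text \<open>The genus is the dimension over \<open>K\<close> of the space of regular differentials.\<close>

definition has_genus :: "'b ring \<Rightarrow> 'b set \<Rightarrow> nat \<Rightarrow> bool" where
  "has_genus F K g \<longleftrightarrow> (\<exists>w. (\<forall>i<g. w i \<in> regular_differentials F K) \<and>
     (\<forall>\<omega>\<in>regular_differentials F K. \<exists>!c. c \<in> {..<g} \<rightarrow>\<^sub>E K \<and>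
        \<omega> = (\<lambda>D\<in>derivations F K. \<Oplus>\<^bsub>F\<^esub>i\<in>{..<g}. c i \<otimes>\<^bsub>F\<^esub> w i D)))"

text \<open>The function field of the image of the canonical morphism is generated by the quotients of regular
  differentials.\<close>

definition canonical_subfield :: "'b ring \<Rightarrow> 'b set \<Rightarrow> 'b set" where
  "canonical_subfield F K = generate_field F (K \<union>
     {h \<in> carrier F. \<exists>\<omega>\<in>regular_differentials F K. \<exists>\<eta>\<in>regular_differentials F K.
        \<eta> \<noteq> (\<lambda>D\<in>derivations F K. \<zero>\<^bsub>F\<^esub>) \<and> \<omega> = (\<lambda>D\<in>derivations F K. h \<otimes>\<^bsub>F\<^esub> \<eta> D)})"

definition hyperelliptic_field :: "'b ring \<Rightarrow> 'b set \<Rightarrow> nat \<Rightarrow> bool" where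
  "hyperelliptic_field F K g \<longleftrightarrow> g \<ge> 1 \<and> has_genus F K g \<and>
     ring.dimension F 2 (canonical_subfield F K) (carrier F) \<and>
     has_genus (F\<lparr>carrier := canonical_subfield F K\<rparr>) K 0"

text \<open>The equations define a (geometrically) integral curve, and the smooth projective curve with the
  same function field is hyperelliptic of genus \<open>g\<close>.\<close>

definition hyperelliptic_model ::
    "nat \<Rightarrow> nat \<Rightarrow> 'a::alg_closed_field mpoly3 \<Rightarrow> 'a mpoly3 \<Rightarrow> bool" where
  "hyperelliptic_model g n f Q \<longleftrightarrow>
     (let I = module.span (*) (model_eqs 1 f Q)
      in prime_ideal I \<and> hyperelliptic_field (function_field n I) (constant_field n I) g)"

end

theory Submission
  imports Defs
begin

text \<open>Every \<open>\<xi> \<sigma>\<close> is \<open>[p : t] \<mapsto> [N p : l t]\<close> for a unique isometry \<open>N\<close> of \<open>Q\<close> of determinant \<open>1\<close> and a unique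
  \<open>l\<close>, and then \<open>f(N p) = l\<^sup>2 f(p)\<close> on the conic.  Both \<open>N\<close> and \<open>l\<close> are cocycles that only depend on
  finitely many values of \<open>\<sigma>\<close>, so Hilbert 90 gives \<open>M\<close> with \<open>N = M \<cdot> \<sigma>(M)\<^sup>-\<^sup>1\<close> and \<open>w\<close> with
  \<open>l = w / \<sigma>(w)\<close>; the condition on \<open>v\<close> amounts to \<open>\<sigma>(v) = v l\<^sup>2\<close>, which \<open>1 / w\<^sup>2\<close> satisfies.  On the conic
  \<open>Q(M p) = 0\<close> all conjugates of \<open>v f(M p)\<close> agree, so their mean has the same values there.  Finally
  \<open>i(\<sigma>)\<close> multiplies \<open>t\<close> by the sign \<open>\<epsilon>(\<sigma>) = \<sigma>(\<surd>v) / (\<surd>v l)\<close>, and a square root of \<open>e\<close> is multiplied by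
  exactly this sign.\<close>

section \<open>Ternary polynomials\<close>

text \<open>Uniqueness of N and l is what turns the automorphisms \<open>\<xi> \<sigma>\<close> into
  two honest cocycles. For N it rests on odd dimension: if two isometries of Q with the same
  determinant are proportional, the scalar c satisfies c^2 = 1 and c^3 = 1. For l one needs a point
  of the conic where f is nonzero; if there were none, Q would divide f and the ideal of the model
  would not be prime. The equation of the curve sees only l^2; the lost sign is the character that e
  restores. Polynomial identities and divisibility by Q are both checked on values: an algebraically
  closed field is infinite, and every polynomial vanishing on the conic is a multiple of Q. Descent
  to k needs an automorphism of the closure moving a given element outside k; it comes from
  extending partial embeddings by Zorn's lemma, and perfectness provides the second conjugate. The
  mean defining g divides by the degree but sums over the Galois group, so the two numbers have to
  be shown equal.\<close>

lemma lookup_map_0: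
  assumes "h 0 = 0" shows "Poly_Mapping.lookup (Poly_Mapping.map h P) m = h (Poly_Mapping.lookup P m)"
  using assms by (simp add: Poly_Mapping.map.rep_eq when_def)

lemma eval3_superset:
  assumes "finite A" "Poly_Mapping.keys P \<subseteq> A"
  shows "eval3 P p = (\<Sum>m\<in>A. Poly_Mapping.lookup P m * (\<Prod>i\<in>UNIV. (p $ i) ^ Poly_Mapping.lookup m i))"
  unfolding eval3_def using assms
  by (intro sum.mono_neutral_left) (auto simp: in_keys_iff)

lemma eval3_0 [simp]: "eval3 0 p = 0"
  by (simp add: eval3_def)

lemma eval3_single: "eval3 (Poly_Mapping.single m c) p = c * (\<Prod>i\<in>UNIV. (p $ i) ^ Poly_Mapping.lookup m i)"
  by (subst eval3_superset[of "{m}"]) auto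

lemma eval3_const3 [simp]: "eval3 (const3 c) p = c"
  by (simp add: const3_def eval3_single)

lemma const3_0: "const3 0 = 0" and const3_1: "const3 1 = 1"
  by (simp_all add: const3_def)

lemma eval3_1 [simp]: "eval3 1 p = 1"
  using eval3_const3[of 1 p] by (simp add: const3_def)

lemma eval3_var3 [simp]: "eval3 (var3 i) p = p $ i"
proof -
  have "(\<Prod>j\<in>UNIV. (p $ j) ^ Poly_Mapping.lookup (Poly_Mapping.single i 1) j)
      = (\<Prod>j\<in>UNIV. if j = i then p $ j else 1)"
    by (intro prod.cong) (auto simp: lookup_single when_def)
  then show ?thesis by (simp add: var3_def eval3_single)
qed

lemma eval3_add [simp]: "eval3 (P + R) p = eval3 P p + eval3 R p"
proof -
  let ?A = "Poly_Mapping.keys P \<union> Poly_Mapping.keys R"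
  have "Poly_Mapping.keys (P + R) \<subseteq> ?A" by (rule Poly_Mapping.keys_add)
  then show ?thesis
    by (simp add: eval3_superset[of ?A] lookup_add distrib_right sum.distrib)
qed

lemma eval3_sum [simp]: "eval3 (\<Sum>x\<in>A. P x) p = (\<Sum>x\<in>A. eval3 (P x) p)"
  by (induction A rule: infinite_finite_induct) auto

lemma poly_mapping_sum_single: "P = (\<Sum>m\<in>Poly_Mapping.keys P. Poly_Mapping.single m (Poly_Mapping.lookup P m))"
  by (rule poly_mapping_eqI)
    (auto simp: lookup_sum lookup_single when_def sum.delta in_keys_iff)

lemma eval3_mult [simp]: "eval3 (P * R) p = eval3 P p * eval3 R p"
proof -
  have single: "eval3 (Poly_Mapping.single m c * Poly_Mapping.single m' c') p =
      eval3 (Poly_Mapping.single m c) p * eval3 (Poly_Mapping.single m' c') p" for m m' c c'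
    by (simp add: mult_single eval3_single lookup_add power_add prod.distrib algebra_simps)
  have "eval3 (P * R) p = eval3 ((\<Sum>m\<in>Poly_Mapping.keys P. Poly_Mapping.single m (Poly_Mapping.lookup P m)) *
      (\<Sum>m\<in>Poly_Mapping.keys R. Poly_Mapping.single m (Poly_Mapping.lookup R m))) p"
    by (simp only: poly_mapping_sum_single[symmetric])
  also have "\<dots> = eval3 (\<Sum>m\<in>Poly_Mapping.keys P. Poly_Mapping.single m (Poly_Mapping.lookup P m)) p *
      eval3 (\<Sum>m\<in>Poly_Mapping.keys R. Poly_Mapping.single m (Poly_Mapping.lookup R m)) p"
    by (simp add: sum_product single)
  finally show ?thesis by (simp only: poly_mapping_sum_single[symmetric])
qed

lemma eval3_uminus [simp]: "eval3 (- P) p = - eval3 P p"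
  using eval3_add[of P "- P" p] by (simp add: eq_neg_iff_add_eq_0 add.commute)

lemma eval3_diff [simp]: "eval3 (P - R) p = eval3 P p - eval3 R p"
  using eval3_add[of P "- R" p] by simp

lemma eval3_power [simp]: "eval3 (P ^ n) p = eval3 P p ^ n"
  by (induction n) auto

lemma eval3_prod [simp]: "eval3 (\<Prod>x\<in>A. P x) p = (\<Prod>x\<in>A. eval3 (P x) p)"
  by (induction A rule: infinite_finite_induct) auto

lemma eval3_conicQ [simp]: "eval3 (conicQ a b) p = (p $ 3)\<^sup>2 - a * (p $ 1)\<^sup>2 - b * (p $ 2)\<^sup>2"
  by (simp add: conicQ_def)

lemma eval3_subst3 [simp]: "eval3 (subst3 N P) p = eval3 P (N *v p)"
  by (simp add: subst3_def matrix_vector_mult_def) (simp add: eval3_def matrix_vector_mult_def)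

lemma mpoly3_monomial: "Poly_Mapping.single m c = const3 c * (\<Prod>i\<in>UNIV. var3 i ^ Poly_Mapping.lookup m i)"
  for c :: "'a::comm_ring_1"
proof -
  have pow: "var3 i ^ n = Poly_Mapping.single (Poly_Mapping.single i n) (1::'a)" for i n
    by (induction n) (auto simp: var3_def mult_single single_add[symmetric])
  have prod: "(\<Prod>i\<in>A. Poly_Mapping.single (g i) (1::'a)) = Poly_Mapping.single (\<Sum>i\<in>A. g i) 1"
    if "finite A" for A :: "3 set" and g :: "3 \<Rightarrow> 3 \<Rightarrow>\<^sub>0 nat"
    using that by induction (auto simp: mult_single)
  have "(\<Sum>i\<in>UNIV. Poly_Mapping.single i (Poly_Mapping.lookup m i)) = m"
    by (rule poly_mapping_eqI) (simp add: lookup_sum lookup_single when_def sum.delta)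
  then show ?thesis
    by (simp add: pow prod const3_def mult_single)
qed

lemma mpoly3_induct [case_names const var add mult]:
  fixes P :: "'a::comm_ring_1 mpoly3"
  assumes "\<And>c. R (const3 c)" "\<And>i. R (var3 i)"
    "\<And>A B. R A \<Longrightarrow> R B \<Longrightarrow> R (A + B)" "\<And>A B. R A \<Longrightarrow> R B \<Longrightarrow> R (A * B)"
  shows "R P"
proof -
  have 0: "R 0" and 1: "R 1" using assms(1)[of 0] assms(1)[of 1] by (simp_all add: const3_def)
  have pow: "R A \<Longrightarrow> R (A ^ n)" for A n by (induction n) (auto simp: 1 assms)
  have prod: "(\<And>x. x \<in> S \<Longrightarrow> R (A x)) \<Longrightarrow> R (\<Prod>x\<in>S. A x)" for A :: "3 \<Rightarrow> _" and S
    by (induction S rule: infinite_finite_induct) (auto simp: 1 assms)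
  have sum: "(\<And>x. x \<in> S \<Longrightarrow> R (A x)) \<Longrightarrow> R (\<Sum>x\<in>S. A x)" for A :: "(3 \<Rightarrow>\<^sub>0 nat) \<Rightarrow> _" and S
    by (induction S rule: infinite_finite_induct) (auto simp: 0 assms)
  have "R (\<Sum>m\<in>Poly_Mapping.keys P. Poly_Mapping.single m (Poly_Mapping.lookup P m))"
    unfolding mpoly3_monomial by (intro sum assms(4) prod pow assms(1,2))
  then show ?thesis by (simp only: poly_mapping_sum_single[symmetric])
qed

text \<open>Euclid's argument: over a finite field, 1 plus the product of all X - x takes only the
  value 1, although its degree is positive.\<close>

lemma infinite_UNIV_alg_closed: "infinite (UNIV :: 'a::alg_closed_field set)"
proof
  assume fin: "finite (UNIV :: 'a set)"
  define p where "p = (\<Prod>x\<in>UNIV. [:- x, 1:]) + (1 :: 'a poly)"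
  have "poly p x = 1" for x
    using fin by (simp add: p_def poly_prod prod_zero_iff)
  moreover have "Polynomial.degree (\<Prod>x\<in>UNIV. [:- x, 1 :: 'a:]) = card (UNIV :: 'a set)"
    by (subst degree_prod_eq_sum_degree) auto
  then have "Polynomial.degree p = card (UNIV :: 'a set)"
    using fin unfolding p_def by (subst degree_add_eq_left) (auto simp: finite_UNIV_card_ge_0)
  then have "Polynomial.degree p > 0" using fin by (simp add: finite_UNIV_card_ge_0)
  ultimately show False using alg_closed_imp_poly_has_root[of p] by auto
qed

text \<open>Kronecker substitution \<open>(s, s\<^sup>N, s\<^bsup>N\<^sup>2\<^esup>)\<close> keeps the monomials of \<open>P\<close> apart.\<close>

lemma mpoly3_eqI:
  fixes P R :: "'a::alg_closed_field mpoly3"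
  assumes "\<And>p. eval3 P p = eval3 R p"
  shows "P = R"
proof -
  define D where "D = P - R"
  have D: "eval3 D p = 0" for p using assms by (simp add: D_def)
  let ?l = Poly_Mapping.lookup
  obtain N where N: "\<And>m i. m \<in> Poly_Mapping.keys D \<Longrightarrow> ?l m i < N"
  proof -
    have "finite ((\<lambda>(m, i). ?l m i) ` (Poly_Mapping.keys D \<times> (UNIV :: 3 set)))" by simp
    then obtain N where "\<forall>x \<in> (\<lambda>(m, i). ?l m i) ` (Poly_Mapping.keys D \<times> (UNIV :: 3 set)). x < N"
      using finite_nat_set_iff_bounded by blast
    then show ?thesis by (intro that[of N]) auto
  qed
  \<comment> \<open>The exponent that s receives from the monomial m. Its base N digits are the
    exponents of m, which are all below N, so distinct monomials stay distinct.\<close>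
  define \<kappa> where "\<kappa> m = ?l m 1 + N * (?l m 2 + N * ?l m 3)" for m :: "3 \<Rightarrow>\<^sub>0 nat"
  have inj: "inj_on \<kappa> (Poly_Mapping.keys D)"
  proof (rule inj_onI)
    fix m m' assume m: "m \<in> Poly_Mapping.keys D" "m' \<in> Poly_Mapping.keys D" and eq: "\<kappa> m = \<kappa> m'"
    have digit: "a = a' \<and> b = b'" if "a + N * b = a' + N * b'" "a < N" "a' < N" for a b a' b'
    proof -
      have "(a + N * b) mod N = (a' + N * b') mod N" using that(1) by simp
      then have "a = a'" using that(2,3) by simp
      then show ?thesis using that by simp
    qed
    have "?l m 1 = ?l m' 1 \<and> ?l m 2 + N * ?l m 3 = ?l m' 2 + N * ?l m' 3"
      using digit eq N m unfolding \<kappa>_def by blast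
    then have "\<forall>i. ?l m i = ?l m' i"
      using digit[of "?l m 2" "?l m 3" "?l m' 2" "?l m' 3"] N m by (simp add: forall_3)
    then show "m = m'" by (intro poly_mapping_eqI) simp
  qed
  \<comment> \<open>The univariate polynomial that D becomes under the substitution; it has every
    element of an infinite field as a root.\<close>
  define U where "U = (\<Sum>m\<in>Poly_Mapping.keys D. Polynomial.monom (?l D m) (\<kappa> m))"
  have "poly U s = 0" for s
  proof -
    let ?v = "vector [s, s ^ N, s ^ (N * N)] :: 'a ^ 3"
    have "s ^ \<kappa> m = (\<Prod>i\<in>UNIV. (?v $ i) ^ ?l m i)" for m
    proof -
      have "(\<Prod>i\<in>UNIV. (?v $ i) ^ ?l m i) = s ^ ?l m 1 * (s ^ N) ^ ?l m 2 * (s ^ (N * N)) ^ ?l m 3"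
        unfolding UNIV_3 by (simp add: mult.assoc)
      also have "\<dots> = s ^ (?l m 1 + N * ?l m 2 + N * N * ?l m 3)"
        by (simp only: power_add power_mult)
      also have "?l m 1 + N * ?l m 2 + N * N * ?l m 3 = \<kappa> m"
        by (simp add: \<kappa>_def distrib_left)
      finally show ?thesis by simp
    qed
    then have "poly U s = eval3 D ?v"
      by (simp add: U_def poly_sum poly_monom eval3_def)
    then show ?thesis using D by simp
  qed
  then have "{s. poly U s = 0} = UNIV" by simp
  then have U0: "U = 0" using poly_roots_finite[of U] infinite_UNIV_alg_closed by metis
  have "?l D m = 0" if m: "m \<in> Poly_Mapping.keys D" for m
  proof -
    have "Polynomial.coeff U (\<kappa> m) = (\<Sum>m'\<in>Poly_Mapping.keys D. if m' = m then ?l D m' else 0)"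
      unfolding U_def coeff_sum coeff_monom using inj m
      by (intro sum.cong) (auto dest: inj_onD)
    then show ?thesis using U0 m by simp
  qed
  then have "D = 0" by (intro poly_mapping_eqI) (metis in_keys_iff lookup_zero)
  then show ?thesis by (simp add: D_def)
qed

lemma subst3_subst3: "subst3 N (subst3 M P) = subst3 (M ** N) P" for P :: "'a::alg_closed_field mpoly3"
  by (rule mpoly3_eqI) (simp add: matrix_vector_mul_assoc)

lemma subst3_mat_1 [simp]: "subst3 (mat 1) P = P" for P :: "'a::alg_closed_field mpoly3"
  by (rule mpoly3_eqI) simp

lemma subst3_mult: "subst3 N (P * R) = subst3 N P * subst3 N R" for P :: "'a::alg_closed_field mpoly3"
  by (rule mpoly3_eqI) simp

lemma subst3_dvd: "P dvd R \<Longrightarrow> subst3 N P dvd subst3 N R" for P :: "'a::alg_closed_field mpoly3"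
  by (auto simp: dvd_def subst3_mult)

section \<open>Reduction modulo the equation of the conic\<close>

lemma alg_closed_sqrt: "\<exists>y. y\<^sup>2 = (x :: 'a::alg_closed_field)"
  using nth_root_exists[of 2 x] by auto

text \<open>Independence of z is expressed through values and not through monomials, so that it
  passes to sums and products at once and applies directly when two points are compared.\<close>

definition zfree :: "'a::comm_ring_1 mpoly3 \<Rightarrow> bool" where
  "zfree P \<longleftrightarrow> (\<forall>p q. p $ 1 = q $ 1 \<longrightarrow> p $ 2 = q $ 2 \<longrightarrow> eval3 P p = eval3 P q)"

lemma zfreeD: "zfree P \<Longrightarrow> p $ 1 = q $ 1 \<Longrightarrow> p $ 2 = q $ 2 \<Longrightarrow> eval3 P p = eval3 P q"
  unfolding zfree_def by blast

lemma zfree_add: "zfree P \<Longrightarrow> zfree R \<Longrightarrow> zfree (P + R)"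
  unfolding zfree_def eval3_add eval3_mult by metis

lemma zfree_mult: "zfree P \<Longrightarrow> zfree R \<Longrightarrow> zfree (P * R)"
  unfolding zfree_def eval3_add eval3_mult by metis

lemma zfree_power: "zfree P \<Longrightarrow> zfree (P ^ n)"
  unfolding zfree_def eval3_power by metis

lemma zfree_const: "zfree (const3 c)"
  by (simp add: zfree_def)

lemma zfree_var: "i = 1 \<or> i = 2 \<Longrightarrow> zfree (var3 i)"
  by (auto simp: zfree_def)

text \<open>Division by Q, which is monic of degree 2 in z. Induction over the ring operations
  avoids leading terms: the only case with work is a product, where z^2 is replaced by Q + S with S
  = a x^2 + b y^2.\<close>

lemma conicQ_division:
  fixes P :: "'a::comm_ring_1 mpoly3"
  shows "\<exists>A B D. P = A * conicQ a b + (var3 3 * B + D) \<and> zfree B \<and> zfree D"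
proof (induction P rule: mpoly3_induct)
  case (const c)
  have "const3 c = 0 * conicQ a b + (var3 3 * 0 + const3 c)" by simp
  then show ?case using zfree_const[of c] zfree_const[of 0] by (metis const3_0)
next
  case (var i)
  consider "i = 3" | "i = 1 \<or> i = 2" using exhaust_3 by blast
  then show ?case
  proof cases
    case 1
    have "var3 i = 0 * conicQ a b + (var3 3 * 1 + 0)" by (simp add: 1)
    then show ?thesis using zfree_const[of 0] zfree_const[of 1] by (metis const3_0 const3_1)
  next
    case 2
    have "var3 i = 0 * conicQ a b + (var3 3 * 0 + var3 i)" by simp
    then show ?thesis using zfree_const[of 0] zfree_var[OF 2] by (metis const3_0)
  qed
next
  case (add P P')
  then obtain A B D A' B' D' where *: "P = A * conicQ a b + (var3 3 * B + D)" "zfree B" "zfree D"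
    "P' = A' * conicQ a b + (var3 3 * B' + D')" "zfree B'" "zfree D'" by blast
  have "P + P' = (A + A') * conicQ a b + (var3 3 * (B + B') + (D + D'))" by (simp add: * algebra_simps)
  moreover have "zfree (B + B')" "zfree (D + D')" using * by (simp_all add: zfree_add)
  ultimately show ?case by blast
next
  case (mult P P')
  then obtain A B D A' B' D' where *: "P = A * conicQ a b + (var3 3 * B + D)" "zfree B" "zfree D"
    "P' = A' * conicQ a b + (var3 3 * B' + D')" "zfree B'" "zfree D'" by blast
  define S where "S = const3 a * var3 1 ^ 2 + const3 b * var3 2 ^ 2"
  have z2: "conicQ a b = var3 3 ^ 2 - S" by (simp add: conicQ_def S_def)
  have "P * P' = (A * (A' * conicQ a b + (var3 3 * B' + D')) + A' * (var3 3 * B + D) + B * B') * conicQ a b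
     + (var3 3 * (B * D' + D * B') + (S * B * B' + D * D'))"
    unfolding * z2 by (simp add: algebra_simps power2_eq_square)
  moreover have "zfree (B * D' + D * B')" "zfree (S * B * B' + D * D')"
    using * by (auto simp: S_def intro!: zfree_add zfree_mult zfree_power zfree_const zfree_var)
  ultimately show ?case by blast
qed

text \<open>Modulo the equation of the conic, \<open>P\<close> is \<open>z B + D\<close> with \<open>B\<close> and \<open>D\<close> free of \<open>z\<close>; comparing the points
  \<open>(x, y, z)\<close> and \<open>(x, y, - z)\<close> shows that \<open>z B\<close> and \<open>D\<close> vanish separately.\<close>

lemma conicQ_dvdI:
  fixes P :: "'a::alg_closed_field mpoly3"
  assumes two: "(2::'a) \<noteq> 0" and a: "a \<noteq> 0"
    and van: "\<And>p. eval3 (conicQ a b) p = 0 \<Longrightarrow> eval3 P p = 0"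
  shows "conicQ a b dvd P"
proof -
  obtain A B D where P: "P = A * conicQ a b + (var3 3 * B + D)" and B: "zfree B" and D: "zfree D"
    using conicQ_division by blast
  define S where "S = const3 a * var3 1 ^ 2 + const3 b * var3 2 ^ 2"
  have *: "eval3 D p = 0 \<and> eval3 (B * S) p = 0" for p
  proof -
    obtain z where z: "z\<^sup>2 = a * (p $ 1)\<^sup>2 + b * (p $ 2)\<^sup>2" using alg_closed_sqrt by blast
    let ?v = "\<lambda>z. vector [p $ 1, p $ 2, z] :: 'a ^ 3"
    have Bv: "eval3 B (?v w) = eval3 B p" and Dv: "eval3 D (?v w) = eval3 D p" for w
      using zfreeD[OF B, of "?v w" p] zfreeD[OF D, of "?v w" p] by simp_all
    have "w * eval3 B p + eval3 D p = 0" if "w\<^sup>2 = z\<^sup>2" for w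
      using van[of "?v w"] that z Bv Dv by (simp add: P)
    from this[of z] this[of "- z"]
    have 1: "z * eval3 B p + eval3 D p = 0" and 2: "- z * eval3 B p + eval3 D p = 0" by simp_all
    then have "(z * eval3 B p + eval3 D p) + (- z * eval3 B p + eval3 D p) = 0" by simp
    then have "2 * eval3 D p = 0" by simp
    then have D0: "eval3 D p = 0" using two by simp
    then have "z = 0 \<or> eval3 B p = 0" using 1 by simp
    \<comment> \<open>Since z^2 is the value of S at p, the alternative z = 0 also makes the product
      vanish.\<close>
    then show ?thesis using D0 z by (auto simp: S_def)
  qed
  have D0: "D = 0" using * by (intro mpoly3_eqI) simp
  have BS: "B * S = 0" using * by (intro mpoly3_eqI) simp
  \<comment> \<open>The value is a; the polynomial ring has no zero divisors, so B itself is
    0.\<close>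
  have "eval3 S (vector [1, 0, 0]) \<noteq> 0" using a by (simp add: S_def)
  then have "S \<noteq> 0" by auto
  then have "B = 0" using BS by simp
  then show ?thesis using P D0 by simp
qed

text \<open>Substitution by an invertible matrix can be undone; the inverse substitution reduces the
  claim to \<open>conicQ_dvdI\<close>.\<close>

lemma subst3_conicQ_dvdI:
  fixes P :: "'a::alg_closed_field mpoly3"
  assumes "(2::'a) \<noteq> 0" "a \<noteq> 0" "invertible M"
    and van: "\<And>p. eval3 (conicQ a b) (M *v p) = 0 \<Longrightarrow> eval3 P p = 0"
  shows "subst3 M (conicQ a b) dvd P"
proof -
  obtain M' where M: "M ** M' = mat 1" "M' ** M = mat 1" using assms(3) invertible_def by blast
  have "conicQ a b dvd subst3 M' P"
    using assms(1,2) van by (intro conicQ_dvdI) (simp_all add: matrix_vector_mul_assoc M)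
  then have "subst3 M (conicQ a b) dvd subst3 M (subst3 M' P)" by (rule subst3_dvd)
  then show ?thesis by (simp add: subst3_subst3 M)
qed

section \<open>Homogeneous polynomials and linear substitution\<close>

lemma homogeneous3_const [simp]: "homogeneous3 0 (const3 c)"
  by (simp add: homogeneous3_def const3_def total_degree_def)

lemma homogeneous3_0 [simp]: "homogeneous3 d 0"
  by (simp add: homogeneous3_def)

lemma homogeneous3_1 [simp]: "homogeneous3 0 1"
  by (simp add: homogeneous3_def total_degree_def)

lemma homogeneous3_var [simp]: "homogeneous3 1 (var3 i :: 'a::zero_neq_one mpoly3)"
  by (simp add: homogeneous3_def var3_def total_degree_def lookup_single when_def)

lemma homogeneous3_add: "homogeneous3 d P \<Longrightarrow> homogeneous3 d R \<Longrightarrow> homogeneous3 d (P + R)"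
  using Poly_Mapping.keys_add by (fastforce simp: homogeneous3_def)

lemma homogeneous3_uminus: "homogeneous3 d P \<Longrightarrow> homogeneous3 d (- P)" for P :: "'a::ab_group_add mpoly3"
  by (simp add: homogeneous3_def)

lemma homogeneous3_sum: "(\<And>x. x \<in> A \<Longrightarrow> homogeneous3 d (P x)) \<Longrightarrow> homogeneous3 d (\<Sum>x\<in>A. P x)"
  by (induction A rule: infinite_finite_induct) (auto intro: homogeneous3_add)

lemma homogeneous3_mult:
  assumes "homogeneous3 d P" "homogeneous3 e R" shows "homogeneous3 (d + e) (P * R)"
  unfolding homogeneous3_def
proof
  fix m assume "m \<in> Poly_Mapping.keys (P * R)"
  then obtain m1 m2 where "m = m1 + m2" "m1 \<in> Poly_Mapping.keys P" "m2 \<in> Poly_Mapping.keys R"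
    using Poly_Mapping.keys_mult by blast
  then show "total_degree m = d + e"
    using assms by (auto simp: homogeneous3_def total_degree_def lookup_add sum.distrib)
qed

lemma homogeneous3_power: "homogeneous3 d P \<Longrightarrow> homogeneous3 (n * d) (P ^ n)" for P :: "'a::comm_ring_1 mpoly3"
  by (induction n) (auto intro: homogeneous3_mult)

lemma homogeneous3_prod:
  "(\<And>x. x \<in> A \<Longrightarrow> homogeneous3 (e x) (P x)) \<Longrightarrow> homogeneous3 (\<Sum>x\<in>A. e x) (\<Prod>x\<in>A. P x)"
  for P :: "'b \<Rightarrow> 'a::comm_ring_1 mpoly3"
  by (induction A rule: infinite_finite_induct) (auto intro: homogeneous3_mult)

lemma homogeneous3_linear: "homogeneous3 1 (\<Sum>j\<in>A. const3 (N j) * var3 j :: 'a::comm_ring_1 mpoly3)"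
proof (rule homogeneous3_sum)
  show "homogeneous3 1 (const3 (N j) * var3 j)" for j
    using homogeneous3_mult[OF homogeneous3_const homogeneous3_var, of "N j" j] by simp
qed

lemma homogeneous3_const_mult: "homogeneous3 d P \<Longrightarrow> homogeneous3 d (const3 c * P)" for P :: "'a::comm_ring_1 mpoly3"
  using homogeneous3_mult[OF homogeneous3_const, of d P c] by simp

lemma homogeneous3_subst3:
  assumes "homogeneous3 d P" shows "homogeneous3 d (subst3 N P)"
  unfolding subst3_def
proof (intro homogeneous3_sum homogeneous3_const_mult)
  fix m assume m: "m \<in> Poly_Mapping.keys P"
  have "homogeneous3 (\<Sum>i\<in>UNIV. Poly_Mapping.lookup m i * 1)
    (\<Prod>i\<in>UNIV. (\<Sum>j\<in>UNIV. const3 (N $ i $ j) * var3 j) ^ Poly_Mapping.lookup m i)"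
    by (intro homogeneous3_prod homogeneous3_power homogeneous3_linear)
  then show "homogeneous3 d (\<Prod>i\<in>UNIV. (\<Sum>j\<in>UNIV. const3 (N $ i $ j) * var3 j) ^ Poly_Mapping.lookup m i)"
    using assms m by (simp add: homogeneous3_def total_degree_def)
qed

lemma homogeneous3_map: "homogeneous3 d P \<Longrightarrow> homogeneous3 d (Poly_Mapping.map h P)"
proof -
  have "Poly_Mapping.keys (Poly_Mapping.map h P) \<subseteq> Poly_Mapping.keys P"
    by (auto simp: in_keys_iff Poly_Mapping.map.rep_eq when_def)
  then show "homogeneous3 d P \<Longrightarrow> ?thesis" by (auto simp: homogeneous3_def)
qed

lemma homogeneous3_conicQ: "homogeneous3 2 (conicQ a b :: 'a::comm_ring_1 mpoly3)"
proof -
  have v: "homogeneous3 2 (var3 i ^ 2 :: 'a mpoly3)" for i using homogeneous3_power[OF homogeneous3_var[of i], of 2] by simp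
  show ?thesis unfolding conicQ_def diff_conv_add_uminus
    by (intro homogeneous3_add homogeneous3_uminus homogeneous3_const_mult v)
qed

lemma eval3_scale: "homogeneous3 d P \<Longrightarrow> eval3 P (c *s p) = c ^ d * eval3 P p"
proof -
  assume hom: "homogeneous3 d P"
  show ?thesis unfolding eval3_def sum_distrib_left
  proof (rule sum.cong)
    fix m assume "m \<in> Poly_Mapping.keys P"
    then have "d = (\<Sum>i\<in>UNIV. Poly_Mapping.lookup m i)" using hom by (auto simp: homogeneous3_def total_degree_def)
    then show "Poly_Mapping.lookup P m * (\<Prod>i\<in>UNIV. ((c *s p) $ i) ^ Poly_Mapping.lookup m i) =
      c ^ d * (Poly_Mapping.lookup P m * (\<Prod>i\<in>UNIV. (p $ i) ^ Poly_Mapping.lookup m i))"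
      by (simp add: power_mult_distrib prod.distrib power_sum)
  qed simp
qed

section \<open>Polynomials with coefficients in a subring\<close>

definition coeffs_in :: "'a::comm_ring_1 set \<Rightarrow> 'a mpoly3 \<Rightarrow> bool" where
  "coeffs_in E P \<longleftrightarrow> (\<forall>m. Poly_Mapping.lookup P m \<in> E)"

locale subring_set =
  fixes E :: "'a::comm_ring_1 set"
  assumes zero_mem: "0 \<in> E" and one_mem: "1 \<in> E"
    and add_mem: "x \<in> E \<Longrightarrow> y \<in> E \<Longrightarrow> x + y \<in> E"
    and mult_mem: "x \<in> E \<Longrightarrow> y \<in> E \<Longrightarrow> x * y \<in> E"
begin

lemma sum_mem: "(\<And>x. x \<in> S \<Longrightarrow> h x \<in> E) \<Longrightarrow> (\<Sum>x\<in>S. h x) \<in> E"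
  by (induction S rule: infinite_finite_induct) (auto simp: zero_mem add_mem)

lemma coeffs_in_const: "c \<in> E \<Longrightarrow> coeffs_in E (const3 c)"
  by (simp add: coeffs_in_def const3_def lookup_single when_def zero_mem)

lemma coeffs_in_var: "coeffs_in E (var3 i)"
  by (simp add: coeffs_in_def var3_def lookup_single when_def zero_mem one_mem)

lemma coeffs_in_sum: "(\<And>x. x \<in> S \<Longrightarrow> coeffs_in E (h x)) \<Longrightarrow> coeffs_in E (\<Sum>x\<in>S. h x)"
  by (auto simp: coeffs_in_def lookup_sum intro: sum_mem)

lemma coeffs_in_mult:
  assumes "coeffs_in E P" "coeffs_in E R" shows "coeffs_in E (P * R)"
proof -
  let ?s = "\<lambda>P. \<Sum>m\<in>Poly_Mapping.keys P. Poly_Mapping.single m (Poly_Mapping.lookup P m)"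
  have single: "coeffs_in E (Poly_Mapping.single m c)" if "c \<in> E" for m :: "3 \<Rightarrow>\<^sub>0 nat" and c
    using that by (simp add: coeffs_in_def lookup_single when_def zero_mem)
  have "coeffs_in E (?s P * ?s R)"
    unfolding sum_product mult_single using assms
    by (intro coeffs_in_sum single mult_mem) (auto simp: coeffs_in_def)
  then show ?thesis by (simp only: poly_mapping_sum_single[symmetric])
qed

lemma coeffs_in_1: "coeffs_in E 1"
  using coeffs_in_const[OF one_mem] by (simp add: const3_def)

lemma coeffs_in_power: "coeffs_in E P \<Longrightarrow> coeffs_in E (P ^ n)"
  by (induction n) (auto intro: coeffs_in_mult coeffs_in_1)

lemma coeffs_in_prod: "(\<And>x. x \<in> S \<Longrightarrow> coeffs_in E (h x)) \<Longrightarrow> coeffs_in E (\<Prod>x\<in>S. h x)"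
  by (induction S rule: infinite_finite_induct) (auto intro: coeffs_in_mult coeffs_in_1)

lemma coeffs_in_subst3:
  fixes N :: "'a ^ 3 ^ 3"
  assumes "coeffs_in E P" "\<And>i j. N $ i $ j \<in> E" shows "coeffs_in E (subst3 N P)"
  unfolding subst3_def using assms
  by (intro coeffs_in_sum coeffs_in_mult coeffs_in_const coeffs_in_prod coeffs_in_power coeffs_in_var)
    (auto simp: coeffs_in_def)

end

section \<open>Embeddings into the algebraic closure\<close>

lemma gal_set_UNIV_iff: "\<sigma> \<in> gal_set UNIV \<longleftrightarrow>
    bij \<sigma> \<and> (\<forall>x y. \<sigma> (x + y) = \<sigma> x + \<sigma> y \<and> \<sigma> (x * y) = \<sigma> x * \<sigma> y) \<and> (\<forall>c. \<sigma> (to_ac c) = to_ac c)"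
  by (auto simp: gal_set_def base_field_def extensional_def)

locale gal_elem =
  fixes \<sigma> :: "'k::field alg_closure \<Rightarrow> 'k alg_closure"
  assumes mem: "\<sigma> \<in> gal_set UNIV"
begin

lemma bij: "bij \<sigma>" and add [simp]: "\<sigma> (x + y) = \<sigma> x + \<sigma> y"
  and mult [simp]: "\<sigma> (x * y) = \<sigma> x * \<sigma> y" and to_ac [simp]: "\<sigma> (to_ac c) = to_ac c"
  using mem by (auto simp: gal_set_UNIV_iff)

lemma inj: "inj \<sigma>" and surj: "surj \<sigma>" using bij by (auto simp: bij_def)

lemma zero [simp]: "\<sigma> 0 = 0" and one [simp]: "\<sigma> 1 = 1"
  using to_ac[of 0] to_ac[of 1] by simp_all

lemma eq_iff [simp]: "\<sigma> x = \<sigma> y \<longleftrightarrow> x = y" using inj by (auto dest: injD)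

lemma eq_0_iff [simp]: "\<sigma> x = 0 \<longleftrightarrow> x = 0" using eq_iff[of x 0] by simp

lemma uminus [simp]: "\<sigma> (- x) = - \<sigma> x"
  using add[of x "- x"] by (simp add: eq_neg_iff_add_eq_0 add.commute)

lemma diff [simp]: "\<sigma> (x - y) = \<sigma> x - \<sigma> y"
  using add[of x "- y"] by simp

lemma inverse [simp]: "\<sigma> (inverse x) = inverse (\<sigma> x)"
proof (cases "x = 0")
  case False
  then have "\<sigma> x * \<sigma> (inverse x) = 1" by (simp flip: mult)
  then show ?thesis by (metis inverse_unique)
qed simp

lemma divide [simp]: "\<sigma> (x / y) = \<sigma> x / \<sigma> y"
  by (simp add: divide_inverse)

lemma power [simp]: "\<sigma> (x ^ n) = \<sigma> x ^ n"
  by (induction n) auto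

lemma sum [simp]: "\<sigma> (\<Sum>x\<in>A. h x) = (\<Sum>x\<in>A. \<sigma> (h x))"
  by (induction A rule: infinite_finite_induct) auto

lemma prod [simp]: "\<sigma> (\<Prod>x\<in>A. h x) = (\<Prod>x\<in>A. \<sigma> (h x))"
  by (induction A rule: infinite_finite_induct) auto

lemma inv_apply [simp]: "inv_into UNIV \<sigma> (\<sigma> x) = x" "\<sigma> (inv_into UNIV \<sigma> x) = x"
  using inj surj by (simp_all add: surj_f_inv_f)

lemma inv_mem: "inv_into UNIV \<sigma> \<in> gal_set UNIV"
  unfolding gal_set_UNIV_iff
proof (intro conjI allI)
  show "bij (inv_into UNIV \<sigma>)" using bij by (rule bij_imp_bij_inv)
  show "inv_into UNIV \<sigma> (x + y) = inv_into UNIV \<sigma> x + inv_into UNIV \<sigma> y" for x y by (rule inv_f_eq[OF inj]) simp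
  show "inv_into UNIV \<sigma> (x * y) = inv_into UNIV \<sigma> x * inv_into UNIV \<sigma> y" for x y by (rule inv_f_eq[OF inj]) simp
  show "inv_into UNIV \<sigma> (to_ac c) = to_ac c" for c by (rule inv_f_eq[OF inj]) simp
qed

lemma poly_map: "\<sigma> (poly (map_poly to_ac p) x) = poly (map_poly to_ac p) (\<sigma> x)"
  by (induction p) (auto simp: map_poly_pCons)

end

lemma gal_id: "id \<in> gal_set UNIV"
  by (simp add: gal_set_UNIV_iff)

lemma gal_comp: "\<sigma> \<in> gal_set UNIV \<Longrightarrow> \<tau> \<in> gal_set UNIV \<Longrightarrow> \<sigma> \<circ> \<tau> \<in> gal_set UNIV"
  by (auto simp: gal_set_UNIV_iff bij_comp)

section \<open>Extension of partial embeddings and the fixed field of G_k\<close>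

lemma map_poly_to_ac_mult: "map_poly to_ac (p * q) = map_poly to_ac p * map_poly to_ac q"
  by (rule poly_eqI) (simp add: coeff_map_poly coeff_mult to_ac_sum)

lemma map_poly_to_ac_add: "map_poly to_ac (p + q) = map_poly to_ac p + map_poly to_ac q"
  by (rule poly_eqI) (simp add: coeff_map_poly)

text \<open>Partial embeddings of the algebraic closure, given by their graphs.  A subring containing the base
  field is automatically a field.\<close>

definition hom_graph :: "('k::field alg_closure \<times> 'k alg_closure) set \<Rightarrow> bool" where
  "hom_graph R \<longleftrightarrow> (\<forall>c. (to_ac c, to_ac c) \<in> R) \<and>
     (\<forall>x y x' y'. (x, y) \<in> R \<longrightarrow> (x', y') \<in> R \<longrightarrow> (x + x', y + y') \<in> R \<and> (x * x', y * y') \<in> R) \<and>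
     (\<forall>y. (0, y) \<in> R \<longrightarrow> y = 0)"

context
  fixes R :: "('k::field alg_closure \<times> 'k alg_closure) set"
  assumes R: "hom_graph R"
begin

lemma hom_graph_base: "(to_ac c, to_ac c) \<in> R"
  using R by (simp add: hom_graph_def)

lemma hom_graph_add: "(x, y) \<in> R \<Longrightarrow> (x', y') \<in> R \<Longrightarrow> (x + x', y + y') \<in> R"
  using R by (simp add: hom_graph_def)

lemma hom_graph_mult: "(x, y) \<in> R \<Longrightarrow> (x', y') \<in> R \<Longrightarrow> (x * x', y * y') \<in> R"
  using R by (simp add: hom_graph_def)

lemma hom_graph_0: "(0, y) \<in> R \<Longrightarrow> y = 0"
  using R by (simp add: hom_graph_def)

lemma hom_graph_00: "(0, 0) \<in> R" and hom_graph_11: "(1, 1) \<in> R"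
  using hom_graph_base[of 0] hom_graph_base[of 1] by simp_all

lemma hom_graph_uminus: "(x, y) \<in> R \<Longrightarrow> (- x, - y) \<in> R"
  using hom_graph_mult[of "-1" "-1" x y] hom_graph_base[of "-1"] by simp

lemma hom_graph_diff: "(x, y) \<in> R \<Longrightarrow> (x', y') \<in> R \<Longrightarrow> (x - x', y - y') \<in> R"
  using hom_graph_add[of x y "- x'" "- y'"] hom_graph_uminus by simp

lemma hom_graph_fun: "(x, y) \<in> R \<Longrightarrow> (x, y') \<in> R \<Longrightarrow> y = y'"
  using hom_graph_diff[of x y x y'] hom_graph_0[of "y - y'"] by simp

lemma hom_graph_sum: "(\<And>i. i \<in> A \<Longrightarrow> (h i, h' i) \<in> R) \<Longrightarrow> (\<Sum>i\<in>A. h i, \<Sum>i\<in>A. h' i) \<in> R"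
  by (induction A rule: infinite_finite_induct) (auto intro: hom_graph_00 hom_graph_add)

lemma hom_graph_poly: "(x, y) \<in> R \<Longrightarrow> (poly (map_poly to_ac p) x, poly (map_poly to_ac p) y) \<in> R"
  by (induction p) (auto simp: map_poly_pCons intro: hom_graph_00 hom_graph_add hom_graph_mult hom_graph_base)

text \<open>The inverse of an algebraic x is a polynomial in x: a polynomial c + X q(X) over k of
  least degree killing x has c nonzero, so 1/x = - q(x)/c. The same identity holds for y, because R
  relates c + x q(x) = 0 to c + y q(y).\<close>

lemma hom_graph_inverse:
  assumes xy: "(x, y) \<in> R" and x: "x \<noteq> 0"
  shows "(inverse x, inverse y) \<in> R"
proof -
  let ?P = "\<lambda>p :: 'k poly. p \<noteq> 0 \<and> poly (map_poly to_ac p) x = 0"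
  obtain p0 where "?P p0" using alg_closure_algebraic by blast
  then obtain p where p: "?P p" and min: "\<And>q. ?P q \<Longrightarrow> Polynomial.degree p \<le> Polynomial.degree q"
    using ex_has_least_nat[of ?P p0 Polynomial.degree] by blast
  obtain c q where pq: "p = pCons c q" by (cases p)
  have "c \<noteq> 0"
  proof
    assume "c = 0"
    then have "?P q" using p x by (auto simp: pq map_poly_pCons)
    then show False using min[of q] \<open>c = 0\<close> p by (auto simp: pq)
  qed
  let ?q = "poly (map_poly to_ac q)"
  have qx: "to_ac c + x * ?q x = 0" using p by (simp add: pq map_poly_pCons)
  have "(to_ac c + x * ?q x, to_ac c + y * ?q y) \<in> R"
    by (intro hom_graph_add hom_graph_mult hom_graph_base hom_graph_poly xy)
  then have qy: "to_ac c + y * ?q y = 0" using qx hom_graph_0 by metis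
  have inv: "inverse z = to_ac (- inverse c) * ?q z" if "to_ac c + z * ?q z = 0" for z
  proof -
    have "z * ?q z = - to_ac c" using that by (simp add: eq_neg_iff_add_eq_0 add.commute)
    then have "z * (to_ac (- inverse c) * ?q z) = 1" using \<open>c \<noteq> 0\<close> by (simp add: mult.left_commute[of z])
    then show ?thesis by (rule inverse_unique)
  qed
  show ?thesis unfolding inv[OF qx] inv[OF qy]
    by (intro hom_graph_mult hom_graph_base hom_graph_poly xy)
qed

text \<open>A nonzero x has an inverse in the domain of R, so a pair (x, 0) would give (1, 0),
  against (1, 1).\<close>

lemma hom_graph_inj: "(x, 0) \<in> R \<Longrightarrow> x = 0"
proof (rule ccontr)
  assume "(x, 0) \<in> R" "x \<noteq> 0"
  then have "(x * inverse x, 0 * inverse 0) \<in> R" by (intro hom_graph_mult hom_graph_inverse)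
  then show False using \<open>x \<noteq> 0\<close> hom_graph_11 hom_graph_fun by fastforce
qed

text \<open>The classical extension by one element: take p of least degree over the domain of R with
  p(x) = 0, move its coefficients along R to p', and send x to a root y of p'. Least degree makes
  q(x) \<mapsto> q'(y) single-valued.\<close>

lemma hom_graph_extend:
  fixes x :: "'k alg_closure"
  shows "\<exists>R' y. hom_graph R' \<and> R \<subseteq> R' \<and> (x, y) \<in> R'"
proof -
  define PR where "PR = {(q, q'). \<forall>i. (Polynomial.coeff q i, Polynomial.coeff q' i) \<in> R}"
  have PR_D: "(Polynomial.coeff q i, Polynomial.coeff q' i) \<in> R" if "(q, q') \<in> PR" for q q' i
    using that by (simp add: PR_def)
  let ?P = "\<lambda>(p, p'). (p, p') \<in> PR \<and> p \<noteq> 0 \<and> poly p x = 0"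
  obtain p0 :: "'k poly" where p0: "p0 \<noteq> 0" "poly (map_poly to_ac p0) x = 0"
    using alg_closure_algebraic by blast
  then have "?P (map_poly to_ac p0, map_poly to_ac p0)"
    by (auto simp: PR_def coeff_map_poly hom_graph_base map_poly_eq_0_iff)
  then obtain pp where "?P pp" and min': "\<And>q. ?P q \<Longrightarrow> Polynomial.degree (fst pp) \<le> Polynomial.degree (fst q)"
    using ex_has_least_nat[of ?P _ "\<lambda>q. Polynomial.degree (fst q)"] by blast
  then obtain p p' where p: "(p, p') \<in> PR" "p \<noteq> 0" "poly p x = 0" and pp: "pp = (p, p')"
    by (cases pp) auto
  have min: "Polynomial.degree p \<le> Polynomial.degree q" if "(q, q') \<in> PR" "q \<noteq> 0" "poly q x = 0" for q q'
    using min'[of "(q, q')"] that pp by simp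
  let ?m = "Polynomial.degree p"
  \<comment> \<open>The leading coefficient of p survives in p' because R is injective; hence p' is
    not constant and has a root.\<close>
  have lc: "Polynomial.coeff p' ?m \<noteq> 0"
    using PR_D[OF p(1), of ?m] hom_graph_inj p(2) by fastforce
  have "?m > 0"
  proof (rule ccontr)
    assume "\<not> ?m > 0"
    then obtain c where "p = [:c:]" by (metis degree_eq_zeroE neq0_conv)
    then show False using p by simp
  qed
  then have "Polynomial.degree p' > 0" using le_degree[OF lc] by simp
  then obtain y where y: "poly p' y = 0" using alg_closed_imp_poly_has_root by blast
  \<comment> \<open>Division of q by p, carried out on both components at once so that the quotients
    stay related. This makes the new relation single-valued at 0.\<close>
  have kernel: "poly q' y = 0" if "(q, q') \<in> PR" "poly q x = 0" for q q'
    using that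
  \<comment> \<open>The shifted degree ranks 0 strictly below the nonzero constants, so that
    cancelling the leading term always decreases it.\<close>
  proof (induction "if q = 0 then 0 else Suc (Polynomial.degree q)" arbitrary: q q' rule: less_induct)
    case less
    show ?case
    proof (cases "q = 0")
      case True
      then have "q' = 0" using PR_D[OF less.prems(1)] hom_graph_0 by (intro poly_eqI) simp
      then show ?thesis by simp
    next
      case False
      let ?n = "Polynomial.degree q"
      have le: "?m \<le> ?n" using min less.prems False by blast
      define c where "c = Polynomial.coeff q ?n / Polynomial.coeff p ?m"
      define c' where "c' = Polynomial.coeff q' ?n / Polynomial.coeff p' ?m"
      have cc: "(c, c') \<in> R" unfolding c_def c'_def divide_inverse
        using p(2) by (intro hom_graph_mult hom_graph_inverse PR_D less.prems p) auto
      define r where "r = q - Polynomial.monom c (?n - ?m) * p"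
      define r' where "r' = q' - Polynomial.monom c' (?n - ?m) * p'"
      have "(r, r') \<in> PR"
        unfolding PR_def r_def r'_def using less.prems(1) p(1)
        by (auto simp: coeff_monom_mult intro!: hom_graph_diff hom_graph_mult hom_graph_00 PR_D cc)
      moreover have "poly r x = 0" using less.prems p by (simp add: r_def)
      moreover have "r = 0 \<or> Polynomial.degree r < ?n"
      proof -
        have c: "Polynomial.coeff r ?n = 0" using p(2) le by (simp add: r_def c_def coeff_monom_mult)
        have "Polynomial.degree r \<le> ?n" unfolding r_def
          using le degree_mult_le[of "Polynomial.monom c (?n - ?m)" p] degree_monom_le[of c "?n - ?m"]
          by (intro degree_diff_le) auto
        then show ?thesis using c by (metis le_neq_implies_less leading_coeff_0_iff)
      qed
      then have "(if r = 0 then 0 else Suc (Polynomial.degree r)) < (if q = 0 then 0 else Suc ?n)"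
        using False by auto
      ultimately have "poly r' y = 0" using less.hyps by blast
      then show ?thesis using y by (simp add: r'_def)
    qed
  qed
  define R' where "R' = {(poly q x, poly q' y) |q q'. (q, q') \<in> PR}"
  have R'I: "(poly q x, poly q' y) \<in> R'" if "(q, q') \<in> PR" for q q'
    using that by (auto simp: R'_def)
  have const: "([:u:], [:v:]) \<in> PR" if "(u, v) \<in> R" for u v
    using that by (auto simp: PR_def coeff_pCons hom_graph_00 split: nat.split)
  have sub: "R \<subseteq> R'"
    using R'I[OF const] by auto
  have "hom_graph R'"
    unfolding hom_graph_def
  proof (intro conjI allI impI)
    show "(to_ac c, to_ac c) \<in> R'" for c using sub hom_graph_base by blast
  next
    fix u v u' v' assume "(u, v) \<in> R'" "(u', v') \<in> R'"
    then obtain q q' s s' where q: "(q, q') \<in> PR" "u = poly q x" "v = poly q' y"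
      and s: "(s, s') \<in> PR" "u' = poly s x" "v' = poly s' y" by (auto simp: R'_def)
    have "(q + s, q' + s') \<in> PR" using q s by (auto simp: PR_def intro: hom_graph_add)
    from R'I[OF this] show "(u + u', v + v') \<in> R'" by (simp add: q s)
    have "(q * s, q' * s') \<in> PR" using q s
      by (auto simp: PR_def coeff_mult intro!: hom_graph_sum hom_graph_mult)
    from R'I[OF this] show "(u * u', v * v') \<in> R'" by (simp add: q s)
  next
    fix v assume "(0, v) \<in> R'"
    then show "v = 0" using kernel by (force simp: R'_def)
  qed
  moreover have "([:0, 1:], [:0, 1:]) \<in> PR"
    by (auto simp: PR_def coeff_pCons hom_graph_00 hom_graph_11 split: nat.split)
  from R'I[OF this] have "(x, y) \<in> R'" by simp
  ultimately show ?thesis using sub by blast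
qed

end

text \<open>All conjugates are roots of one nonzero polynomial over k.\<close>

lemma finite_conjugates: "finite {\<sigma> x |\<sigma>. \<sigma> \<in> gal_set UNIV}"
proof -
  obtain p where p: "p \<noteq> 0" "poly (map_poly to_ac p) x = 0" using alg_closure_algebraic by blast
  have "finite {z. poly (map_poly to_ac p) z = 0}"
    using p by (intro poly_roots_finite) (simp add: map_poly_eq_0_iff)
  moreover have "poly (map_poly to_ac p) (\<sigma> x) = 0" if "\<sigma> \<in> gal_set UNIV" for \<sigma>
    using gal_elem.poly_map[OF gal_elem.intro[OF that], of p x] p
      gal_elem.zero[OF gal_elem.intro[OF that]] by simp
  ultimately show ?thesis by (auto elim!: finite_subset[rotated])
qed

text \<open>Zorn's lemma gives a maximal graph, and \<open>hom_graph_extend\<close> makes it total.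
  The map is onto because, being injective, it permutes the finite root set of every nonzero
  polynomial over k, and each element lies in such a set.\<close>

lemma hom_graph_extends_to_gal:
  assumes "hom_graph R0"
  obtains \<sigma> where "\<sigma> \<in> gal_set UNIV" "\<And>x y. (x, y) \<in> R0 \<Longrightarrow> \<sigma> x = y"
proof -
  define A where "A = {R. hom_graph R \<and> R0 \<subseteq> R}"
  have "\<exists>M\<in>A. \<forall>Y\<in>A. M \<subseteq> Y \<longrightarrow> Y = M"
  proof (rule subset_Zorn_nonempty)
    show "A \<noteq> {}" using assms by (auto simp: A_def)
    fix \<C> assume C: "\<C> \<noteq> {}" "subset.chain A \<C>"
    have up: "\<exists>Y\<in>\<C>. u \<in> Y \<and> v \<in> Y" if "u \<in> \<Union>\<C>" "v \<in> \<Union>\<C>" for u v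
      
    proof -
      from that obtain Y Z where YZ: "Y \<in> \<C>" "u \<in> Y" "Z \<in> \<C>" "v \<in> Z" by blast
      then have "Y \<subseteq> Z \<or> Z \<subseteq> Y" using C(2) by (simp add: subset_chain_def)
      then show ?thesis using YZ by blast
    qed
    have mem: "hom_graph Y" "R0 \<subseteq> Y" if "Y \<in> \<C>" for Y
      using that C by (auto simp: subset_chain_def A_def)
    have "hom_graph (\<Union>\<C>)"
      unfolding hom_graph_def
    proof (intro conjI allI impI)
      show "(to_ac c, to_ac c) \<in> \<Union>\<C>" for c using C(1) mem hom_graph_base by blast
    next
      fix x y x' y' assume "(x, y) \<in> \<Union>\<C>" "(x', y') \<in> \<Union>\<C>"
      then obtain Y where Y: "Y \<in> \<C>" "(x, y) \<in> Y" "(x', y') \<in> Y" using up by blast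
      show "(x + x', y + y') \<in> \<Union>\<C>" using Y mem hom_graph_add by blast
      show "(x * x', y * y') \<in> \<Union>\<C>" using Y mem hom_graph_mult by blast
    next
      fix y assume "(0, y) \<in> \<Union>\<C>" then show "y = 0" using mem hom_graph_0 by blast
    qed
    then show "\<Union>\<C> \<in> A" using C(1) mem by (fastforce simp: A_def)
  qed
  then obtain M where M: "hom_graph M" "R0 \<subseteq> M" and max: "\<And>Y. hom_graph Y \<Longrightarrow> M \<subseteq> Y \<Longrightarrow> Y = M"
    by (auto simp: A_def)
  have "\<exists>y. (x, y) \<in> M" for x
    using hom_graph_extend[OF M(1), of x] max by blast
  then obtain \<sigma> where \<sigma>: "\<And>x. (x, \<sigma> x) \<in> M" by metis
  have eq: "\<sigma> x = y" if "(x, y) \<in> M" for x y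
    using hom_graph_fun[OF M(1) \<sigma> that] .
  have add: "\<sigma> (x + y) = \<sigma> x + \<sigma> y" for x y
    by (rule eq) (rule hom_graph_add[OF M(1) \<sigma> \<sigma>])
  have mult: "\<sigma> (x * y) = \<sigma> x * \<sigma> y" for x y
    by (rule eq) (rule hom_graph_mult[OF M(1) \<sigma> \<sigma>])
  have diff: "\<sigma> (x - y) = \<sigma> x - \<sigma> y" for x y
    by (rule eq) (rule hom_graph_diff[OF M(1) \<sigma> \<sigma>])
  have base: "\<sigma> (to_ac c) = to_ac c" for c using eq hom_graph_base[OF M(1)] by blast
  have inj: "inj \<sigma>"
  proof (rule injI)
    fix x y assume "\<sigma> x = \<sigma> y"
    then have "(x - y, 0) \<in> M" using \<sigma>[of "x - y"] by (simp add: diff)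
    then show "x = y" using hom_graph_inj[OF M(1)] by fastforce
  qed
  have "surj \<sigma>"
  proof
    show "UNIV \<subseteq> range \<sigma>"
    proof
      fix y :: "'a alg_closure"
      obtain p where p: "p \<noteq> 0" "poly (map_poly to_ac p) y = 0" using alg_closure_algebraic by blast
      let ?S = "{z. poly (map_poly to_ac p) z = 0}"
      have "finite ?S" using p by (intro poly_roots_finite) (simp add: map_poly_eq_0_iff)
      moreover have "\<sigma> z \<in> ?S" if "z \<in> ?S" for z
        using hom_graph_poly[OF M(1) \<sigma>[of z], of p] that hom_graph_0[OF M(1)] by simp
      ultimately have "\<sigma> ` ?S = ?S" using inj by (intro endo_inj_surj) (auto intro: inj_on_subset)
      then show "y \<in> range \<sigma>" using p by blast
    qed
  qed simp
  then have "\<sigma> \<in> gal_set UNIV" using inj add mult base by (simp add: gal_set_UNIV_iff bij_def)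
  then show ?thesis using that eq M(2) by blast
qed

text \<open>If the minimal polynomial p of x is not linear, perfectness gives it a root y \<noteq>
  x. Then q(x) \<mapsto> q(y) is a well-defined partial embedding, and its extension to the closure
  moves x.\<close>

lemma gal_fixed_in_base:
  assumes perf: "perfect_field TYPE('k::field)" and fix_x: "\<And>\<sigma>. \<sigma> \<in> gal_set UNIV \<Longrightarrow> \<sigma> x = x"
  shows "x \<in> (base_field :: 'k alg_closure set)"
proof -
  let ?ev = "\<lambda>p :: 'k poly. poly (map_poly to_ac p)"
  let ?P = "\<lambda>p :: 'k poly. p \<noteq> 0 \<and> ?ev p x = 0"
  obtain p0 where "?P p0" using alg_closure_algebraic by blast
  then obtain p where p: "?P p" and min: "\<And>q. ?P q \<Longrightarrow> Polynomial.degree p \<le> Polynomial.degree q"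
    using ex_has_least_nat[of ?P p0 Polynomial.degree] by blast
  have pos: "Polynomial.degree p > 0"
  proof (rule ccontr)
    assume "\<not> Polynomial.degree p > 0"
    then obtain c where "p = [:c:]" by (metis degree_eq_zeroE neq0_conv)
    then show False using p by (simp add: map_poly_pCons)
  qed
  have irr: "irreducible p"
  proof (rule irreducibleI)
    show "p \<noteq> 0" "\<not> p dvd 1" using p pos by (auto simp: is_unit_iff_degree)
    fix a b assume ab: "p = a * b"
    then have nz: "a \<noteq> 0" "b \<noteq> 0" using p by auto
    have deg: "Polynomial.degree p = Polynomial.degree a + Polynomial.degree b"
      using nz by (simp add: ab degree_mult_eq)
    have "?ev a x = 0 \<or> ?ev b x = 0" using p by (simp add: ab map_poly_to_ac_mult)
    then have "Polynomial.degree p \<le> Polynomial.degree a \<or> Polynomial.degree p \<le> Polynomial.degree b"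
      using min nz by blast
    then have "Polynomial.degree a = 0 \<or> Polynomial.degree b = 0" using deg by linarith
    then show "a dvd 1 \<or> b dvd 1" using nz by (auto simp: is_unit_iff_degree)
  qed
  let ?p = "map_poly to_ac p"
  have p0: "?p \<noteq> 0" using p by (simp add: map_poly_eq_0_iff)
  have degp: "Polynomial.degree ?p = Polynomial.degree p" by (intro degree_map_poly) simp
  have sf: "rsquarefree ?p" using perf irr by (simp add: perfect_field_def)
  obtain S where S: "?p = [:- x, 1:] * S" using p by (metis poly_eq_0_iff_dvd dvdE)
  have S0: "S \<noteq> 0" using p0 S by auto
  have degS: "Polynomial.degree ?p = Suc (Polynomial.degree S)" using S0 unfolding S by (subst degree_mult_eq) auto
  show ?thesis
  proof (cases "Polynomial.degree S = 0")
    \<comment> \<open>Here p is linear, and x is minus the quotient of its coefficients.\<close>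
    case True
    then obtain c where c: "S = [:c:]" by (metis degree_eq_zeroE)
    have "Polynomial.coeff ?p 0 = - x * c" "Polynomial.coeff ?p 1 = c" unfolding S c by simp_all
    then have "x = to_ac (- Polynomial.coeff p 0 / Polynomial.coeff p 1)"
      using S0 c by (auto simp: coeff_map_poly field_simps)
    then show ?thesis unfolding base_field_def by (rule range_eqI)
  next
    case False
    then obtain y where y: "poly S y = 0" using alg_closed_imp_poly_has_root by blast
    have py: "?ev p y = 0" using y by (simp add: S)
    have "y \<noteq> x"
    proof
      assume "y = x"
      then obtain T where "S = [:- x, 1:] * T" using y by (metis poly_eq_0_iff_dvd dvdE)
      then have "?p = [:- x, 1:] ^ 2 * T" by (simp only: S power2_eq_square mult.assoc)
      then have "[:- x, 1:] ^ 2 dvd ?p" by (rule dvdI)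
      then have "2 \<le> order x ?p" using p0 by (simp add: order_divides)
      moreover have "order x ?p = 0 \<or> order x ?p = 1" using sf unfolding rsquarefree_def by blast
      ultimately show False by linarith
    qed
    define R where "R = {(?ev q x, ?ev q y) |q. True}"
    have RI: "(?ev q x, ?ev q y) \<in> R" for q by (auto simp: R_def)
    have "hom_graph R" unfolding hom_graph_def
    proof (intro conjI allI impI)
      show "(to_ac c, to_ac c) \<in> R" for c using RI[of "[:c:]"] by (simp add: map_poly_pCons)
    next
      fix u v u' v' assume "(u, v) \<in> R" "(u', v') \<in> R"
      then obtain q s where *: "u = ?ev q x" "v = ?ev q y" "u' = ?ev s x" "v' = ?ev s y" by (auto simp: R_def)
      show "(u + u', v + v') \<in> R" using RI[of "q + s"] by (simp add: * map_poly_to_ac_add)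
      show "(u * u', v * v') \<in> R" using RI[of "q * s"] by (simp add: * map_poly_to_ac_mult)
    next
      fix v assume "(0, v) \<in> R"
      then obtain q where q: "?ev q x = 0" "v = ?ev q y" by (auto simp: R_def)
      \<comment> \<open>By minimality of p, a polynomial q with q(x) = 0 is a multiple of p, hence
        also kills y.\<close>
      define r where "r = q mod p"
      have qr: "q = p * (q div p) + r" by (simp add: r_def)
      have ev: "?ev q z = ?ev p z * ?ev (q div p) z + ?ev r z" for z
        by (subst qr) (simp add: map_poly_to_ac_add map_poly_to_ac_mult)
      have "?ev r x = 0" using q p ev[of x] by simp
      moreover have "r = 0 \<or> Polynomial.degree r < Polynomial.degree p"
        using p degree_mod_less[of p q] by (simp add: r_def)
      ultimately have "r = 0" using min[of r] by (metis leD)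
      then show "v = 0" using ev[of y] py q by simp
    qed
    then obtain \<sigma> where \<sigma>: "\<sigma> \<in> gal_set UNIV" "\<And>u v. (u, v) \<in> R \<Longrightarrow> \<sigma> u = v"
      using hom_graph_extends_to_gal by blast
    have "\<sigma> x = y" using \<sigma>(2)[OF RI[of "[:0, 1:]"]] by (simp add: map_poly_pCons)
    then show ?thesis using fix_x[OF \<sigma>(1)] \<open>y \<noteq> x\<close> by simp
  qed
qed

section \<open>Independence of characters and Hilbert 90\<close>

text \<open>Fewer equations than unknowns leave a nontrivial solution. Gaussian elimination: the
  equation a is solved for the unknown b0, and \<open>m'\<close> is the remaining system.\<close>

lemma linear_system_card_le:
  fixes m :: "'a \<Rightarrow> 'b \<Rightarrow> 'f::field"
  assumes "finite A" "finite B"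
    and "\<And>c. (\<And>a. a \<in> A \<Longrightarrow> (\<Sum>b\<in>B. c b * m a b) = 0) \<Longrightarrow> (\<forall>b\<in>B. c b = 0)"
  shows "card B \<le> card A"
  using assms
proof (induction A arbitrary: B m rule: finite_induct)
  case empty
  from empty(2)[of "\<lambda>_. 1"] have "B = {}" by auto
  then show ?case by simp
next
  case (insert a A)
  show ?case
  proof (cases "\<forall>b\<in>B. m a b = 0")
    case True
    have "card B \<le> card A"
    proof (rule insert.IH[OF insert.prems(1)])
      fix c assume "\<And>a. a \<in> A \<Longrightarrow> (\<Sum>b\<in>B. c b * m a b) = 0"
      then show "\<forall>b\<in>B. c b = 0" using True by (intro insert.prems(2)) auto
    qed
    then show ?thesis using insert.hyps by simp
  next
    case False
    then obtain b0 where b0: "b0 \<in> B" "m a b0 \<noteq> 0" by blast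
    define B' where "B' = B - {b0}"
    have B: "B = insert b0 B'" "b0 \<notin> B'" "finite B'" using b0 insert.prems by (auto simp: B'_def)
    define m' where "m' a' b = m a' b - m a' b0 * m a b / m a b0" for a' b
    have "card B' \<le> card A"
    proof (rule insert.IH[OF B(3)])
      fix c assume c: "\<And>a. a \<in> A \<Longrightarrow> (\<Sum>b\<in>B'. c b * m' a b) = 0"
      define s where "s = (\<Sum>b\<in>B'. c b * m a b)"
      \<comment> \<open>The value at b0 is the one forced by equation a.\<close>
      define c' where "c' = c(b0 := - s / m a b0)"
      have sum: "(\<Sum>b\<in>B. c' b * m a' b) = (\<Sum>b\<in>B'. c b * m a' b) - s * m a' b0 / m a b0" for a'
      proof -
        have "(\<Sum>b\<in>B'. c' b * m a' b) = (\<Sum>b\<in>B'. c b * m a' b)"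
          using B(2) by (intro sum.cong) (auto simp: c'_def)
        then show ?thesis using B by (simp add: c'_def)
      qed
      have "\<forall>b\<in>B. c' b = 0"
      proof (rule insert.prems(2))
        fix a' assume "a' \<in> insert a A"
        then consider "a' = a" | "a' \<in> A" by blast
        then show "(\<Sum>b\<in>B. c' b * m a' b) = 0"
        proof cases
          case 1
          then show ?thesis using sum[of a] b0 by (simp add: s_def)
        next
          case 2
          have "(\<Sum>b\<in>B'. c b * m' a' b) = (\<Sum>b\<in>B'. c b * m a' b) - s * m a' b0 / m a b0"
          proof -
            have "(\<Sum>b\<in>B'. c b * m' a' b) = (\<Sum>b\<in>B'. c b * m a' b - m a' b0 / m a b0 * (c b * m a b))"
              by (intro sum.cong) (auto simp: m'_def algebra_simps)
            then have "(\<Sum>b\<in>B'. c b * m' a' b) = (\<Sum>b\<in>B'. c b * m a' b) - m a' b0 / m a b0 * s"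
              by (simp only: sum_subtractf s_def sum_distrib_left)
            then show ?thesis by simp
          qed
          then show ?thesis using c[OF 2] sum[of a'] by simp
        qed
      qed
      then show "\<forall>b\<in>B'. c b = 0" using B by (auto simp: c'_def split: if_splits)
    qed
    then show ?thesis using insert.hyps B by simp
  qed
qed

text \<open>Artin's proof of Dedekind's theorem: the relation at a x minus \<psi>0(a) times the
  relation at x no longer contains \<psi>0, so its coefficients vanish by induction. Extensionality
  provides an a in E at which two distinct characters differ.\<close>

lemma characters_independent:
  fixes c :: "('a::monoid_mult \<Rightarrow> 'f::field) \<Rightarrow> 'f"
  assumes "finite S" "S \<subseteq> extensional E" "1 \<in> E" "\<And>x y. x \<in> E \<Longrightarrow> y \<in> E \<Longrightarrow> x * y \<in> E"
    and "\<And>\<psi> x y. \<psi> \<in> S \<Longrightarrow> x \<in> E \<Longrightarrow> y \<in> E \<Longrightarrow> \<psi> (x * y) = \<psi> x * \<psi> y"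
    and "\<And>\<psi>. \<psi> \<in> S \<Longrightarrow> \<psi> 1 = 1"
    and "\<And>x. x \<in> E \<Longrightarrow> (\<Sum>\<psi>\<in>S. c \<psi> * \<psi> x) = 0"
  shows "\<forall>\<psi>\<in>S. c \<psi> = 0"
  using assms
proof (induction S arbitrary: c rule: finite_induct)
  case (insert \<psi>0 S)
  have *: "c \<psi> * (\<psi> a - \<psi>0 a) = 0" if a: "a \<in> E" and \<psi>: "\<psi> \<in> S" for a \<psi>
  proof -
    have "\<forall>\<psi>\<in>S. c \<psi> * (\<psi> a - \<psi>0 a) = 0"
    proof (rule insert.IH)
      fix x assume x: "x \<in> E"
      have "c \<psi>0 * \<psi>0 (a * x) + (\<Sum>\<psi>\<in>S. c \<psi> * \<psi> (a * x)) = 0"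
        using insert.prems(6)[of "a * x"] insert.prems(3)[OF a x] insert.hyps by simp
      moreover have "\<psi>0 a * (c \<psi>0 * \<psi>0 x + (\<Sum>\<psi>\<in>S. c \<psi> * \<psi> x)) = 0"
        using insert.prems(6)[OF x] insert.hyps by simp
      moreover have "(\<Sum>\<psi>\<in>S. c \<psi> * \<psi> (a * x)) = (\<Sum>\<psi>\<in>S. c \<psi> * (\<psi> a * \<psi> x))"
        using insert.prems(4) a x by (intro sum.cong) auto
      moreover have "\<psi>0 (a * x) = \<psi>0 a * \<psi>0 x" using insert.prems(4) a x by blast
      ultimately show "(\<Sum>\<psi>\<in>S. c \<psi> * (\<psi> a - \<psi>0 a) * \<psi> x) = 0"
      proof -
        assume 1: "c \<psi>0 * \<psi>0 (a * x) + (\<Sum>\<psi>\<in>S. c \<psi> * \<psi> (a * x)) = 0"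
          and 2: "\<psi>0 a * (c \<psi>0 * \<psi>0 x + (\<Sum>\<psi>\<in>S. c \<psi> * \<psi> x)) = 0"
          and 3: "(\<Sum>\<psi>\<in>S. c \<psi> * \<psi> (a * x)) = (\<Sum>\<psi>\<in>S. c \<psi> * (\<psi> a * \<psi> x))"
          and 4: "\<psi>0 (a * x) = \<psi>0 a * \<psi>0 x"
        have "(\<Sum>\<psi>\<in>S. c \<psi> * (\<psi> a - \<psi>0 a) * \<psi> x) = (\<Sum>\<psi>\<in>S. c \<psi> * (\<psi> a * \<psi> x) - \<psi>0 a * (c \<psi> * \<psi> x))"
          by (intro sum.cong) (auto simp: algebra_simps)
        also have "\<dots> = (\<Sum>\<psi>\<in>S. c \<psi> * (\<psi> a * \<psi> x)) - \<psi>0 a * (\<Sum>\<psi>\<in>S. c \<psi> * \<psi> x)"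
          by (simp only: sum_subtractf sum_distrib_left)
        also have "\<dots> = 0"
        proof -
          have "c \<psi>0 * (\<psi>0 a * \<psi>0 x) + (\<Sum>\<psi>\<in>S. c \<psi> * (\<psi> a * \<psi> x))
              = c \<psi>0 * (\<psi>0 a * \<psi>0 x) + \<psi>0 a * (\<Sum>\<psi>\<in>S. c \<psi> * \<psi> x)"
            using 1 2 unfolding 3 4 by (simp only: distrib_left mult.left_commute)
          then show ?thesis by simp
        qed
        finally show ?thesis .
      qed
    qed (use insert.prems in auto)
    then show ?thesis using \<psi> by blast
  qed
  have S0: "c \<psi> = 0" if \<psi>: "\<psi> \<in> S" for \<psi>
  proof -
    have "\<psi> \<noteq> \<psi>0" using \<psi> insert.hyps by blast
    then obtain a where "a \<in> E" "\<psi> a \<noteq> \<psi>0 a"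
      using insert.prems(1) \<psi> by (metis extensionalityI in_mono insertI1 insertI2)
    then show ?thesis using *[OF _ \<psi>, of a] by simp
  qed
  have "c \<psi>0 * \<psi>0 1 = 0" using insert.prems(6)[OF insert.prems(2)] insert.hyps S0 by simp
  moreover have "\<psi>0 1 = 1" using insert.prems(5) by blast
  ultimately show ?case using S0 by auto
qed simp

interpretation ext_vs: vector_space "ext_scale :: 'k::field \<Rightarrow> _"
  by unfold_locales (auto simp: ext_scale_def algebra_simps)

section \<open>Restrictions of automorphisms determined by finitely many values\<close>

lemma finite_image_factor:
  assumes "finite (g ` A)" "\<And>x y. x \<in> A \<Longrightarrow> y \<in> A \<Longrightarrow> g x = g y \<Longrightarrow> f x = f y"
  shows "finite (f ` A)"
proof -
  have "f x = f (SOME y. y \<in> A \<and> g y = g x)" if "x \<in> A" for x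
    using someI[of "\<lambda>y. y \<in> A \<and> g y = g x" x] that assms(2) by metis
  then have "f ` A \<subseteq> (\<lambda>u. f (SOME y. y \<in> A \<and> g y = u)) ` g ` A" by blast
  then show ?thesis using assms(1) finite_subset by blast
qed

lemma finite_gal_restrict:
  assumes "finite B" shows "finite ((\<lambda>\<sigma>. restrict \<sigma> B) ` gal_set UNIV)"
proof (rule finite_subset)
  show "(\<lambda>\<sigma>. restrict \<sigma> B) ` gal_set UNIV \<subseteq> PiE B (\<lambda>x. {\<sigma> x |\<sigma>. \<sigma> \<in> gal_set UNIV})" by auto
  show "finite (PiE B (\<lambda>x. {\<sigma> x |\<sigma>. \<sigma> \<in> gal_set UNIV}))"
    using assms by (intro finite_PiE finite_conjugates)
qed

text \<open>\<open>determined B\<close> plays the role of the field generated by \<open>B\<close>; Hilbert 90 below sums over the finitely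
  many restrictions of automorphisms to it, so that no splitting field is needed.\<close>

definition determined :: "'k::field alg_closure set \<Rightarrow> 'k alg_closure set" where
  "determined B = {x. \<forall>\<sigma>\<in>gal_set UNIV. \<forall>\<tau>\<in>gal_set UNIV. (\<forall>b\<in>B. \<sigma> b = \<tau> b) \<longrightarrow> \<sigma> x = \<tau> x}"

lemma determined_superset: "B \<subseteq> determined B"
  by (auto simp: determined_def)

lemma determinedI:
  assumes "\<And>\<sigma> \<tau>. gal_elem \<sigma> \<Longrightarrow> gal_elem \<tau> \<Longrightarrow> \<forall>b\<in>B. \<sigma> b = \<tau> b \<Longrightarrow> \<sigma> x = \<tau> x"
  shows "x \<in> determined B"
  using assms by (simp add: determined_def gal_elem_def)

lemma determinedD:
  assumes "x \<in> determined B" "gal_elem \<sigma>" "gal_elem \<tau>" "\<forall>b\<in>B. \<sigma> b = \<tau> b"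
  shows "\<sigma> x = \<tau> x"
  using assms by (simp add: determined_def gal_elem_def)

lemma determined_to_ac: "to_ac c \<in> determined B"
proof (rule determinedI)
  fix \<sigma> \<tau> :: "'a alg_closure \<Rightarrow> 'a alg_closure" assume "gal_elem \<sigma>" "gal_elem \<tau>"
  then interpret s: gal_elem \<sigma> + t: gal_elem \<tau> by simp_all
  show "\<sigma> (to_ac c) = \<tau> (to_ac c)" by simp
qed

lemma determined_0: "0 \<in> determined B" and determined_1: "1 \<in> determined B"
  using determined_to_ac[of 0 B] determined_to_ac[of 1 B] by simp_all

lemma determined_add_mult:
  assumes "x \<in> determined B" "y \<in> determined B"
  shows determined_add: "x + y \<in> determined B" and determined_mult: "x * y \<in> determined B"
proof -
  have *: "\<sigma> (x + y) = \<tau> (x + y) \<and> \<sigma> (x * y) = \<tau> (x * y)"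
    if st: "gal_elem \<sigma>" "gal_elem \<tau>" "\<forall>b\<in>B. \<sigma> b = \<tau> b" for \<sigma> \<tau>
  proof -
    interpret s: gal_elem \<sigma> + t: gal_elem \<tau> using st by simp_all
    show ?thesis using determinedD[OF assms(1) st] determinedD[OF assms(2) st] by simp
  qed
  show "x + y \<in> determined B" by (rule determinedI) (rule conjunct1[OF *])
  show "x * y \<in> determined B" by (rule determinedI) (rule conjunct2[OF *])
qed

lemma span_determined: "module.span ext_scale B \<subseteq> determined B"
proof
  fix x assume "x \<in> module.span ext_scale B"
  then show "x \<in> determined B"
  proof (induction rule: ext_vs.span_induct_alt)
    case base then show ?case by (rule determined_0)
  next
    case (step c b y)
    then have "b \<in> determined B" using determined_superset by blast
    then show ?case unfolding ext_scale_def
      by (intro determined_add[OF _ step(2)] determined_mult[OF determined_to_ac])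
  qed
qed

lemma restrict_determined_eq_iff:
  assumes "\<sigma> \<in> gal_set UNIV" "\<tau> \<in> gal_set UNIV"
  shows "restrict \<sigma> (determined B) = restrict \<tau> (determined B) \<longleftrightarrow> restrict \<sigma> B = restrict \<tau> B"
proof
  assume "restrict \<sigma> (determined B) = restrict \<tau> (determined B)"
  then have "\<forall>x\<in>determined B. \<sigma> x = \<tau> x" by (metis restrict_apply')
  then show "restrict \<sigma> B = restrict \<tau> B" using determined_superset by (intro restrict_ext) blast
next
  assume "restrict \<sigma> B = restrict \<tau> B"
  then have "\<forall>x\<in>B. \<sigma> x = \<tau> x" by (metis restrict_apply')
  then show "restrict \<sigma> (determined B) = restrict \<tau> (determined B)"
    using assms by (intro restrict_ext) (auto simp: determined_def)
qed

lemma finite_gal_restrict_determined: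
  assumes "finite B" "E \<subseteq> determined B" shows "finite ((\<lambda>\<sigma>. restrict \<sigma> E) ` gal_set UNIV)"
proof (rule finite_image_factor[OF finite_gal_restrict[OF assms(1)]])
  fix \<sigma> \<tau> assume "\<sigma> \<in> gal_set UNIV" "\<tau> \<in> gal_set UNIV" "restrict \<sigma> B = restrict \<tau> B"
  then have "restrict \<sigma> (determined B) = restrict \<tau> (determined B)" by (simp add: restrict_determined_eq_iff)
  then show "restrict \<sigma> E = restrict \<tau> E" using assms(2) by (metis restrict_restrict inf.absorb2)
qed

text \<open>Left translation by \<sigma>, used both for classes of automorphisms and for
  \<open>gal_set E\<close>: it is injective because \<sigma> is, and onto because S is
  finite.\<close>

lemma bij_betw_gal_compose:
  assumes \<sigma>: "\<sigma> \<in> gal_set UNIV" and S: "finite S" "S \<subseteq> extensional E"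
    and closed: "\<And>\<rho>. \<rho> \<in> S \<Longrightarrow> restrict (\<sigma> \<circ> \<rho>) E \<in> S"
  shows "bij_betw (\<lambda>\<rho>. restrict (\<sigma> \<circ> \<rho>) E) S S"
proof -
  have "inj_on (\<lambda>\<rho>. restrict (\<sigma> \<circ> \<rho>) E) S"
  proof (rule inj_onI)
    fix \<rho> \<rho>' assume *: "\<rho> \<in> S" "\<rho>' \<in> S" "restrict (\<sigma> \<circ> \<rho>) E = restrict (\<sigma> \<circ> \<rho>') E"
    have "\<rho> x = \<rho>' x" if "x \<in> E" for x
      using fun_cong[OF *(3), of x] that gal_elem.eq_iff[OF gal_elem.intro[OF \<sigma>]] by simp
    then show "\<rho> = \<rho>'" using * S(2) by (intro extensionalityI[of _ E]) auto
  qed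
  moreover have "(\<lambda>\<rho>. restrict (\<sigma> \<circ> \<rho>) E) ` S \<subseteq> S" using closed by blast
  ultimately show ?thesis using S(1) by (simp add: bij_betw_def endo_inj_surj)
qed

section \<open>Hilbert 90 for units and for GL_3\<close>

locale gal_class =
  fixes B :: "'k::field alg_closure set"
  assumes finite_B: "finite B"
begin

abbreviation "E \<equiv> determined B"

definition gclasses where "gclasses = (\<lambda>\<sigma>. restrict \<sigma> E) ` gal_set UNIV"

lemma finite_classes: "finite gclasses" and classes_ext: "gclasses \<subseteq> extensional E"
  using finite_gal_restrict_determined[OF finite_B order_refl] by (auto simp: gclasses_def)

lemma gclassesE:
  assumes "\<rho> \<in> gclasses" obtains \<tau> where "gal_elem \<tau>" "\<rho> = restrict \<tau> E"
  using assms unfolding gclasses_def gal_elem_def by blast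

text \<open>A function of automorphisms read off at a representative; meaningful when it depends
  only on the values on B.\<close>

definition on_class where "on_class h \<rho> = h (SOME \<sigma>. \<sigma> \<in> gal_set UNIV \<and> restrict \<sigma> E = \<rho>)"

lemma on_class_restrict:
  assumes h: "\<And>\<sigma> \<tau>. \<sigma> \<in> gal_set UNIV \<Longrightarrow> \<tau> \<in> gal_set UNIV \<Longrightarrow> restrict \<sigma> B = restrict \<tau> B \<Longrightarrow> h \<sigma> = h \<tau>"
    and \<sigma>: "\<sigma> \<in> gal_set UNIV"
  shows "on_class h (restrict \<sigma> E) = h \<sigma>"
proof -
  have "\<exists>\<tau>. \<tau> \<in> gal_set UNIV \<and> restrict \<tau> E = restrict \<sigma> E" using \<sigma> by blast
  from someI_ex[OF this] show ?thesis
    unfolding on_class_def using h \<sigma> restrict_determined_eq_iff[OF _ \<sigma>] by blast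
qed

lemma restrict_comp_restrict: "restrict (\<sigma> \<circ> restrict \<tau> E) E = restrict (\<sigma> \<circ> \<tau>) E"
  by (auto simp: restrict_def)

lemma bij_classes: "\<sigma> \<in> gal_set UNIV \<Longrightarrow> bij_betw (\<lambda>\<rho>. restrict (\<sigma> \<circ> \<rho>) E) gclasses gclasses"
  by (rule bij_betw_gal_compose[OF _ finite_classes classes_ext])
    (auto simp: gclasses_def restrict_comp_restrict gal_comp)

lemma classes_independent:
  assumes "\<And>x. x \<in> E \<Longrightarrow> (\<Sum>\<rho>\<in>gclasses. c \<rho> * \<rho> x) = 0"
  shows "\<forall>\<rho>\<in>gclasses. c \<rho> = 0"
proof (rule characters_independent[OF finite_classes classes_ext determined_1 determined_mult _ _ assms])
  show "\<rho> (x * y) = \<rho> x * \<rho> y" if r: "\<rho> \<in> gclasses" and "x \<in> E" "y \<in> E" for \<rho> x y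
  proof -
    obtain \<tau> where "gal_elem \<tau>" "\<rho> = restrict \<tau> E" by (rule gclassesE[OF r])
    then interpret gal_elem \<tau> by simp
    show ?thesis using that \<open>\<rho> = _\<close> by (simp add: determined_mult)
  qed
  show "\<rho> 1 = 1" if r: "\<rho> \<in> gclasses" for \<rho>
  proof -
    obtain \<tau> where "gal_elem \<tau>" "\<rho> = restrict \<tau> E" by (rule gclassesE[OF r])
    then interpret gal_elem \<tau> by simp
    show ?thesis using \<open>\<rho> = _\<close> by (simp add: determined_1)
  qed
qed

text \<open>Take w to be the sum of c(\<rho>) \<rho>(x) over the classes, at an x where it is
  nonzero; Dedekind's theorem provides x. By the cocycle law, w \<mapsto> c(\<sigma>) \<sigma>(w)
  only permutes the summands. The values of c may lie outside E, since \<sigma> acts on them as an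
  automorphism of the whole closure.\<close>

lemma hilbert90_units:
  assumes h: "\<And>\<sigma> \<tau>. \<sigma> \<in> gal_set UNIV \<Longrightarrow> \<tau> \<in> gal_set UNIV \<Longrightarrow> restrict \<sigma> B = restrict \<tau> B \<Longrightarrow> c \<sigma> = c \<tau>"
    and cocycle: "\<And>\<sigma> \<tau>. \<sigma> \<in> gal_set UNIV \<Longrightarrow> \<tau> \<in> gal_set UNIV \<Longrightarrow> c (\<sigma> \<circ> \<tau>) = c \<sigma> * \<sigma> (c \<tau>)"
    and nz: "\<And>\<sigma>. \<sigma> \<in> gal_set UNIV \<Longrightarrow> c \<sigma> \<noteq> 0"
  shows "\<exists>w. w \<noteq> 0 \<and> (\<forall>\<sigma>\<in>gal_set UNIV. c \<sigma> * \<sigma> w = w)"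
proof -
  have id: "restrict id E \<in> gclasses" unfolding gclasses_def using gal_id by blast
  have oc: "on_class c (restrict \<sigma> E) = c \<sigma>" if "\<sigma> \<in> gal_set UNIV" for \<sigma>
    by (rule on_class_restrict[OF h that])
  have "on_class c (restrict id E) \<noteq> 0" unfolding oc[OF gal_id] by (rule nz[OF gal_id])
  then obtain x where x: "x \<in> E" "(\<Sum>\<rho>\<in>gclasses. on_class c \<rho> * \<rho> x) \<noteq> 0"
    using id classes_independent[of "on_class c"] by blast
  define w where "w = (\<Sum>\<rho>\<in>gclasses. on_class c \<rho> * \<rho> x)"
  have "c \<sigma> * \<sigma> w = w" if \<sigma>: "\<sigma> \<in> gal_set UNIV" for \<sigma>
  proof -
    interpret gal_elem \<sigma> using \<sigma> by unfold_locales
    have "c \<sigma> * \<sigma> w = (\<Sum>\<rho>\<in>gclasses. c \<sigma> * \<sigma> (on_class c \<rho>) * \<sigma> (\<rho> x))"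
      by (simp add: w_def sum_distrib_left mult.assoc)
    also have "\<dots> = (\<Sum>\<rho>\<in>gclasses. on_class c (restrict (\<sigma> \<circ> \<rho>) E) * restrict (\<sigma> \<circ> \<rho>) E x)"
    proof (rule sum.cong)
      fix \<rho> assume "\<rho> \<in> gclasses"
      then obtain \<tau> where \<tau>: "\<tau> \<in> gal_set UNIV" "\<rho> = restrict \<tau> E" unfolding gclasses_def by blast
      show "c \<sigma> * \<sigma> (on_class c \<rho>) * \<sigma> (\<rho> x) = on_class c (restrict (\<sigma> \<circ> \<rho>) E) * restrict (\<sigma> \<circ> \<rho>) E x"
        unfolding \<tau>(2) restrict_comp_restrict oc[OF \<tau>(1)] oc[OF gal_comp[OF \<sigma> \<tau>(1)]] cocycle[OF \<sigma> \<tau>(1)]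
        using x by simp
    qed simp
    also have "\<dots> = w"
      unfolding w_def using sum.reindex_bij_betw[OF bij_classes[OF \<sigma>], of "\<lambda>\<rho>. on_class c \<rho> * \<rho> x"] .
    finally show ?thesis .
  qed
  then show ?thesis using x w_def by blast
qed

end

text \<open>No nonzero functional vanishes on W, so W spans the space and contains a basis, whose
  members become the columns.\<close>

lemma invertible_with_columns_in:
  fixes W :: "('a::field ^ 3) set"
  assumes "\<And>u. (\<And>w. w \<in> W \<Longrightarrow> (\<Sum>i\<in>UNIV. u $ i * w $ i) = 0) \<Longrightarrow> u = 0"
  shows "\<exists>A :: 'a ^ 3 ^ 3. invertible A \<and> (\<forall>j. (\<chi> i. A $ i $ j) \<in> W)"
proof -
  obtain B0 where B0: "B0 \<subseteq> W" "vec.independent B0" "W \<subseteq> vec.span B0"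
    using vec.maximal_independent_subset by blast
  have "finite B0" "card B0 \<le> card (cart_basis :: ('a ^ 3) set)"
    using vec.independent_span_bound[OF finite_cart_basis B0(2)] span_cart_basis by auto
  then have fin: "finite B0" "card B0 \<le> CARD(3)" by (simp_all add: card_cart_basis)
  have "B0 \<noteq> {}"
  proof
    assume "B0 = {}"
    then have "W \<subseteq> {0}" using B0(3) by simp
    then have "(1 :: 'a ^ 3) = 0" by (intro assms) auto
    then show False by (simp add: vec_eq_iff)
  qed
  \<comment> \<open>An enumeration of B0 by three indices that allows repetitions; the invertibility
    proved below excludes them.\<close>
  then obtain f :: "3 \<Rightarrow> 'a ^ 3" where f: "range f = B0"
  proof -
    obtain h :: "'a ^ 3 \<Rightarrow> 3" where h: "inj_on h B0"
      using fin card_le_inj[of B0 "UNIV :: 3 set"] by auto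
    obtain b where b: "b \<in> B0" using \<open>B0 \<noteq> {}\<close> by blast
    let ?f = "\<lambda>i. if i \<in> h ` B0 then inv_into B0 h i else b"
    have "range ?f = B0"
    proof
      show "range ?f \<subseteq> B0" using b by (auto simp: h)
      show "B0 \<subseteq> range ?f"
      proof
        fix x assume x: "x \<in> B0"
        then have "?f (h x) = x" using h by simp
        then show "x \<in> range ?f" by (intro range_eqI[of _ _ "h x"]) simp
      qed
    qed
    then show ?thesis using that by blast
  qed
  \<comment> \<open>The vectors f j are the rows here, so that a vector in the kernel is a
    functional vanishing on B0; the transpose is the matrix wanted.\<close>
  define A where "A = (\<chi> j. f j)"
  have "invertible A"
  proof (rule ccontr)
    assume "\<not> invertible A"
    then obtain u where u: "A *v u = 0" "u \<noteq> 0"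
      using matrix_left_invertible_ker[of A] by (auto simp: invertible_left_inverse)
    have "w \<in> {w. (\<Sum>i\<in>UNIV. u $ i * w $ i) = 0}" if "w \<in> vec.span B0" for w
    using that
    proof (induction rule: vec.span_induct_alt)
      case base show ?case by simp
    next
      case (step c x y)
      obtain j where "x = f j" using f step(1) by auto
      then have "(\<Sum>i\<in>UNIV. x $ i * u $ i) = (A *v u) $ j" by (simp add: A_def matrix_vector_mult_def)
      then have "(\<Sum>i\<in>UNIV. u $ i * x $ i) = 0" using u by (simp add: mult.commute)
      moreover have "(\<Sum>i\<in>UNIV. u $ i * (c *s x) $ i) = c * (\<Sum>i\<in>UNIV. u $ i * x $ i)"
        by (simp add: sum_distrib_left mult.left_commute)
      ultimately show ?case using step(2) by (simp add: distrib_left sum.distrib)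
    qed
    then have "u = 0" using B0(3) by (intro assms) blast
    then show False using u by simp
  qed
  then have "invertible (transpose A)" by (simp add: invertible_det_nz)
  moreover have "(\<chi> i. transpose A $ i $ j) \<in> W" for j
  proof -
    have "(\<chi> i. transpose A $ i $ j) = f j" by (simp add: A_def transpose_def vec_eq_iff)
    then show ?thesis using f B0(1) by auto
  qed
  ultimately show ?thesis by blast
qed

context gal_elem
begin

lemma gal_vec_mult: "gal_vec \<sigma> (M *v p) = gal_mat \<sigma> M *v gal_vec \<sigma> p"
  by (simp add: gal_mat_def gal_vec_def matrix_vector_mult_def vec_eq_iff)

lemma det_gal_mat: "det (gal_mat \<sigma> M) = \<sigma> (det M)"
  by (simp add: det_3 gal_mat_def)

lemma invertible_gal_mat: "invertible M \<Longrightarrow> invertible (gal_mat \<sigma> M)"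
  by (simp add: invertible_det_nz det_gal_mat)

end

lemma matrix_vector_mult_sum: "A *v (\<Sum>x\<in>S. h x) = (\<Sum>x\<in>S. A *v h x)"
  for A :: "'a::comm_ring_1 ^ 'n ^ 'm"
  by (induction S rule: infinite_finite_induct) (auto simp: matrix_vector_right_distrib)

lemma matrix_inv_inverse:
  fixes A :: "'a::field ^ 'n ^ 'n"
  assumes "invertible A"
  shows "A ** matrix_inv A = mat 1" "matrix_inv A ** A = mat 1"
  using someI_ex[OF assms[unfolded invertible_def]] by (auto simp: matrix_inv_def)

context gal_class
begin

text \<open>As for units, the sum b(x) of N(\<rho>) \<rho>(x) over the classes satisfies N(\<sigma>)
  \<sigma>(b(x)) = b(x). Such vectors have to supply the columns of an invertible matrix, which is
  the purpose of \<open>invertible_with_columns_in\<close>.\<close>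

lemma hilbert90_GL3:
  assumes h: "\<And>\<sigma> \<tau>. \<sigma> \<in> gal_set UNIV \<Longrightarrow> \<tau> \<in> gal_set UNIV \<Longrightarrow> restrict \<sigma> B = restrict \<tau> B \<Longrightarrow> N \<sigma> = N \<tau>"
    and cocycle: "\<And>\<sigma> \<tau>. \<sigma> \<in> gal_set UNIV \<Longrightarrow> \<tau> \<in> gal_set UNIV \<Longrightarrow> N (\<sigma> \<circ> \<tau>) = N \<sigma> ** gal_mat \<sigma> (N \<tau>)"
    and inv: "\<And>\<sigma>. \<sigma> \<in> gal_set UNIV \<Longrightarrow> invertible (N \<sigma>)"
  shows "\<exists>M. invertible M \<and> (\<forall>\<sigma>\<in>gal_set UNIV. N \<sigma> = M ** matrix_inv (gal_mat \<sigma> M))"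
proof -
  have oc: "on_class N (restrict \<sigma> E) = N \<sigma>" if "\<sigma> \<in> gal_set UNIV" for \<sigma>
    by (rule on_class_restrict[OF h that])
  define b where "b x = (\<Sum>\<rho>\<in>gclasses. on_class N \<rho> *v (\<chi> i. \<rho> (x $ i)))" for x :: "'k alg_closure ^ 3"
  define W where "W = b ` {x. \<forall>i. x $ i \<in> E}"
  have "\<exists>M :: 'k alg_closure ^ 3 ^ 3. invertible M \<and> (\<forall>j. (\<chi> i. M $ i $ j) \<in> W)"
  proof (rule invertible_with_columns_in)
    fix u :: "'k alg_closure ^ 3"
    assume u: "\<And>w. w \<in> W \<Longrightarrow> (\<Sum>i\<in>UNIV. u $ i * w $ i) = 0"
    have "(\<Sum>i\<in>UNIV. u $ i * on_class N (restrict id E) $ i $ j) = 0" for j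
    proof -
      \<comment> \<open>Evaluated on vectors supported in the single coordinate j, a functional u
        that kills W becomes a linear relation between characters.\<close>
      have "\<forall>\<rho>\<in>gclasses. (\<Sum>i\<in>UNIV. u $ i * on_class N \<rho> $ i $ j) = 0"
      proof (rule classes_independent)
        fix x assume x: "x \<in> E"
        let ?x = "(\<chi> k. if k = j then x else 0)"
        have \<rho>0: "\<rho> 0 = 0" if r: "\<rho> \<in> gclasses" for \<rho>
        proof -
          obtain \<tau> where "gal_elem \<tau>" "\<rho> = restrict \<tau> E" by (rule gclassesE[OF r])
          then interpret gal_elem \<tau> by simp
          show ?thesis using \<open>\<rho> = _\<close> by (simp add: determined_0)
        qed
        have "on_class N \<rho> *v (\<chi> i. \<rho> (?x $ i)) = (\<chi> i. on_class N \<rho> $ i $ j * \<rho> x)" if "\<rho> \<in> gclasses" for \<rho>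
          using \<rho>0[OF that] by (simp add: matrix_vector_mult_def vec_eq_iff if_distrib[of \<rho>] if_distrib[of "\<lambda>z. _ * z"] cong: if_cong)
        then have "b ?x = (\<Sum>\<rho>\<in>gclasses. \<chi> i. on_class N \<rho> $ i $ j * \<rho> x)" by (simp add: b_def)
        moreover have "b ?x \<in> W" using x by (auto simp: W_def determined_0)
        ultimately have "(\<Sum>i\<in>UNIV. u $ i * (\<Sum>\<rho>\<in>gclasses. on_class N \<rho> $ i $ j * \<rho> x)) = 0" using u[of "b ?x"] by simp
        then have "(\<Sum>i\<in>UNIV. \<Sum>\<rho>\<in>gclasses. u $ i * on_class N \<rho> $ i $ j * \<rho> x) = 0"
          by (simp add: sum_distrib_left mult.assoc)
        then show "(\<Sum>\<rho>\<in>gclasses. (\<Sum>i\<in>UNIV. u $ i * on_class N \<rho> $ i $ j) * \<rho> x) = 0"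
          by (subst (asm) sum.swap) (simp add: sum_distrib_right)
      qed
      moreover have "restrict id E \<in> gclasses" unfolding gclasses_def using gal_id by blast
      ultimately show ?thesis by blast
    qed
    \<comment> \<open>The coefficients at the class of the identity say that u is orthogonal to
      every column of \<open>N id\<close>, which is invertible.\<close>
    then have "transpose (N id) *v u = 0"
      unfolding oc[OF gal_id] by (simp add: matrix_vector_mult_def transpose_def vec_eq_iff mult.commute)
    moreover have "invertible (transpose (N id))" using inv[OF gal_id] by (simp add: invertible_det_nz)
    ultimately show "u = 0" using matrix_left_invertible_ker[of "transpose (N id)"] by (auto simp: invertible_left_inverse)
  qed
  then obtain M :: "'k alg_closure ^ 3 ^ 3" where M: "invertible M" "\<And>j. (\<chi> i. M $ i $ j) \<in> W" by blast
  have b: "N \<sigma> *v gal_vec \<sigma> (b x) = b x" if \<sigma>: "\<sigma> \<in> gal_set UNIV" and x: "\<forall>i. x $ i \<in> E" for \<sigma> and x :: "'k alg_closure ^ 3"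
  proof -
    interpret gal_elem \<sigma> using \<sigma> by unfold_locales
    have gv: "gal_vec \<sigma> (\<Sum>\<rho>\<in>S. h \<rho>) = (\<Sum>\<rho>\<in>S. gal_vec \<sigma> (h \<rho>))" for h and S :: "('k alg_closure \<Rightarrow> 'k alg_closure) set"
      by (simp add: gal_vec_def vec_eq_iff)
    have "N \<sigma> *v gal_vec \<sigma> (b x) = (\<Sum>\<rho>\<in>gclasses. N \<sigma> *v (gal_mat \<sigma> (on_class N \<rho>) *v gal_vec \<sigma> (\<chi> i. \<rho> (x $ i))))"
      by (simp add: b_def gv gal_vec_mult matrix_vector_mult_sum)
    also have "\<dots> = (\<Sum>\<rho>\<in>gclasses. on_class N (restrict (\<sigma> \<circ> \<rho>) E) *v (\<chi> i. restrict (\<sigma> \<circ> \<rho>) E (x $ i)))"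
    proof (rule sum.cong)
      fix \<rho> assume "\<rho> \<in> gclasses"
      then obtain \<tau> where \<tau>: "\<tau> \<in> gal_set UNIV" "\<rho> = restrict \<tau> E" unfolding gclasses_def by blast
      have 1: "gal_vec \<sigma> (\<chi> i. \<rho> (x $ i)) = (\<chi> i. restrict (\<sigma> \<circ> \<rho>) E (x $ i))"
        using x by (simp add: gal_vec_def vec_eq_iff)
      have 2: "on_class N (restrict (\<sigma> \<circ> \<rho>) E) = N \<sigma> ** gal_mat \<sigma> (on_class N \<rho>)"
        unfolding \<tau>(2) restrict_comp_restrict oc[OF \<tau>(1)] oc[OF gal_comp[OF \<sigma> \<tau>(1)]]
        by (rule cocycle[OF \<sigma> \<tau>(1)])
      show "N \<sigma> *v (gal_mat \<sigma> (on_class N \<rho>) *v gal_vec \<sigma> (\<chi> i. \<rho> (x $ i)))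
         = on_class N (restrict (\<sigma> \<circ> \<rho>) E) *v (\<chi> i. restrict (\<sigma> \<circ> \<rho>) E (x $ i))"
        unfolding 1 2 by (simp add: matrix_vector_mul_assoc)
    qed simp
    also have "\<dots> = b x"
      unfolding b_def using sum.reindex_bij_betw[OF bij_classes[OF \<sigma>], of "\<lambda>\<rho>. on_class N \<rho> *v (\<chi> i. \<rho> (x $ i))"] .
    finally show ?thesis .
  qed
  have "N \<sigma> = M ** matrix_inv (gal_mat \<sigma> M)" if \<sigma>: "\<sigma> \<in> gal_set UNIV" for \<sigma>
  proof -
    interpret gal_elem \<sigma> using \<sigma> by unfold_locales
    have "(N \<sigma> ** gal_mat \<sigma> M) $ i $ j = M $ i $ j" for i j
    proof -
      obtain x :: "'k alg_closure ^ 3" where x: "(\<chi> i. M $ i $ j) = b x" "\<forall>i. x $ i \<in> E" using M(2)[of j] by (auto simp: W_def)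
      have "(N \<sigma> ** gal_mat \<sigma> M) $ i $ j = (N \<sigma> *v gal_vec \<sigma> (\<chi> i. M $ i $ j)) $ i"
        by (simp add: matrix_matrix_mult_def matrix_vector_mult_def gal_vec_def gal_mat_def)
      also have "\<dots> = M $ i $ j" using b[OF \<sigma> x(2)] x(1) by (metis vec_lambda_beta)
      finally show ?thesis .
    qed
    then have "N \<sigma> ** gal_mat \<sigma> M = M" by (simp add: vec_eq_iff)
    then show ?thesis
      using matrix_inv_inverse(1)[OF invertible_gal_mat[OF M(1)]] by (metis matrix_mul_assoc matrix_mul_rid)
  qed
  then show ?thesis using M(1) by blast
qed

end

section \<open>Finite Galois extensions\<close>

context gal_elem
begin

lemma map_poly_mult: "map_poly \<sigma> (p * q) = map_poly \<sigma> p * map_poly \<sigma> q"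
  by (rule poly_eqI) (simp add: coeff_map_poly coeff_mult)

lemma map_poly_prod: "map_poly \<sigma> (\<Prod>x\<in>A. h x) = (\<Prod>x\<in>A. map_poly \<sigma> (h x))"
  by (induction A rule: infinite_finite_induct) (auto simp: map_poly_mult)

lemma poly_map_poly: "\<sigma> (poly p x) = poly (map_poly \<sigma> p) (\<sigma> x)"
  by (induction p) (auto simp: map_poly_pCons)

lemma base_fixed: "x \<in> base_field \<Longrightarrow> \<sigma> x = x"
  by (auto simp: base_field_def)

end

locale finite_galois_ext =
  fixes E :: "'k::field alg_closure set"
  assumes finite_galois: "finite_galois E"
begin

lemma intermediate: "intermediate_field E"
  using finite_galois by (simp add: finite_galois_def finite_ext_def)

lemma base_sub: "base_field \<subseteq> E" and add_mem: "x \<in> E \<Longrightarrow> y \<in> E \<Longrightarrow> x + y \<in> E"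
  and mult_mem: "x \<in> E \<Longrightarrow> y \<in> E \<Longrightarrow> x * y \<in> E" and uminus_mem: "x \<in> E \<Longrightarrow> - x \<in> E"
  using intermediate by (auto simp: intermediate_field_def)

lemma to_ac_mem: "to_ac c \<in> E" using base_sub by (auto simp: base_field_def)

lemma zero_mem: "0 \<in> E" and one_mem: "1 \<in> E" using to_ac_mem[of 0] to_ac_mem[of 1] by simp_all

sublocale subring_set E
  by unfold_locales (auto intro: zero_mem one_mem add_mem mult_mem)

lemma fixed_in_base: "x \<in> E \<Longrightarrow> (\<And>\<tau>. \<tau> \<in> gal_set E \<Longrightarrow> \<tau> x = x) \<Longrightarrow> x \<in> base_field"
  using finite_galois unfolding finite_galois_def by blast

text \<open>The graph of \<tau> is a partial embedding.\<close>

lemma gal_set_extends: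
  assumes \<tau>: "\<tau> \<in> gal_set E"
  obtains \<sigma> where "gal_elem \<sigma>" "\<tau> = restrict \<sigma> E"
proof -
  have hom: "\<tau> (x + y) = \<tau> x + \<tau> y" "\<tau> (x * y) = \<tau> x * \<tau> y" if "x \<in> E" "y \<in> E" for x y
    using \<tau> that by (auto simp: gal_set_def)
  have base: "\<tau> (to_ac c) = to_ac c" for c using \<tau> by (auto simp: gal_set_def base_field_def)
  have "hom_graph {(x, \<tau> x) |x. x \<in> E}"
    unfolding hom_graph_def using hom base to_ac_mem base[of 0] by (auto simp: add_mem mult_mem)
  then obtain \<sigma> where \<sigma>: "\<sigma> \<in> gal_set UNIV" "\<And>x y. (x, y) \<in> {(x, \<tau> x) |x. x \<in> E} \<Longrightarrow> \<sigma> x = y"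
    using hom_graph_extends_to_gal by blast
  have "\<tau> = restrict \<sigma> E"
    using \<tau> \<sigma>(2) by (intro extensionalityI[of _ E]) (auto simp: gal_set_def)
  then show ?thesis using that \<sigma>(1) by (simp add: gal_elem_def)
qed

lemma finite_gal_set: "finite (gal_set E)"
proof -
  obtain B where B: "finite B" "E = module.span ext_scale B"
    using finite_galois by (auto simp: finite_galois_def finite_ext_def)
  have "finite ((\<lambda>\<sigma>. restrict \<sigma> E) ` gal_set UNIV)"
    using finite_gal_restrict_determined[OF B(1)] span_determined B(2) by blast
  moreover have "gal_set E \<subseteq> (\<lambda>\<sigma>. restrict \<sigma> E) ` gal_set UNIV"
  proof
    fix \<tau> assume "\<tau> \<in> gal_set E"
    then obtain \<sigma> where "gal_elem \<sigma>" "\<tau> = restrict \<sigma> E" by (rule gal_set_extends)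
    then show "\<tau> \<in> (\<lambda>\<sigma>. restrict \<sigma> E) ` gal_set UNIV" by (auto simp: gal_elem_def)
  qed
  ultimately show ?thesis by (rule finite_subset[rotated])
qed

lemma gal_set_ext: "gal_set E \<subseteq> extensional E"
  by (auto simp: gal_set_def)

lemma gal_set_mem: "\<tau> \<in> gal_set E \<Longrightarrow> x \<in> E \<Longrightarrow> \<tau> x \<in> E"
  by (auto simp: gal_set_def bij_betw_def)

lemma restrict_id_mem: "restrict id E \<in> gal_set E"
  by (auto simp: gal_set_def base_sub[THEN subsetD] add_mem mult_mem bij_betw_def inj_on_def)

lemma gal_set_compose:
  assumes "restrict \<sigma> E \<in> gal_set E" "\<rho> \<in> gal_set E"
  shows "restrict (\<sigma> \<circ> \<rho>) E \<in> gal_set E"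
proof -
  have "bij_betw \<sigma> E E" using assms(1) by (auto simp: gal_set_def cong: bij_betw_cong)
  moreover have "bij_betw \<rho> E E" using assms(2) by (auto simp: gal_set_def)
  ultimately have "bij_betw (\<sigma> \<circ> \<rho>) E E" by (rule bij_betw_trans[rotated])
  then have "bij_betw (restrict (\<sigma> \<circ> \<rho>) E) E E" by (subst bij_betw_cong[of E _ "\<sigma> \<circ> \<rho>"]) auto
  moreover have "\<sigma> (x + y) = \<sigma> x + \<sigma> y \<and> \<sigma> (x * y) = \<sigma> x * \<sigma> y" if "x \<in> E" "y \<in> E" for x y
    using assms(1) that by (auto simp: gal_set_def add_mem mult_mem)
  moreover have "\<rho> (x + y) = \<rho> x + \<rho> y \<and> \<rho> (x * y) = \<rho> x * \<rho> y" if "x \<in> E" "y \<in> E" for x y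
    using assms(2) that by (auto simp: gal_set_def)
  moreover have "\<sigma> x = x \<and> \<rho> x = x" if "x \<in> base_field" for x
  proof -
    have "restrict \<sigma> E x = x" "\<rho> x = x" using assms that unfolding gal_set_def by blast+
    moreover have "x \<in> E" using that base_sub by blast
    ultimately show ?thesis by simp
  qed
  ultimately show ?thesis unfolding gal_set_def
    using base_sub by (auto simp: add_mem mult_mem gal_set_mem[OF assms(2)])
qed

text \<open>\<open>E\<close> is normal: \<open>\<Prod> (X - \<tau> x)\<close> over the \<open>Gal(E/k)\<close>-orbit of \<open>x\<close> has coefficients in \<open>k\<close>.\<close>

lemma gal_mem:
  assumes "gal_elem \<sigma>" and x: "x \<in> E" shows "\<sigma> x \<in> E"
proof -
  interpret s: gal_elem \<sigma> by fact
  define S where "S = (\<lambda>\<tau>. \<tau> x) ` gal_set E"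
  have S: "finite S" "S \<subseteq> E" using finite_gal_set x gal_set_mem by (auto simp: S_def)
  define P where "P = (\<Prod>y\<in>S. [:- y, 1:])"
  have P_E: "Polynomial.coeff P i \<in> E" for i
  proof -
    have "\<forall>i. Polynomial.coeff (\<Prod>y\<in>S. [:- y, 1:]) i \<in> E"
      using S
    proof (induction S rule: finite_induct)
      case (insert y S)
      then have "Polynomial.coeff [:- y, 1:] i \<in> E" for i
        by (auto simp: coeff_pCons zero_mem one_mem uminus_mem split: nat.split)
      then show ?case using insert by (auto simp: coeff_mult simp del: mult_pCons_left intro!: sum_mem mult_mem)
    qed (auto simp: zero_mem one_mem)
    then show ?thesis by (simp add: P_def)
  qed
  have "Polynomial.coeff P i \<in> base_field" for i
  proof (rule fixed_in_base[OF P_E])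
    fix \<tau> assume \<tau>: "\<tau> \<in> gal_set E"
    then obtain \<sigma>' where *: "gal_elem \<sigma>'" "\<tau> = restrict \<sigma>' E" by (rule gal_set_extends)
    interpret s': gal_elem \<sigma>' by fact
    have "\<sigma>' ` S \<subseteq> S"
    proof
      fix z assume "z \<in> \<sigma>' ` S"
      then obtain \<rho> where \<rho>: "\<rho> \<in> gal_set E" "z = \<sigma>' (\<rho> x)" by (auto simp: S_def)
      have "restrict (\<sigma>' \<circ> \<rho>) E \<in> gal_set E" using gal_set_compose \<tau> \<rho> unfolding * by blast
      then have "restrict (\<sigma>' \<circ> \<rho>) E x \<in> S" unfolding S_def by blast
      then show "z \<in> S" using x \<rho> by simp
    qed
    then have im: "\<sigma>' ` S = S"
      using S(1) s'.inj by (intro endo_inj_surj) (auto intro: inj_on_subset)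
    have "map_poly \<sigma>' P = (\<Prod>y\<in>S. [:- \<sigma>' y, 1:])"
      by (simp add: P_def s'.map_poly_prod map_poly_pCons)
    also have "\<dots> = (\<Prod>y\<in>\<sigma>' ` S. [:- y, 1:])"
      using s'.inj by (subst prod.reindex) (auto intro: inj_on_subset)
    finally have "map_poly \<sigma>' P = P" by (simp add: im P_def)
    then have "\<sigma>' (Polynomial.coeff P i) = Polynomial.coeff P i" by (metis coeff_map_poly s'.zero)
    then show "\<tau> (Polynomial.coeff P i) = Polynomial.coeff P i" using P_E by (simp add: *)
  qed
  \<comment> \<open>With coefficients in k, P is fixed by every \<sigma>, so \<sigma> x is again a
    root of P, that is, an element of the orbit S, which lies in E.\<close>
  then have "map_poly \<sigma> P = P" by (intro poly_eqI) (simp add: coeff_map_poly s.base_fixed)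
  moreover have "restrict id E x \<in> S" unfolding S_def using restrict_id_mem by blast
  then have "x \<in> S" using x by simp
  then have "poly P x = 0" using S(1) by (auto simp: P_def poly_prod prod_zero_iff)
  ultimately have "poly P (\<sigma> x) = 0" using s.poly_map_poly[of P x] by simp
  then have "\<sigma> x \<in> S" using S(1) by (auto simp: P_def poly_prod prod_zero_iff)
  then show ?thesis using S(2) by blast
qed

lemma restrict_mem_gal_set: assumes "gal_elem \<sigma>" shows "restrict \<sigma> E \<in> gal_set E"
proof -
  interpret gal_elem \<sigma> by fact
  have "\<sigma> ` E = E"
  proof
    show "\<sigma> ` E \<subseteq> E" using gal_mem[OF assms] by blast
    show "E \<subseteq> \<sigma> ` E"
    proof
      fix y assume "y \<in> E"
      then have "inv_into UNIV \<sigma> y \<in> E" using gal_mem inv_mem by (simp add: gal_elem_def)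
      then show "y \<in> \<sigma> ` E" using inv_apply(2)[of y] by (metis imageI)
    qed
  qed
  then have "bij_betw \<sigma> E E" using inj by (auto simp: bij_betw_def intro: inj_on_subset)
  then have "bij_betw (restrict \<sigma> E) E E" by (subst bij_betw_cong[of E _ \<sigma>]) auto
  then show ?thesis
    using base_sub by (auto simp: gal_set_def add_mem mult_mem base_fixed)
qed

lemma bij_gal_set: "gal_elem \<sigma> \<Longrightarrow> bij_betw (\<lambda>\<rho>. restrict (\<sigma> \<circ> \<rho>) E) (gal_set E) (gal_set E)"
  by (rule bij_betw_gal_compose[OF gal_elem.mem finite_gal_set gal_set_ext])
    (auto intro: gal_set_compose restrict_mem_gal_set)

text \<open>An element of the Galois group only permutes the summands, by left translation.\<close>

lemma trace_in_base:
  assumes x: "x \<in> E" shows "(\<Sum>\<tau>\<in>gal_set E. \<tau> x) \<in> base_field"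
proof (rule fixed_in_base)
  show "(\<Sum>\<tau>\<in>gal_set E. \<tau> x) \<in> E" using x gal_set_mem by (intro sum_mem) blast
  fix \<tau> assume "\<tau> \<in> gal_set E"
  then obtain \<sigma> where *: "gal_elem \<sigma>" "\<tau> = restrict \<sigma> E" by (rule gal_set_extends)
  interpret gal_elem \<sigma> by fact
  have "\<tau> (\<Sum>\<tau>\<in>gal_set E. \<tau> x) = (\<Sum>\<rho>\<in>gal_set E. restrict (\<sigma> \<circ> \<rho>) E x)"
    using x \<open>(\<Sum>\<tau>\<in>gal_set E. \<tau> x) \<in> E\<close> by (simp add: *)
  also have "\<dots> = (\<Sum>\<tau>\<in>gal_set E. \<tau> x)"
    using sum.reindex_bij_betw[OF bij_gal_set[OF *(1)], of "\<lambda>\<rho>. \<rho> x"] .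
  finally show "\<tau> (\<Sum>\<tau>\<in>gal_set E. \<tau> x) = (\<Sum>\<tau>\<in>gal_set E. \<tau> x)" .
qed

text \<open>Both inequalities compare the rows and the columns of the matrix \<open>(\<tau> b)\<close>, for \<open>\<tau>\<close> in \<open>Gal(E/k)\<close>
  and \<open>b\<close> in a basis.  The rows are independent by Dedekind's theorem; a relation of minimal length
  between the columns has coefficients in \<open>k\<close>.\<close>

theorem card_gal_set:
  assumes perf: "perfect_field TYPE('k)"
  shows "card (gal_set E) = ext_degree E"
proof -
  obtain B0 where B0: "finite B0" "E = module.span ext_scale B0"
    using finite_galois by (auto simp: finite_galois_def finite_ext_def)
  obtain B where B: "B \<subseteq> E" "\<not> module.dependent ext_scale B" "E \<subseteq> module.span ext_scale B"
      "card B = vector_space.dim ext_scale E"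
    using ext_vs.basis_exists by blast
  have finB: "finite B" using ext_vs.independent_span_bound[OF B0(1) B(2)] B(1) B0(2) by blast
  have hom: "\<tau> (x + y) = \<tau> x + \<tau> y" "\<tau> (x * y) = \<tau> x * \<tau> y" if "\<tau> \<in> gal_set E" "x \<in> E" "y \<in> E" for \<tau> x y
    using that by (auto simp: gal_set_def)
  have base: "\<tau> (to_ac c) = to_ac c" if "\<tau> \<in> gal_set E" for \<tau> c
    using that by (auto simp: gal_set_def base_field_def)
  have "card (gal_set E) \<le> card B"
  proof (rule linear_system_card_le[OF finB finite_gal_set])
    fix c assume c: "\<And>b. b \<in> B \<Longrightarrow> (\<Sum>\<tau>\<in>gal_set E. c \<tau> * \<tau> b) = 0"
    have zero: "\<tau> 0 = 0" if "\<tau> \<in> gal_set E" for \<tau> using base[OF that, of 0] by simp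
    have "x \<in> E \<and> (\<Sum>\<tau>\<in>gal_set E. c \<tau> * \<tau> x) = 0" if "x \<in> module.span ext_scale B" for x
      using that
    proof (induction rule: ext_vs.span_induct_alt)
      case base
      then show ?case by (simp add: zero zero_mem)
    next
      case (step a b y)
      then have *: "b \<in> E" "y \<in> E" "to_ac a * b \<in> E" using B(1) by (auto intro: mult_mem to_ac_mem)
      have "(\<Sum>\<tau>\<in>gal_set E. c \<tau> * \<tau> (ext_scale a b + y))
          = (\<Sum>\<tau>\<in>gal_set E. to_ac a * (c \<tau> * \<tau> b) + c \<tau> * \<tau> y)"
        using * by (intro sum.cong) (auto simp: ext_scale_def hom base to_ac_mem algebra_simps)
      also have "\<dots> = to_ac a * (\<Sum>\<tau>\<in>gal_set E. c \<tau> * \<tau> b) + (\<Sum>\<tau>\<in>gal_set E. c \<tau> * \<tau> y)"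
        by (simp only: sum.distrib sum_distrib_left)
      finally show ?case using c[OF step(1)] step(2) * by (simp add: ext_scale_def add_mem)
    qed
    then have "(\<Sum>\<tau>\<in>gal_set E. c \<tau> * \<tau> x) = 0" if "x \<in> E" for x using that B(3) by blast
    then show "\<forall>\<tau>\<in>gal_set E. c \<tau> = 0"
      by (intro characters_independent[OF finite_gal_set gal_set_ext one_mem mult_mem])
        (auto simp: hom base[of _ 1, simplified])
  qed
  moreover have "card B \<le> card (gal_set E)"
  proof (rule linear_system_card_le[OF finite_gal_set finB])
    \<comment> \<open>A column relation, and below it the size of its support, on which the
      induction runs.\<close>
    let ?R = "\<lambda>c. \<forall>\<tau>\<in>gal_set E. (\<Sum>b\<in>B. c b * \<tau> b) = 0"
    let ?s = "\<lambda>c. card {b\<in>B. c b \<noteq> 0}"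
    have "\<forall>b\<in>B. c b = 0" if "?R c" for c
      using that
    proof (induction "?s c" arbitrary: c rule: less_induct)
      case less
      show ?case
      proof (rule ccontr)
        assume "\<not> (\<forall>b\<in>B. c b = 0)"
        then obtain b0 where b0: "b0 \<in> B" "c b0 \<noteq> 0" by blast
        \<comment> \<open>Once the coefficient at b0 is 1, the difference between the relation and
          its conjugate no longer involves b0; having smaller support, it is trivial.\<close>
        define c1 where "c1 b = c b / c b0" for b
        have c1: "c1 b0 = 1" using b0 by (simp add: c1_def)
        have R1: "?R c1" using less.prems by (simp add: c1_def sum_divide_distrib[symmetric])
        have fix_c1: "\<sigma> (c1 b) = c1 b" if \<sigma>: "gal_elem \<sigma>" and b: "b \<in> B" for \<sigma> b
        proof -
          interpret gal_elem \<sigma> by fact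
          define c2 where "c2 b = c1 b - \<sigma> (c1 b)" for b
          have "(\<Sum>b\<in>B. \<sigma> (c1 b) * \<tau> b) = 0" if \<tau>: "\<tau> \<in> gal_set E" for \<tau>
          proof -
            obtain \<rho> where \<rho>: "\<rho> \<in> gal_set E" "\<tau> = restrict (\<sigma> \<circ> \<rho>) E"
              using bij_gal_set[OF \<sigma>] \<tau> by (auto simp: bij_betw_def)
            have "(\<Sum>b\<in>B. \<sigma> (c1 b) * \<tau> b) = \<sigma> (\<Sum>b\<in>B. c1 b * \<rho> b)"
              unfolding \<rho>(2) sum using B(1) by (intro sum.cong) auto
            then show ?thesis using R1 \<rho>(1) by simp
          qed
          then have "?R c2" using R1 by (simp add: c2_def left_diff_distrib sum_subtractf)
          moreover have "{b\<in>B. c2 b \<noteq> 0} \<subseteq> {b\<in>B. c b \<noteq> 0} - {b0}"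
            using c1 by (auto simp: c2_def c1_def)
          then have "{b\<in>B. c2 b \<noteq> 0} \<subset> {b\<in>B. c b \<noteq> 0}"
            using b0 by blast
          then have "?s c2 < ?s c" using finB by (intro psubset_card_mono) auto
          ultimately have "\<forall>b\<in>B. c2 b = 0" using less.hyps by blast
          then show ?thesis using b by (simp add: c2_def)
        qed
        have "\<exists>a. c1 b = to_ac a" if "b \<in> B" for b
          using gal_fixed_in_base[OF perf, of "c1 b"] fix_c1[OF _ that] by (auto simp: gal_elem_def base_field_def)
        then obtain a where a: "\<And>b. b \<in> B \<Longrightarrow> c1 b = to_ac (a b)" by metis
        \<comment> \<open>At the identity of the Galois group the relation becomes a linear
          dependence over k between elements of the basis.\<close>
        have "(\<Sum>b\<in>B. ext_scale (a b) b) = (\<Sum>b\<in>B. c1 b * restrict id E b)"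
          using B(1) a by (intro sum.cong) (auto simp: ext_scale_def)
        also have "\<dots> = 0" using R1 restrict_id_mem by blast
        finally have "(\<Sum>b\<in>B. ext_scale (a b) b) = 0" .
        then have "a b0 = 0" using ext_vs.independentD[OF B(2) finB order_refl _ b0(1)] by blast
        then show False using a[OF b0(1)] c1 by simp
      qed
    qed
    then show "\<And>c. (\<And>\<tau>. \<tau> \<in> gal_set E \<Longrightarrow> (\<Sum>b\<in>B. c b * \<tau> b) = 0) \<Longrightarrow> \<forall>b\<in>B. c b = 0" by blast
  qed
  ultimately show ?thesis using B(4) by (simp add: ext_degree_def)
qed

end

text \<open>The fixed points of \<sigma> form an intermediate field, so they contain k(r) as soon as
  they contain r.\<close>

lemma adjoin_fixed:
  assumes "gal_elem \<sigma>" "\<sigma> r = r" "x \<in> adjoin r" shows "\<sigma> x = x"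
proof -
  interpret gal_elem \<sigma> by fact
  have "intermediate_field {x. \<sigma> x = x}" by (auto simp: intermediate_field_def base_fixed)
  then have "adjoin r \<subseteq> {x. \<sigma> x = x}" using assms(2) unfolding adjoin_def by blast
  then show ?thesis using assms(3) by blast
qed

section \<open>Isometries of the conic and maps of models\<close>

definition mscale :: "'a::comm_ring_1 \<Rightarrow> 'a ^ 3 ^ 3 \<Rightarrow> 'a ^ 3 ^ 3" where
  "mscale c N = (\<chi> i j. c * N $ i $ j)"

lemma mscale_vector: "mscale c N *v p = c *s (N *v p)"
  by (simp add: mscale_def matrix_vector_mult_def vec_eq_iff sum_distrib_left mult.assoc)

lemma det_mscale: "det (mscale c N) = c ^ 3 * det N"
  by (simp add: mscale_def det_3 power3_eq_cube algebra_simps)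

lemma vec3_eq_iff: "p = q \<longleftrightarrow> p $ 1 = q $ 1 \<and> p $ 2 = q $ 2 \<and> p $ 3 = q $ 3" for p :: "'a ^ 3"
  by (simp add: vec_eq_iff forall_3)

lemma matrix_vector_3: "(N *v p) $ i = N $ i $ 1 * p $ 1 + N $ i $ 2 * p $ 2 + N $ i $ 3 * p $ 3"
  for N :: "'a::comm_ring_1 ^ 3 ^ 3"
  by (simp add: matrix_vector_mult_def sum_3)

locale conic =
  fixes a b :: "'a::alg_closed_field"
  assumes two: "(2::'a) \<noteq> 0" and a_nz: "a \<noteq> 0" and b_nz: "b \<noteq> 0"
begin

abbreviation "q p \<equiv> eval3 (conicQ a b) p"

lemma q_scale: "q (c *s p) = c\<^sup>2 * q p"
  by (rule eval3_scale[OF homogeneous3_conicQ])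

text \<open>The quadratic form q(N p) has six coefficients and vanishes on the conic. The five
  points (\<alpha>, 0, 1), (\<alpha>, 0, -1), (0, \<beta>, 1), (0, \<beta>, -1) and (\<alpha>, i
  \<beta>, 0) leave only the multiples of q.\<close>

lemma preserves_conic_imp_similitude:
  assumes N: "\<And>p. q p = 0 \<Longrightarrow> q (N *v p) = 0"
  shows "\<exists>c. \<forall>p. q (N *v p) = c * q p"
proof -
  let ?B = "\<lambda>i j. N $ 3 $ i * N $ 3 $ j - a * (N $ 1 $ i * N $ 1 $ j) - b * (N $ 2 $ i * N $ 2 $ j)"
  define A B C D E F where "A = ?B 1 1" and "B = ?B 2 2" and "C = ?B 3 3"
    and "D = 2 * ?B 1 2" and "E = 2 * ?B 1 3" and "F = 2 * ?B 2 3"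
  have form: "q (N *v p) = A * (p $ 1)\<^sup>2 + B * (p $ 2)\<^sup>2 + C * (p $ 3)\<^sup>2
      + D * (p $ 1 * p $ 2) + E * (p $ 1 * p $ 3) + F * (p $ 2 * p $ 3)" for p
    unfolding eval3_conicQ matrix_vector_3 A_def B_def C_def D_def E_def F_def
    by (simp add: power2_eq_square algebra_simps)
  obtain \<alpha> \<beta> i where roots: "\<alpha>\<^sup>2 = 1 / a" "\<beta>\<^sup>2 = 1 / b" "i\<^sup>2 = (- 1 :: 'a)"
    using alg_closed_sqrt by metis
  have nz: "\<alpha> \<noteq> 0" "\<beta> \<noteq> 0" "i \<noteq> 0" using roots a_nz b_nz by auto
  have at: "A * x\<^sup>2 + B * y\<^sup>2 + C * z\<^sup>2 + D * (x * y) + E * (x * z) + F * (y * z) = 0"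
    if "z\<^sup>2 = a * x\<^sup>2 + b * y\<^sup>2" for x y z
  proof -
    have "q (vector [x, y, z]) = 0" using that by simp
    from N[OF this] show ?thesis unfolding form by simp
  qed
  have twice: "u = 0" if "x + u = 0" "x - u = 0" for x u :: 'a
  proof -
    have "(x + u) - (x - u) = 2 * u" by simp
    then show ?thesis using that two by simp
  qed
  \<comment> \<open>The fact \<open>at\<close> takes its arguments in the order z, x, y.\<close>
  have "A / a + C + E * \<alpha> = 0" "A / a + C - E * \<alpha> = 0"
    using at[of 1 \<alpha> 0] at[of "- 1" \<alpha> 0] roots a_nz by simp_all
  then have E: "E * \<alpha> = 0" and A: "A / a + C = 0" using twice[of "A / a + C" "E * \<alpha>"] by simp_all
  have "B / b + C + F * \<beta> = 0" "B / b + C - F * \<beta> = 0"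
    using at[of 1 0 \<beta>] at[of "- 1" 0 \<beta>] roots b_nz by simp_all
  then have F: "F * \<beta> = 0" and B: "B / b + C = 0" using twice[of "B / b + C" "F * \<beta>"] by simp_all
  have "A / a - B / b + D * (\<alpha> * (i * \<beta>)) = 0"
    using at[of 0 \<alpha> "i * \<beta>"] roots a_nz b_nz by (simp add: power_mult_distrib)
  moreover have "A / a - B / b = (A / a + C) - (B / b + C)" by simp
  ultimately have "D * (\<alpha> * (i * \<beta>)) = 0" using A B by simp
  then have "D = 0" "E = 0" "F = 0" using E F nz by simp_all
  moreover have "A = - a * C" "B = - b * C" using A B a_nz b_nz
    by (simp_all add: field_simps eq_neg_iff_add_eq_0)
  ultimately have "q (N *v p) = C * q p" for p unfolding form by (simp add: algebra_simps)
  then show ?thesis by blast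
qed

text \<open>Polarisation, possible as 2 is nonzero, makes N an isometry of the bilinear form with
  diagonal Gram matrix D; taking determinants in N^T D N = D gives the claim.\<close>

lemma isometry_det:
  assumes N: "\<And>p. q (N *v p) = q p"
  shows "(det N)\<^sup>2 = 1"
proof -
  define d :: "'a ^ 3" where "d = vector [- a, - b, 1]"
  define B where "B p r = (\<Sum>k\<in>UNIV. d $ k * (p $ k * r $ k))" for p r
  have qB: "q p = B p p" for p by (simp add: B_def sum_3 d_def power2_eq_square)
  have "2 * B p r = B (p + r) (p + r) - B p p - B r r" for p r
    by (simp add: B_def sum_3 algebra_simps)
  then have pol: "2 * B p r = q (p + r) - q p - q r" for p r by (simp only: qB)
  have "2 * B (N *v p) (N *v r) = 2 * B p r" for p r
    unfolding pol by (simp only: N matrix_vector_right_distrib[symmetric])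
  then have BN: "B (N *v p) (N *v r) = B p r" for p r using two by simp
  define D :: "'a ^ 3 ^ 3" where "D = (\<chi> i j. if i = j then d $ i else 0)"
  have "(transpose N ** (D ** N)) $ i $ j = D $ i $ j" for i j
  proof -
    have "(D ** N) $ k $ j = d $ k * N $ k $ j" for k
      by (simp add: matrix_matrix_mult_def D_def if_distrib[of "\<lambda>x. x * _"] cong: if_cong)
    moreover have Nx: "(N *v axis j 1) $ k = N $ k $ j" for j k
      by (simp add: matrix_vector_mult_def axis_def if_distrib[of "\<lambda>x. _ * x"] cong: if_cong)
    ultimately have "(transpose N ** (D ** N)) $ i $ j = B (N *v axis i 1) (N *v axis j 1)"
      by (simp add: matrix_matrix_mult_def transpose_def B_def Nx mult.left_commute[of "d $ _"])
    also have "\<dots> = B (axis i 1) (axis j 1)" by (rule BN)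
    also have "\<dots> = D $ i $ j"
      by (auto simp: B_def D_def axis_def if_distrib[of "\<lambda>x. _ * x"] cong: if_cong)
    finally show ?thesis .
  qed
  then have "transpose N ** (D ** N) = D" by (simp add: vec_eq_iff)
  then have "det N * (det D * det N) = det D" by (metis det_mul det_transpose)
  moreover have "det D \<noteq> 0" using a_nz b_nz by (simp add: det_3 D_def d_def)
  ultimately show ?thesis by (simp add: power2_eq_square algebra_simps)
qed

text \<open>If q(N p) = c q(p), scaling N by a square root of 1/c gives an isometry, of determinant
  1 or -1. In odd dimension the other square root changes the sign of the determinant.\<close>

lemma exists_isometry:
  assumes N: "\<And>p. q p = 0 \<Longrightarrow> q (N *v p) = 0" and inv: "invertible N"
  shows "\<exists>\<mu>. \<mu> \<noteq> 0 \<and> det (mscale \<mu> N) = 1 \<and> (\<forall>p. q (mscale \<mu> N *v p) = q p)"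
proof -
  obtain c where c: "\<And>p. q (N *v p) = c * q p" using preserves_conic_imp_similitude[OF N] by blast
  obtain N' where "N ** N' = mat 1" using inv invertible_def by blast
  \<comment> \<open>The vector (0, 0, 1), where q is 1, lies in the image of N, so c is
    nonzero.\<close>
  then have "c * q (N' *v vector [0, 0, 1]) = q (vector [0, 0, 1])"
    by (simp only: c[symmetric] matrix_vector_mul_assoc matrix_vector_mul_lid)
  then have c0: "c \<noteq> 0" by auto
  obtain \<mu> where \<mu>: "\<mu>\<^sup>2 = 1 / c" using alg_closed_sqrt by blast
  have iso: "q (mscale \<nu> N *v p) = q p" if "\<nu>\<^sup>2 = 1 / c" for \<nu> p
    using that c0 by (simp only: mscale_vector q_scale c) simp
  have "(det (mscale \<mu> N))\<^sup>2 = 1" using iso[OF \<mu>] by (rule isometry_det)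
  then have "det (mscale \<mu> N) = 1 \<or> det (mscale \<mu> N) = - 1" by (simp add: power2_eq_1_iff)
  moreover have "det (mscale (- \<mu>) N) = - det (mscale \<mu> N)" by (simp add: det_mscale)
  ultimately have "det (mscale \<mu> N) = 1 \<or> det (mscale (- \<mu>) N) = 1" by auto
  moreover have "\<mu> \<noteq> 0" using \<mu> c0 by auto
  ultimately show ?thesis using iso \<mu> by (metis neg_equal_0_iff_equal power2_minus)
qed

text \<open>Four points of the conic form a projective frame. The relation p1 - p2 - p3 + p4 = 0 and
  its image under N1 force the four factors to agree, so N1 = c N2; then c^3 = 1 by the determinants
  and c^2 = 1 by the isometry property.\<close>

lemma isometry_unique:
  assumes N1: "\<And>p. q (N1 *v p) = q p" "det N1 = 1" and N2: "\<And>p. q (N2 *v p) = q p" "det N2 = 1"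
    and proportional: "\<And>p. p \<noteq> 0 \<Longrightarrow> q p = 0 \<Longrightarrow> \<exists>c. N1 *v p = c *s (N2 *v p)"
  shows "N1 = N2"
proof -
  obtain \<alpha> \<beta> where roots: "\<alpha>\<^sup>2 = 1 / a" "\<beta>\<^sup>2 = 1 / b"
    using alg_closed_sqrt by metis
  have nz: "\<alpha> \<noteq> 0" "\<beta> \<noteq> 0" using roots a_nz b_nz by auto
  let ?p1 = "vector [\<alpha>, 0, 1] :: 'a ^ 3" and ?p2 = "vector [\<alpha>, 0, - 1] :: 'a ^ 3"
    and ?p3 = "vector [0, \<beta>, 1] :: 'a ^ 3" and ?p4 = "vector [0, \<beta>, - 1] :: 'a ^ 3"
  have "?p1 \<noteq> 0" "?p2 \<noteq> 0" "?p3 \<noteq> 0" "?p4 \<noteq> 0" by (simp_all add: vec3_eq_iff)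
  moreover have "q ?p1 = 0" "q ?p2 = 0" "q ?p3 = 0" "q ?p4 = 0"
    using roots a_nz b_nz by simp_all
  ultimately obtain c1 c2 c3 c4 where c: "N1 *v ?p1 = c1 *s (N2 *v ?p1)" "N1 *v ?p2 = c2 *s (N2 *v ?p2)"
    "N1 *v ?p3 = c3 *s (N2 *v ?p3)" "N1 *v ?p4 = c4 *s (N2 *v ?p4)" using proportional by metis
  have "?p1 - ?p2 - ?p3 + ?p4 = 0" by (simp add: vec3_eq_iff)
  then have "N1 *v (?p1 - ?p2 - ?p3 + ?p4) = 0" by simp
  then have "N1 *v ?p1 - N1 *v ?p2 - N1 *v ?p3 + N1 *v ?p4 = 0"
    by (simp only: matrix_vector_mult_diff_distrib matrix_vector_right_distrib)
  then have "N2 *v (c1 *s ?p1 - c2 *s ?p2 - c3 *s ?p3 + c4 *s ?p4) = 0"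
    unfolding c by (simp only: matrix_vector_mult_diff_distrib matrix_vector_right_distrib vector_scalar_commute)
  moreover have "invertible N2" using N2 by (simp add: invertible_det_nz)
  ultimately have "c1 *s ?p1 - c2 *s ?p2 - c3 *s ?p3 + c4 *s ?p4 = 0"
    using matrix_left_invertible_ker[of N2] by (auto simp: invertible_left_inverse)
  then have "c1 * \<alpha> - c2 * \<alpha> = 0" "c4 * \<beta> - c3 * \<beta> = 0" "c1 + c2 - c3 - c4 = 0"
    by (simp_all add: vec3_eq_iff)
  then have c12: "c1 = c2" "c4 = c3" "2 * (c1 - c3) = 0" using nz by (simp_all add: algebra_simps)
  then have c13: "c3 = c1" using two by simp
  define R where "R = N1 - mscale c1 N2"
  have Rv: "R *v p = N1 *v p - c1 *s (N2 *v p)" for p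
    by (simp add: R_def matrix_vector_mult_diff_rdistrib mscale_vector)
  have "R *v ?p1 = 0" "R *v ?p2 = 0" "R *v ?p3 = 0" using c c12 c13 by (simp_all add: Rv)
  then have R: "R $ i $ 1 * \<alpha> + R $ i $ 3 = 0" "R $ i $ 1 * \<alpha> - R $ i $ 3 = 0" "R $ i $ 2 * \<beta> + R $ i $ 3 = 0" for i
    using matrix_vector_3[of R ?p1 i] matrix_vector_3[of R ?p2 i] matrix_vector_3[of R ?p3 i] by simp_all
  have "R $ i $ 3 = 0" for i
  proof -
    have "(R $ i $ 1 * \<alpha> + R $ i $ 3) - (R $ i $ 1 * \<alpha> - R $ i $ 3) = 2 * R $ i $ 3" by simp
    then show ?thesis using R two by simp
  qed
  then have "R = 0" using R nz by (simp add: vec_eq_iff forall_3)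
  then have eq: "N1 = mscale c1 N2" by (simp add: R_def)
  have "c1 ^ 3 = 1" using N1(2) N2(2) by (simp add: eq det_mscale)
  moreover have "c1\<^sup>2 = 1"
    using N1(1)[of "vector [0, 0, 1]"] N2(1)[of "vector [0, 0, 1]"] unfolding eq mscale_vector q_scale by simp
  ultimately have "c1 = 1" by (simp add: power3_eq_cube power2_eq_square)
  then show ?thesis by (simp add: eq mscale_def vec_eq_iff)
qed

end

section \<open>Points of weighted projective space and of the models\<close>

lemma mem_wpt: "(p, t) \<in> wpt n p t"
  unfolding wpt_def by (rule CollectI, rule exI[of _ 1]) simp

lemma wpt_scale: assumes "c \<noteq> 0" shows "wpt n (c *s p) (c ^ n * t) = wpt n p t"
proof
  show "wpt n (c *s p) (c ^ n * t) \<subseteq> wpt n p t"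
  proof
    fix x assume "x \<in> wpt n (c *s p) (c ^ n * t)"
    then obtain e where "e \<noteq> 0" "x = (e *s (c *s p), e ^ n * (c ^ n * t))" by (auto simp: wpt_def)
    then show "x \<in> wpt n p t" using assms unfolding wpt_def
      by (intro CollectI exI[of _ "e * c"]) (simp add: power_mult_distrib)
  qed
  show "wpt n p t \<subseteq> wpt n (c *s p) (c ^ n * t)"
  proof
    fix x assume "x \<in> wpt n p t"
    then obtain e where "e \<noteq> 0" "x = (e *s p, e ^ n * t)" by (auto simp: wpt_def)
    then show "x \<in> wpt n (c *s p) (c ^ n * t)" using assms unfolding wpt_def
      by (intro CollectI exI[of _ "e / c"]) (simp add: power_divide)
  qed
qed

lemma wpt_eq_iff: "wpt n p t = wpt n r s \<longleftrightarrow> (\<exists>c. c \<noteq> 0 \<and> r = c *s p \<and> s = c ^ n * t)"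
proof
  assume "wpt n p t = wpt n r s"
  then have "(r, s) \<in> wpt n p t" using mem_wpt by blast
  then show "\<exists>c. c \<noteq> 0 \<and> r = c *s p \<and> s = c ^ n * t" by (auto simp: wpt_def)
qed (auto simp: wpt_scale)

lemma wlin_wpt: "wlin N l (wpt n p t) = wpt n (N *v p) (l * t)"
  unfolding wlin_def wpt_def by (force simp: vector_scalar_commute)

lemma (in gal_elem) gal_point_wpt: "gal_point \<sigma> (wpt n p t) = wpt n (gal_vec \<sigma> p) (\<sigma> t)"
proof -
  have gv: "gal_vec \<sigma> (c *s p) = \<sigma> c *s gal_vec \<sigma> p" for c by (simp add: gal_vec_def vec_eq_iff)
  have "gal_point \<sigma> (wpt n p t) = {(\<sigma> c *s gal_vec \<sigma> p, \<sigma> c ^ n * \<sigma> t) |c. c \<noteq> 0}"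
    unfolding gal_point_def wpt_def by (force simp: gv)
  also have "\<dots> = wpt n (gal_vec \<sigma> p) (\<sigma> t)"
    unfolding wpt_def
  proof (rule Set.set_eqI, rule iffI)
    fix x assume "x \<in> {(c *s gal_vec \<sigma> p, c ^ n * \<sigma> t) |c. c \<noteq> 0}"
    then obtain c where "c \<noteq> 0" "x = (c *s gal_vec \<sigma> p, c ^ n * \<sigma> t)" by blast
    then show "x \<in> {(\<sigma> c *s gal_vec \<sigma> p, \<sigma> c ^ n * \<sigma> t) |c. c \<noteq> 0}"
      by (intro CollectI exI[of _ "inv_into UNIV \<sigma> c"]) (metis eq_0_iff inv_apply(2))
  next
    fix x assume "x \<in> {(\<sigma> c *s gal_vec \<sigma> p, \<sigma> c ^ n * \<sigma> t) |c. c \<noteq> 0}"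
    then show "x \<in> {(c *s gal_vec \<sigma> p, c ^ n * \<sigma> t) |c. c \<noteq> 0}" using eq_0_iff by blast
  qed
  finally show ?thesis .
qed

lemma weval_pCons: "weval (pCons A P) p t = eval3 A p + t * weval P p t"
  by (simp add: weval_def map_poly_pCons)

lemma weval_0 [simp]: "weval 0 p t = 0"
  by (simp add: weval_def)

lemma mem_modelE:
  assumes "x \<in> model n e F R"
  obtains p t where "x = wpt n p t" "p \<noteq> 0 \<or> t \<noteq> 0" "eval3 R p = 0" "e * t\<^sup>2 = eval3 F p"
  using assms by (auto simp: model_def wlocus_def model_eqs_def weval_pCons power2_eq_square algebra_simps)

lemma wpt_in_modelI:
  assumes "p \<noteq> 0 \<or> t \<noteq> 0" "eval3 R p = 0" "e * t\<^sup>2 = eval3 F p"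
  shows "wpt n p t \<in> model n e F R"
  unfolding model_def wlocus_def using assms
  by (intro CollectI exI[of _ p] exI[of _ t]) (simp add: model_eqs_def weval_pCons power2_eq_square algebra_simps)

text \<open>By definition some representative satisfies the equations; homogeneity, with t of weight
  n, carries them over to every representative.\<close>

lemma wpt_in_model_iff:
  assumes "homogeneous3 2 R" "homogeneous3 (2 * n) F"
  shows "wpt n p t \<in> model n e F R \<longleftrightarrow> (p \<noteq> 0 \<or> t \<noteq> 0) \<and> eval3 R p = 0 \<and> e * t\<^sup>2 = eval3 F p"
proof
  assume "wpt n p t \<in> model n e F R"
  then obtain p' t' where *: "wpt n p t = wpt n p' t'" "p' \<noteq> 0 \<or> t' \<noteq> 0" "eval3 R p' = 0" "e * t'\<^sup>2 = eval3 F p'"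
    by (rule mem_modelE)
  then obtain c where c: "c \<noteq> 0" "p' = c *s p" "t' = c ^ n * t" by (auto simp: wpt_eq_iff)
  have "c ^ (2 * n) * (e * t\<^sup>2) = c ^ (2 * n) * eval3 F p"
    using *(4) unfolding c(2,3) eval3_scale[OF assms(2)] by (simp add: power_mult_distrib power_mult[symmetric] mult.commute mult.left_commute)
  then show "(p \<noteq> 0 \<or> t \<noteq> 0) \<and> eval3 R p = 0 \<and> e * t\<^sup>2 = eval3 F p"
    using c(1) *(2,3) unfolding c(2,3) eval3_scale[OF assms(1)] by auto
qed (blast intro: wpt_in_modelI)

section \<open>Linear maps between models\<close>

lemma invertible_mult_eq_0:
  fixes N :: "'a::field ^ 3 ^ 3"
  assumes "invertible N" shows "N *v p = 0 \<longleftrightarrow> p = 0"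
  using matrix_left_invertible_ker[of N] assms by (auto simp: invertible_left_inverse)

lemma regular_map_wlin:
  fixes N :: "'a::field ^ 3 ^ 3"
  assumes N: "invertible N" "l \<noteq> 0" and Z: "\<And>x. x \<in> Z \<Longrightarrow> \<exists>p t. x = wpt n p t \<and> (p \<noteq> 0 \<or> t \<noteq> 0)"
  shows "regular_map n Z (restrict (wlin N l) Z)"
  unfolding regular_map_def
proof
  fix x assume x: "x \<in> Z"
  define P where "P j = [: \<Sum>i\<in>UNIV. const3 (N $ j $ i) * var3 i :]" for j
  define T where "T = [: 0, const3 l :]"
  have P: "(\<chi> j. weval (P j) p t) = N *v p" for p t
    by (simp add: P_def weval_pCons matrix_vector_mult_def)
  have T: "weval T p t = l * t" for p t by (simp add: T_def weval_pCons)
  have "whomogeneous n 1 (P j)" for j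
    using homogeneous3_linear[of "\<lambda>i. N $ j $ i" UNIV]
    by (auto simp: whomogeneous_def P_def coeff_pCons homogeneous3_def split: nat.split)
  moreover have "whomogeneous n (1 * n) T"
    using homogeneous3_const[of l]
    by (auto simp: whomogeneous_def T_def coeff_pCons homogeneous3_def split: nat.split)
  moreover have "\<exists>p t. x = wpt n p t \<and> (N *v p \<noteq> 0 \<or> l * t \<noteq> 0)"
    using Z[OF x] N by (auto simp: invertible_mult_eq_0)
  ultimately show "\<exists>m P T. (\<forall>j. whomogeneous n m (P j)) \<and> whomogeneous n (m * n) T \<and>
      (\<exists>p t. x = wpt n p t \<and> ((\<chi> j. weval (P j) p t) \<noteq> 0 \<or> weval T p t \<noteq> 0)) \<and>
      (\<forall>p t. wpt n p t \<in> Z \<and> ((\<chi> j. weval (P j) p t) \<noteq> 0 \<or> weval T p t \<noteq> 0) \<longrightarrow>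
        restrict (wlin N l) Z (wpt n p t) = wpt n (\<chi> j. weval (P j) p t) (weval T p t))"
    by (intro exI[of _ 1] exI[of _ P] exI[of _ T]) (simp add: P T wlin_wpt)
qed

text \<open>Covers the automorphisms of C, the maps \<open>\<psi>0\<close> and
  \<open>\<phi>\<close>, and their conjugates. In these cases the equations for t are known to
  correspond only at points of the conic.\<close>

locale linear_model_iso =
  fixes n :: nat and e e' l :: "'a::field" and F R F' R' :: "'a mpoly3" and M :: "'a ^ 3 ^ 3"
  assumes M: "invertible M" and l: "l \<noteq> 0"
    and R: "\<And>p. eval3 R' (M *v p) = 0 \<longleftrightarrow> eval3 R p = 0"
    and F: "\<And>p t. eval3 R p = 0 \<Longrightarrow> e' * (l * t)\<^sup>2 = eval3 F' (M *v p) \<longleftrightarrow> e * t\<^sup>2 = eval3 F p"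
begin

abbreviation "Z \<equiv> model n e F R"
abbreviation "Y \<equiv> model n e' F' R'"

lemma inverse_cancel: "matrix_inv M *v (M *v p) = p" "M *v (matrix_inv M *v p) = p"
  using matrix_inv_inverse[OF M] by (simp_all add: matrix_vector_mul_assoc)

lemma invertible_matrix_inv: "invertible (matrix_inv M)"
  using matrix_inv_inverse[OF M] invertible_def by blast

lemma wlin_mem: "x \<in> Z \<Longrightarrow> wlin M l x \<in> Y"
  by (erule mem_modelE) (auto simp: wlin_wpt R F M l invertible_mult_eq_0 intro!: wpt_in_modelI)

lemma wlin_inverse_mem: "x \<in> Y \<Longrightarrow> wlin (matrix_inv M) (1 / l) x \<in> Z"
proof (erule mem_modelE)
  fix p t assume x: "x = wpt n p t" "p \<noteq> 0 \<or> t \<noteq> 0" "eval3 R' p = 0" "e' * t\<^sup>2 = eval3 F' p"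
  show "wlin (matrix_inv M) (1 / l) x \<in> Z"
    unfolding x(1) wlin_wpt
  proof (rule wpt_in_modelI)
    show "matrix_inv M *v p \<noteq> 0 \<or> 1 / l * t \<noteq> 0"
      using x(2) l invertible_matrix_inv by (auto simp: invertible_mult_eq_0)
    show R0: "eval3 R (matrix_inv M *v p) = 0" using R[of "matrix_inv M *v p"] x(3) by (simp add: inverse_cancel)
    show "e * (1 / l * t)\<^sup>2 = eval3 F (matrix_inv M *v p)"
      using F[OF R0, of "1 / l * t"] x(4) l by (simp add: inverse_cancel)
  qed
qed

lemma wlin_cancel:
  "x \<in> Z \<Longrightarrow> wlin (matrix_inv M) (1 / l) (wlin M l x) = x"
  "x \<in> Y \<Longrightarrow> wlin M l (wlin (matrix_inv M) (1 / l) x) = x"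
  by (erule mem_modelE, simp add: wlin_wpt inverse_cancel l)+

lemma bij: "bij_betw (restrict (wlin M l) Z) Z Y"
  by (rule bij_betw_byWitness[of _ "restrict (wlin (matrix_inv M) (1 / l)) Y"])
    (auto simp: wlin_mem wlin_inverse_mem wlin_cancel)

lemma map_inv_wlin: "map_inv Z Y (restrict (wlin M l) Z) = restrict (wlin (matrix_inv M) (1 / l)) Y"
  unfolding map_inv_def
proof (rule restrict_ext)
  fix y assume y: "y \<in> Y"
  have "restrict (wlin M l) Z (wlin (matrix_inv M) (1 / l) y) = y"
    using y by (simp add: wlin_inverse_mem wlin_cancel)
  then show "inv_into Z (restrict (wlin M l) Z) y = wlin (matrix_inv M) (1 / l) y"
    using bij wlin_inverse_mem[OF y] by (intro inv_into_f_eq) (auto simp: bij_betw_def)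
qed

lemma curve_iso: "curve_iso n Z Y (restrict (wlin M l) Z)"
proof -
  have "regular_map n Z (restrict (wlin M l) Z)"
    by (rule regular_map_wlin[OF M l]) (erule mem_modelE, blast)
  moreover have "regular_map n Y (restrict (wlin (matrix_inv M) (1 / l)) Y)"
    by (rule regular_map_wlin[OF invertible_matrix_inv]) (simp add: l, erule mem_modelE, blast)
  ultimately show ?thesis unfolding curve_iso_def map_inv_wlin by (intro conjI bij) auto
qed

end

section \<open>Galois conjugation of polynomials, points and maps\<close>

context gal_elem
begin

lemma lookup_gal_poly [simp]: "Poly_Mapping.lookup (gal_poly \<sigma> P) m = \<sigma> (Poly_Mapping.lookup P m)"
  by (simp add: gal_poly_def lookup_map_0)

lemma eval3_gal_poly: "eval3 (gal_poly \<sigma> P) (gal_vec \<sigma> p) = \<sigma> (eval3 P p)"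
proof -
  have "Poly_Mapping.keys (gal_poly \<sigma> P) \<subseteq> Poly_Mapping.keys P" by (auto simp: in_keys_iff)
  then show ?thesis
    by (simp add: eval3_superset[of "Poly_Mapping.keys P"] gal_vec_def)
qed

lemma gal_poly_fixed: "poly_over_k P \<Longrightarrow> gal_poly \<sigma> P = P"
  by (intro poly_mapping_eqI) (simp add: base_fixed poly_over_k_def)

lemma eval3_gal_fixed: "poly_over_k P \<Longrightarrow> eval3 P (gal_vec \<sigma> p) = \<sigma> (eval3 P p)"
  using eval3_gal_poly[of P p] by (simp add: gal_poly_fixed)

lemma gal_vec_eq_0 [simp]: "gal_vec \<sigma> p = 0 \<longleftrightarrow> p = 0"
  by (simp add: gal_vec_def vec_eq_iff)

lemma gal_point_mem_model:
  assumes "poly_over_k F" "poly_over_k R" "x \<in> model n (to_ac e) F R"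
  shows "gal_point \<sigma> x \<in> model n (to_ac e) F R"
proof -
  obtain p t where x: "x = wpt n p t" "p \<noteq> 0 \<or> t \<noteq> 0" "eval3 R p = 0" "to_ac e * t\<^sup>2 = eval3 F p"
    using assms(3) by (rule mem_modelE)
  have "to_ac e * (\<sigma> t)\<^sup>2 = \<sigma> (to_ac e * t\<^sup>2)" by simp
  then show ?thesis unfolding x(1) gal_point_wpt
    using x assms(1,2) by (intro wpt_in_modelI) (auto simp: eval3_gal_fixed)
qed

lemma gal_vec_inv [simp]: "gal_vec \<sigma> (gal_vec (inv_into UNIV \<sigma>) p) = p"
  by (simp add: gal_vec_def vec_eq_iff)

text \<open>Since the equations are over k, the inverse of \<sigma> maps Z into itself, so the
  restricted map is evaluated inside its domain.\<close>

lemma gal_map_wlin: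
  assumes "poly_over_k F" "poly_over_k R" and Z: "Z = model n (to_ac e) F R"
  shows "gal_map \<sigma> Z (restrict (wlin M l) Z) = restrict (wlin (gal_mat \<sigma> M) (\<sigma> l)) Z"
  unfolding gal_map_def
proof (rule restrict_ext)
  fix x assume x: "x \<in> Z"
  interpret i: gal_elem "inv_into UNIV \<sigma>" using inv_mem by unfold_locales
  have mem: "gal_point (inv_into UNIV \<sigma>) x \<in> Z" using i.gal_point_mem_model assms x by blast
  obtain p t where "x = wpt n p t" using x unfolding Z by (rule mem_modelE)
  then show "gal_point \<sigma> (restrict (wlin M l) Z (gal_point (inv_into UNIV \<sigma>) x)) = wlin (gal_mat \<sigma> M) (\<sigma> l) x"
    using mem by (simp add: i.gal_point_wpt wlin_wpt gal_point_wpt gal_vec_mult)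
qed

end

lemma poly_over_kI:
  assumes "perfect_field TYPE('k::field)" "\<And>\<sigma>. gal_elem \<sigma> \<Longrightarrow> gal_poly \<sigma> P = P"
  shows "poly_over_k (P :: 'k alg_closure mpoly3)"
  unfolding poly_over_k_def
proof
  fix m
  show "Poly_Mapping.lookup P m \<in> base_field"
  proof (rule gal_fixed_in_base[OF assms(1)])
    fix \<sigma> :: "'k alg_closure \<Rightarrow> _" assume "\<sigma> \<in> gal_set UNIV"
    then interpret gal_elem \<sigma> by unfold_locales
    show "\<sigma> (Poly_Mapping.lookup P m) = Poly_Mapping.lookup P m"
      using assms(2)[OF gal_elem_axioms] lookup_gal_poly[of P m] by simp
  qed
qed

section \<open>The twist\<close>

lemma (in gal_elem) eval3_gal_poly_at: "eval3 (gal_poly \<sigma> P) p = \<sigma> (eval3 P (gal_vec (inv_into UNIV \<sigma>) p))"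
  using eval3_gal_poly[of P "gal_vec (inv_into UNIV \<sigma>) p"] by simp

lemma gal_elem_iff: "\<sigma> \<in> gal_set UNIV \<longleftrightarrow> gal_elem \<sigma>"
  by (simp add: gal_elem_def)

lemma carrier_abs_gal: "carrier abs_gal = gal_set UNIV"
  and mult_abs_gal: "\<sigma> \<otimes>\<^bsub>abs_gal\<^esub> \<tau> = \<sigma> \<circ> \<tau>"
  by (simp_all add: abs_gal_def)

text \<open>\<open>F_nz\<close> will follow from primality of the ideal of the model; it makes the
  factor on t unique. The weight n of t is d / 2, so F has degree 2 n.\<close>

locale hyperelliptic_twist =
  fixes a b :: "'k::field" and F :: "'k alg_closure mpoly3" and n :: nat
    and L :: "'k alg_closure set"
    and \<xi> :: "('k alg_closure \<Rightarrow> 'k alg_closure) \<Rightarrow> 'k alg_closure wpoint \<Rightarrow> 'k alg_closure wpoint"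
    and Q C
  assumes perfect: "perfect_field TYPE('k)" and two_nz: "(2::'k) \<noteq> 0"
    and ab: "a \<noteq> 0" "b \<noteq> 0"
    and F_over_k: "poly_over_k F" and F_hom: "homogeneous3 (2 * n) F" and n_pos: "n > 0"
    and Q_def: "Q = conicQ (to_ac a) (to_ac b)" and C_def: "C = model n 1 F Q"
    and F_nz: "\<exists>p. eval3 Q p = 0 \<and> eval3 F p \<noteq> 0"
    and cocycle: "cocycle n C \<xi>"
    and L: "finite_galois L" "\<exists>\<xi>'. \<forall>\<sigma>\<in>carrier abs_gal. \<xi> \<sigma> = \<xi>' (restrict \<sigma> L)"
    and linear: "\<forall>\<sigma>\<in>carrier abs_gal. \<exists>N l. invertible N \<and> l \<noteq> 0 \<and> \<xi> \<sigma> = restrict (wlin N l) C"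
begin

sublocale conic "to_ac a" "to_ac b"
  by unfold_locales (use two_nz ab to_ac_eq_0_iff[of 2] in auto)

lemma Q_hom: "homogeneous3 2 Q" by (simp add: Q_def homogeneous3_conicQ)

lemma Q_over_k: "poly_over_k Q"
proof (rule poly_over_kI[OF perfect])
  fix \<sigma> :: "'k alg_closure \<Rightarrow> 'k alg_closure" assume "gal_elem \<sigma>"
  then interpret gal_elem \<sigma> .
  show "gal_poly \<sigma> Q = Q"
    by (rule mpoly3_eqI) (simp add: Q_def eval3_gal_poly_at gal_vec_def)
qed

lemma C_def': "C = model n (to_ac 1) F Q" by (simp add: C_def)

lemma F_0: "eval3 F 0 = 0"
  using eval3_scale[OF F_hom, of 0 0] n_pos by (simp add: power_0_left)

lemma mem_C_iff: "wpt n p t \<in> C \<longleftrightarrow> (p \<noteq> 0 \<or> t \<noteq> 0) \<and> eval3 Q p = 0 \<and> t\<^sup>2 = eval3 F p"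
  unfolding C_def using wpt_in_model_iff[OF Q_hom F_hom, of p t 1] by simp

lemma C_point: assumes "p \<noteq> 0" "eval3 Q p = 0" obtains t where "t\<^sup>2 = eval3 F p" "wpt n p t \<in> C"
  using alg_closed_sqrt[of "eval3 F p"] assms by (auto simp: mem_C_iff)

text \<open>The point [0:0:0:1] is excluded, as F(0) = 0 would force t = 0.\<close>

lemma C_cases: assumes "x \<in> C" obtains p t where "x = wpt n p t" "p \<noteq> 0" "eval3 Q p = 0" "t\<^sup>2 = eval3 F p"
proof -
  obtain p t where x: "x = wpt n p t" "p \<noteq> 0 \<or> t \<noteq> 0" "eval3 Q p = 0" "1 * t\<^sup>2 = eval3 F p"
    using assms unfolding C_def by (rule mem_modelE)
  then have "p \<noteq> 0" using F_0 by auto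
  then show ?thesis using that x by simp
qed

text \<open>The normalised pairs (N, l) that represent automorphisms of C. The relation for F is
  imposed on the conic only, since the curve sees F only modulo Q.\<close>

definition lift_of :: "'k alg_closure ^ 3 ^ 3 \<Rightarrow> 'k alg_closure \<Rightarrow> bool" where
  "lift_of N l \<longleftrightarrow> det N = 1 \<and> (\<forall>p. eval3 Q (N *v p) = eval3 Q p) \<and> l \<noteq> 0 \<and>
     (\<forall>p. eval3 Q p = 0 \<longrightarrow> eval3 F (N *v p) = l\<^sup>2 * eval3 F p)"

lemma lift_of_isometry: "lift_of N l \<Longrightarrow> eval3 (conicQ (to_ac a) (to_ac b)) (N *v p) = eval3 (conicQ (to_ac a) (to_ac b)) p"
  unfolding lift_of_def by (simp only: Q_def)

lemma lift_of_det: "lift_of N l \<Longrightarrow> det N = 1"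
  by (simp add: lift_of_def)

lemma lift_of_invertible: "lift_of N l \<Longrightarrow> invertible N"
  by (simp add: lift_of_def invertible_det_nz)

lemma lift_of_iso: "lift_of N l \<Longrightarrow> linear_model_iso 1 1 l F Q F Q N"
  using lift_of_invertible[of N l] by unfold_locales (auto simp: lift_of_def power_mult_distrib)

lemma lift_of_mem: "lift_of N l \<Longrightarrow> x \<in> C \<Longrightarrow> wlin N l x \<in> C"
  unfolding C_def by (rule linear_model_iso.wlin_mem[OF lift_of_iso])

lemma lift_of_mult: "lift_of N l \<Longrightarrow> lift_of N' l' \<Longrightarrow> lift_of (N ** N') (l * l')"
  by (auto simp: lift_of_def det_mul matrix_vector_mul_assoc[symmetric] power_mult_distrib)

lemma lift_of_1: "\<epsilon>\<^sup>2 = 1 \<Longrightarrow> lift_of (mat 1) \<epsilon>"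
  by (auto simp: lift_of_def)

lemma compose_wlin:
  assumes "\<And>x. x \<in> Z \<Longrightarrow> wlin N' l' x \<in> C" "\<And>x. x \<in> Z \<Longrightarrow> \<exists>p t. x = wpt n p t"
  shows "compose Z (restrict (wlin N l) C) (restrict (wlin N' l') Z) = restrict (wlin (N ** N') (l * l')) Z"
  unfolding compose_def
proof (rule restrict_ext)
  fix x assume x: "x \<in> Z"
  then obtain p t where "x = wpt n p t" using assms(2) by blast
  then show "restrict (wlin N l) C (restrict (wlin N' l') Z x) = wlin (N ** N') (l * l') x"
    using assms(1)[OF x] x by (simp add: wlin_wpt matrix_vector_mul_assoc mult.assoc)
qed

lemma C_wpt: "x \<in> C \<Longrightarrow> \<exists>p t. x = wpt n p t"
  by (erule C_cases) blast

text \<open>The maps agree over the conic, which fixes N by \<open>isometry_unique\<close>. To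
  compare l and l', take a point with F nonzero: there t is nonzero, and equality of the x, y, z
  coordinates makes the scalar between the two representatives 1.\<close>

lemma lift_of_unique:
  assumes N: "lift_of N l" and N': "lift_of N' l'" and eq: "restrict (wlin N l) C = restrict (wlin N' l') C"
  shows "N = N' \<and> l = l'"
proof
  have at: "wpt n (N *v p) (l * t) = wpt n (N' *v p) (l' * t)" if "wpt n p t \<in> C" for p t
    using fun_cong[OF eq, of "wpt n p t"] that by (simp add: wlin_wpt)
  show NN: "N = N'"
  proof (rule isometry_unique)
    fix p :: "'k alg_closure ^ 3" assume p: "p \<noteq> 0" "eval3 (conicQ (to_ac a) (to_ac b)) p = 0"
    then obtain t where "wpt n p t \<in> C" using C_point unfolding Q_def by blast
    from at[OF this] obtain c where c: "c \<noteq> 0" "N' *v p = c *s (N *v p)" by (auto simp: wpt_eq_iff)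
    then have "N *v p = (1 / c) *s (N' *v p)" by (simp add: vec_eq_iff)
    then show "\<exists>c. N *v p = c *s (N' *v p)" by blast
  qed (rule lift_of_isometry[OF N] lift_of_det[OF N] lift_of_isometry[OF N'] lift_of_det[OF N'])+
  obtain p where p: "eval3 Q p = 0" "eval3 F p \<noteq> 0" using F_nz by blast
  then have p0: "p \<noteq> 0" using F_0 by auto
  then obtain t where t: "t\<^sup>2 = eval3 F p" "wpt n p t \<in> C" using C_point p by blast
  from at[OF t(2)] obtain c where c: "N *v p = c *s (N *v p)" "l' * t = c ^ n * (l * t)"
    unfolding NN[symmetric] by (auto simp: wpt_eq_iff)
  have "N *v p \<noteq> 0" using p0 lift_of_invertible[OF N] by (simp add: invertible_mult_eq_0)
  then obtain j where j: "(N *v p) $ j \<noteq> 0" by (auto simp: vec_eq_iff)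
  have "(N *v p) $ j = c * (N *v p) $ j" using arg_cong[OF c(1), of "\<lambda>u. u $ j"] by simp
  then have "c = 1" using j by simp
  then show "l = l'" using c(2) t p(2) by auto
qed

lemma xi_iso: "\<sigma> \<in> gal_set UNIV \<Longrightarrow> curve_iso n C C (\<xi> \<sigma>)"
  using cocycle by (auto simp: cocycle_def carrier_abs_gal aut_group_def Pi_def)

text \<open>In weighted coordinates N may be replaced by \<mu> N if l is replaced by \<mu>^n l;
  \<mu> is chosen by \<open>exists_isometry\<close>. Every point of the conic lies below a point of
  C, so N preserves the conic because the automorphism preserves C.\<close>

lemma xi_lift: assumes \<sigma>: "\<sigma> \<in> gal_set UNIV" shows "\<exists>N l. lift_of N l \<and> \<xi> \<sigma> = restrict (wlin N l) C"
proof -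
  obtain N l where N: "invertible N" "l \<noteq> 0" "\<xi> \<sigma> = restrict (wlin N l) C"
    using linear \<sigma> by (auto simp: carrier_abs_gal)
  have maps: "wlin N l x \<in> C" if "x \<in> C" for x
    using xi_iso[OF \<sigma>] that bij_betwE[of "\<xi> \<sigma>" C C] by (auto simp: curve_iso_def N)
  have *: "eval3 Q (N *v p) = 0 \<and> eval3 F (N *v p) = l\<^sup>2 * eval3 F p" if Qp: "eval3 Q p = 0" for p
  proof (cases "p = 0")
    case True
    then show ?thesis using Qp F_0 by simp
  next
    case False
    then obtain t where t: "t\<^sup>2 = eval3 F p" "wpt n p t \<in> C" using C_point Qp by blast
    have "wpt n (N *v p) (l * t) \<in> C" using maps[OF t(2)] by (simp add: wlin_wpt)
    then show ?thesis using t(1) by (simp add: mem_C_iff power_mult_distrib)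
  qed
  obtain \<mu> where \<mu>: "\<mu> \<noteq> 0" "det (mscale \<mu> N) = 1" "\<And>p. eval3 Q (mscale \<mu> N *v p) = eval3 Q p"
    using exists_isometry[of N] * N(1) unfolding Q_def by blast
  have "eval3 F (mscale \<mu> N *v p) = (\<mu> ^ n * l)\<^sup>2 * eval3 F p" if "eval3 Q p = 0" for p
    using *[OF that] unfolding mscale_vector eval3_scale[OF F_hom]
    by (simp add: power_mult_distrib power_mult[symmetric] mult.commute)
  then have "lift_of (mscale \<mu> N) (\<mu> ^ n * l)" using \<mu> N(2) by (simp add: lift_of_def)
  moreover have "\<xi> \<sigma> = restrict (wlin (mscale \<mu> N) (\<mu> ^ n * l)) C"
    unfolding N(3)
  proof (rule restrict_ext)
    fix x assume "x \<in> C"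
    then obtain p t where "x = wpt n p t" using C_wpt by blast
    then show "wlin N l x = wlin (mscale \<mu> N) (\<mu> ^ n * l) x"
      using wpt_scale[OF \<mu>(1), of n "N *v p" "l * t"] by (simp add: wlin_wpt mscale_vector mult.assoc)
  qed
  ultimately show ?thesis by blast
qed

definition mat_of where "mat_of \<sigma> = (SOME N. \<exists>l. lift_of N l \<and> \<xi> \<sigma> = restrict (wlin N l) C)"
definition lam where "lam \<sigma> = (SOME l. lift_of (mat_of \<sigma>) l \<and> \<xi> \<sigma> = restrict (wlin (mat_of \<sigma>) l) C)"

lemma mat_of_lam:
  assumes "\<sigma> \<in> gal_set UNIV"
  shows "lift_of (mat_of \<sigma>) (lam \<sigma>)" "\<xi> \<sigma> = restrict (wlin (mat_of \<sigma>) (lam \<sigma>)) C"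
proof -
  have "\<exists>l. lift_of (mat_of \<sigma>) l \<and> \<xi> \<sigma> = restrict (wlin (mat_of \<sigma>) l) C"
    unfolding mat_of_def using xi_lift[OF assms] by (rule someI_ex)
  then have "lift_of (mat_of \<sigma>) (lam \<sigma>) \<and> \<xi> \<sigma> = restrict (wlin (mat_of \<sigma>) (lam \<sigma>)) C"
    unfolding lam_def by (rule someI_ex)
  then show "lift_of (mat_of \<sigma>) (lam \<sigma>)" "\<xi> \<sigma> = restrict (wlin (mat_of \<sigma>) (lam \<sigma>)) C" by blast+
qed

text \<open>\<open>acts_on_conic\<close> makes N and \<open>mat_of \<sigma>\<close> proportional at
  each point of the conic, so \<open>isometry_unique\<close> applies.\<close>

lemma is_normalized_iff:
  assumes \<sigma>: "\<sigma> \<in> gal_set UNIV"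
  shows "is_normalized_matrix n C Q (\<xi> \<sigma>) N \<longleftrightarrow> N = mat_of \<sigma>"
proof
  assume N: "is_normalized_matrix n C Q (\<xi> \<sigma>) N"
  then have N': "subst3 N Q = Q" "det N = 1" "acts_on_conic n C (\<xi> \<sigma>) N" by (simp_all add: is_normalized_matrix_def)
  have QN: "eval3 (conicQ (to_ac a) (to_ac b)) (N *v p) = eval3 (conicQ (to_ac a) (to_ac b)) p" for p
    using eval3_subst3[of N Q p] unfolding N'(1) by (simp only: Q_def)
  show "N = mat_of \<sigma>"
  proof (rule isometry_unique)
    fix p :: "'k alg_closure ^ 3" assume p: "p \<noteq> 0" "eval3 (conicQ (to_ac a) (to_ac b)) p = 0"
    then obtain t where t: "wpt n p t \<in> C" using C_point unfolding Q_def by blast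
    then obtain t' where "\<xi> \<sigma> (wpt n p t) = wpt n (N *v p) t'"
      using N'(3) unfolding acts_on_conic_def by blast
    then have "wpt n (mat_of \<sigma> *v p) (lam \<sigma> * t) = wpt n (N *v p) t'" using t by (simp add: mat_of_lam(2)[OF \<sigma>] wlin_wpt)
    then show "\<exists>c. N *v p = c *s (mat_of \<sigma> *v p)" by (auto simp: wpt_eq_iff)
  qed (rule QN N'(2) lift_of_isometry[OF mat_of_lam(1)[OF \<sigma>]] lift_of_det[OF mat_of_lam(1)[OF \<sigma>]])+
next
  assume N: "N = mat_of \<sigma>"
  have "subst3 N Q = Q" using mat_of_lam(1)[OF \<sigma>] unfolding N by (intro mpoly3_eqI) (simp add: lift_of_def)
  moreover have "acts_on_conic n C (\<xi> \<sigma>) N"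
    unfolding acts_on_conic_def by (auto simp: N mat_of_lam(2)[OF \<sigma>] wlin_wpt)
  ultimately show "is_normalized_matrix n C Q (\<xi> \<sigma>) N"
    using mat_of_lam(1)[OF \<sigma>] by (simp add: is_normalized_matrix_def N lift_of_def)
qed

lemma normalized_matrix_eq: "\<sigma> \<in> gal_set UNIV \<Longrightarrow> normalized_matrix n C Q (\<xi> \<sigma>) = mat_of \<sigma>"
  unfolding normalized_matrix_def by (rule the_equality) (simp_all add: is_normalized_iff)

lemma lift_of_conj:
  assumes "gal_elem \<sigma>" "lift_of N l" shows "lift_of (gal_mat \<sigma> N) (\<sigma> l)"
proof -
  interpret gal_elem \<sigma> by fact
  have conj: "eval3 P (gal_mat \<sigma> N *v gal_vec \<sigma> p) = \<sigma> (eval3 P (N *v p))" if "poly_over_k P" for P p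
    using that by (simp add: eval3_gal_fixed gal_vec_mult[symmetric])
  have "eval3 Q (gal_mat \<sigma> N *v gal_vec \<sigma> p) = eval3 Q (gal_vec \<sigma> p)" for p
    using assms(2) by (simp add: conj Q_over_k eval3_gal_fixed lift_of_def)
  moreover have "eval3 F (gal_mat \<sigma> N *v gal_vec \<sigma> p) = (\<sigma> l)\<^sup>2 * eval3 F (gal_vec \<sigma> p)"
    if "eval3 Q (gal_vec \<sigma> p) = 0" for p
    using assms(2) that by (simp add: conj Q_over_k F_over_k eval3_gal_fixed lift_of_def)
  ultimately show ?thesis
    using assms(2) gal_vec_inv unfolding lift_of_def det_gal_mat by (metis one eq_0_iff)
qed

lemma wlin_Bij: "lift_of N l \<Longrightarrow> restrict (wlin N l) C \<in> Bij C"
  using linear_model_iso.bij[OF lift_of_iso, of N l n] by (simp add: Bij_def C_def)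

text \<open>The cocycle law of \<xi> compares two normalised lifts of the same map, so by uniqueness
  it holds for the matrices and factors themselves and not only up to scalars.\<close>

lemma mat_of_lam_cocycle:
  assumes \<sigma>: "\<sigma> \<in> gal_set UNIV" and \<tau>: "\<tau> \<in> gal_set UNIV"
  shows "mat_of (\<sigma> \<circ> \<tau>) = mat_of \<sigma> ** gal_mat \<sigma> (mat_of \<tau>) \<and> lam (\<sigma> \<circ> \<tau>) = lam \<sigma> * \<sigma> (lam \<tau>)"
proof -
  interpret gal_elem \<sigma> using \<sigma> by unfold_locales
  note conj = lift_of_conj[OF gal_elem_axioms mat_of_lam(1)[OF \<tau>]]
  have gm: "gal_map \<sigma> C (\<xi> \<tau>) = restrict (wlin (gal_mat \<sigma> (mat_of \<tau>)) (\<sigma> (lam \<tau>))) C"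
    unfolding mat_of_lam(2)[OF \<tau>] by (rule gal_map_wlin[OF F_over_k Q_over_k C_def'])
  have "\<xi> (\<sigma> \<circ> \<tau>) = \<xi> \<sigma> \<otimes>\<^bsub>aut_group n C\<^esub> gal_map \<sigma> C (\<xi> \<tau>)"
    using cocycle \<sigma> \<tau> by (auto simp: cocycle_def carrier_abs_gal mult_abs_gal)
  also have "\<dots> = compose C (\<xi> \<sigma>) (gal_map \<sigma> C (\<xi> \<tau>))"
    using wlin_Bij[OF mat_of_lam(1)[OF \<sigma>]] wlin_Bij[OF conj]
    unfolding gm mat_of_lam(2)[OF \<sigma>] by (simp add: aut_group_def BijGroup_def)
  also have "\<dots> = restrict (wlin (mat_of \<sigma> ** gal_mat \<sigma> (mat_of \<tau>)) (lam \<sigma> * \<sigma> (lam \<tau>))) C"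
    unfolding gm mat_of_lam(2)[OF \<sigma>] by (rule compose_wlin[OF lift_of_mem[OF conj] C_wpt])
  finally have "restrict (wlin (mat_of (\<sigma> \<circ> \<tau>)) (lam (\<sigma> \<circ> \<tau>))) C
      = restrict (wlin (mat_of \<sigma> ** gal_mat \<sigma> (mat_of \<tau>)) (lam \<sigma> * \<sigma> (lam \<tau>))) C"
    unfolding mat_of_lam(2)[OF gal_comp[OF \<sigma> \<tau>]] .
  then show ?thesis
    by (rule lift_of_unique[OF mat_of_lam(1)[OF gal_comp[OF \<sigma> \<tau>]] lift_of_mult[OF mat_of_lam(1)[OF \<sigma>] conj]])
qed

text \<open>Take a finite set spanning L over k: automorphisms that agree on it agree on L, through
  which \<xi> factors.\<close>

lemma mat_of_lam_finite:
  obtains B where "finite B" "\<And>\<sigma> \<tau>. \<sigma> \<in> gal_set UNIV \<Longrightarrow> \<tau> \<in> gal_set UNIV \<Longrightarrow> restrict \<sigma> B = restrict \<tau> B \<Longrightarrow>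
    mat_of \<sigma> = mat_of \<tau> \<and> lam \<sigma> = lam \<tau>"
proof -
  obtain B where B: "finite B" "L = module.span ext_scale B"
    using L(1) by (auto simp: finite_galois_def finite_ext_def)
  show ?thesis
  proof (rule that[OF B(1)])
    fix \<sigma> \<tau> assume st: "\<sigma> \<in> gal_set UNIV" "\<tau> \<in> gal_set UNIV" "restrict \<sigma> B = restrict \<tau> B"
    then have "restrict \<sigma> (determined B) = restrict \<tau> (determined B)" by (simp add: restrict_determined_eq_iff)
    moreover have "L \<subseteq> determined B" using span_determined B(2) by blast
    ultimately have "restrict \<sigma> L = restrict \<tau> L" by (metis restrict_restrict inf.absorb2)
    then have "\<xi> \<sigma> = \<xi> \<tau>" using L(2) st by (auto simp: carrier_abs_gal)
    then show "mat_of \<sigma> = mat_of \<tau> \<and> lam \<sigma> = lam \<tau>"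
      using lift_of_unique[OF mat_of_lam(1)[OF st(1)] mat_of_lam(1)[OF st(2)]] mat_of_lam(2)[OF st(1)] mat_of_lam(2)[OF st(2)] by simp
  qed
qed

lemma exists_M: "\<exists>M. invertible M \<and> (\<forall>\<sigma>\<in>gal_set UNIV. mat_of \<sigma> = M ** matrix_inv (gal_mat \<sigma> M))"
proof -
  obtain B where B: "finite B" "\<And>\<sigma> \<tau>. \<sigma> \<in> gal_set UNIV \<Longrightarrow> \<tau> \<in> gal_set UNIV \<Longrightarrow> restrict \<sigma> B = restrict \<tau> B \<Longrightarrow>
    mat_of \<sigma> = mat_of \<tau> \<and> lam \<sigma> = lam \<tau>" using mat_of_lam_finite by blast
  interpret gal_class B by unfold_locales (rule B)
  show ?thesis
    by (rule hilbert90_GL3) (use B mat_of_lam_cocycle mat_of_lam(1) lift_of_invertible in blast)+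
qed

lemma exists_w: "\<exists>w. w \<noteq> 0 \<and> (\<forall>\<sigma>\<in>gal_set UNIV. lam \<sigma> * \<sigma> w = w)"
proof -
  obtain B where B: "finite B" "\<And>\<sigma> \<tau>. \<sigma> \<in> gal_set UNIV \<Longrightarrow> \<tau> \<in> gal_set UNIV \<Longrightarrow> restrict \<sigma> B = restrict \<tau> B \<Longrightarrow>
    mat_of \<sigma> = mat_of \<tau> \<and> lam \<sigma> = lam \<tau>" using mat_of_lam_finite by blast
  interpret gal_class B by unfold_locales (rule B)
  show ?thesis
  proof (rule hilbert90_units)
    show "lam \<sigma> \<noteq> 0" if "\<sigma> \<in> gal_set UNIV" for \<sigma> using mat_of_lam(1)[OF that] by (simp add: lift_of_def)
  qed (use B mat_of_lam_cocycle in blast)+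
qed

end

section \<open>The twisted conic and the scalar v\<close>

locale twist_matrix = hyperelliptic_twist +
  fixes M :: "'a alg_closure ^ 3 ^ 3"
  assumes M: "invertible M" "\<And>\<sigma>. \<sigma> \<in> gal_set UNIV \<Longrightarrow> mat_of \<sigma> = M ** matrix_inv (gal_mat \<sigma> M)"
begin

abbreviation "QM \<equiv> subst3 M Q"
abbreviation "fM \<equiv> subst3 M F"

lemma mat_of_gal_M: assumes "\<sigma> \<in> gal_set UNIV" shows "mat_of \<sigma> ** gal_mat \<sigma> M = M"
proof -
  interpret gal_elem \<sigma> using assms by unfold_locales
  show ?thesis
    unfolding M(2)[OF assms]
    by (simp add: matrix_mul_assoc[symmetric] matrix_inv_inverse(2)[OF invertible_gal_mat[OF M(1)]])
qed

text \<open>\<open>M\<close> is \<open>gal_mat \<sigma> M\<close> followed by the isometry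
  \<open>mat_of \<sigma>\<close>.\<close>

lemma Q_gal_M: assumes "\<sigma> \<in> gal_set UNIV" shows "eval3 Q (gal_mat \<sigma> M *v p) = eval3 Q (M *v p)"
proof -
  have "eval3 Q (mat_of \<sigma> *v (gal_mat \<sigma> M *v p)) = eval3 Q (gal_mat \<sigma> M *v p)"
    using mat_of_lam(1)[OF assms] by (simp add: lift_of_def)
  then show ?thesis by (simp add: matrix_vector_mul_assoc mat_of_gal_M[OF assms])
qed

lemma F_gal_M: assumes "\<sigma> \<in> gal_set UNIV" "eval3 Q (M *v p) = 0"
  shows "eval3 F (M *v p) = (lam \<sigma>)\<^sup>2 * eval3 F (gal_mat \<sigma> M *v p)"
proof -
  have "eval3 F (mat_of \<sigma> *v (gal_mat \<sigma> M *v p)) = (lam \<sigma>)\<^sup>2 * eval3 F (gal_mat \<sigma> M *v p)"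
    using mat_of_lam(1)[OF assms(1)] assms by (simp add: lift_of_def Q_gal_M)
  then show ?thesis by (simp add: matrix_vector_mul_assoc mat_of_gal_M[OF assms(1)])
qed

lemma eval3_gal_subst:
  assumes "gal_elem \<sigma>" "poly_over_k P"
  shows "eval3 (gal_poly \<sigma> (subst3 M P)) p = eval3 P (gal_mat \<sigma> M *v p)"
proof -
  interpret gal_elem \<sigma> by fact
  have "eval3 P (gal_mat \<sigma> M *v p) = eval3 P (gal_vec \<sigma> (M *v gal_vec (inv_into UNIV \<sigma>) p))"
    by (simp add: gal_vec_mult)
  then show ?thesis using assms(2) by (simp add: eval3_gal_poly_at eval3_gal_fixed)
qed

lemma QM_over_k: "poly_over_k QM"
proof (rule poly_over_kI[OF perfect])
  fix \<sigma> :: "'a alg_closure \<Rightarrow> 'a alg_closure" assume \<sigma>: "gal_elem \<sigma>"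
  then show "gal_poly \<sigma> QM = QM"
    by (intro mpoly3_eqI) (simp add: eval3_gal_subst Q_over_k Q_gal_M gal_elem_iff)
qed

lemma eval3_gal_vfM:
  assumes "gal_elem \<sigma>"
  shows "eval3 (gal_poly \<sigma> (const3 v * fM)) p = \<sigma> v * eval3 F (gal_mat \<sigma> M *v p)"
proof -
  interpret gal_elem \<sigma> by fact
  show ?thesis
    using eval3_gal_subst[OF assms F_over_k, of p] by (simp add: eval3_gal_poly_at)
qed

text \<open>On the conic the difference equals (\<sigma>(v) - v l^2) F(\<sigma>(M) p), where l is
  \<open>lam \<sigma>\<close>. Divisibility means that it vanishes there, and at some point of the
  conic F(\<sigma>(M) p) is nonzero.\<close>

lemma dvd_iff:
  assumes \<sigma>: "\<sigma> \<in> gal_set UNIV"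
  shows "QM dvd gal_poly \<sigma> (const3 v * fM) - const3 v * fM \<longleftrightarrow> \<sigma> v = v * (lam \<sigma>)\<^sup>2"
proof
  interpret gal_elem \<sigma> using \<sigma> by unfold_locales
  assume "QM dvd gal_poly \<sigma> (const3 v * fM) - const3 v * fM"
  then obtain A where A: "gal_poly \<sigma> (const3 v * fM) - const3 v * fM = QM * A" by (auto simp: dvd_def)
  obtain r where r: "eval3 Q r = 0" "eval3 F r \<noteq> 0" using F_nz by blast
  define p where "p = matrix_inv M *v r"
  have Mp: "M *v p = r" by (simp add: p_def matrix_vector_mul_assoc matrix_inv_inverse[OF M(1)])
  have "\<sigma> v * eval3 F (gal_mat \<sigma> M *v p) = v * eval3 F r"
    using arg_cong[OF A, of "\<lambda>P. eval3 P p"] r by (simp add: eval3_gal_vfM gal_elem_axioms Mp)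
  moreover have "eval3 F r = (lam \<sigma>)\<^sup>2 * eval3 F (gal_mat \<sigma> M *v p)" using F_gal_M[OF \<sigma>, of p] r by (simp add: Mp)
  ultimately show "\<sigma> v = v * (lam \<sigma>)\<^sup>2" using r(2) by auto
next
  interpret gal_elem \<sigma> using \<sigma> by unfold_locales
  assume v: "\<sigma> v = v * (lam \<sigma>)\<^sup>2"
  show "QM dvd gal_poly \<sigma> (const3 v * fM) - const3 v * fM"
    unfolding Q_def
  proof (rule subst3_conicQ_dvdI[OF two a_nz M(1)])
    fix p assume "eval3 (conicQ (to_ac a) (to_ac b)) (M *v p) = 0"
    then have "eval3 Q (M *v p) = 0" by (simp add: Q_def)
    from F_gal_M[OF \<sigma> this]
    show "eval3 (gal_poly \<sigma> (const3 v * fM) - const3 v * fM) p = 0"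
      unfolding eval3_diff eval3_gal_vfM[OF gal_elem_axioms] by (simp add: v mult.assoc)
  qed
qed

lemma exists_v: "\<exists>v. v \<noteq> 0 \<and> (\<forall>\<sigma>\<in>gal_set UNIV. QM dvd gal_poly \<sigma> (const3 v * fM) - const3 v * fM)"
proof -
  obtain w where w: "w \<noteq> 0" "\<And>\<sigma>. \<sigma> \<in> gal_set UNIV \<Longrightarrow> lam \<sigma> * \<sigma> w = w" using exists_w by blast
  have "\<sigma> (1 / w\<^sup>2) = 1 / w\<^sup>2 * (lam \<sigma>)\<^sup>2" if \<sigma>: "\<sigma> \<in> gal_set UNIV" for \<sigma>
  proof -
    interpret gal_elem \<sigma> using \<sigma> by unfold_locales
    have *: "1 / u\<^sup>2 = 1 / w\<^sup>2 * l\<^sup>2" if "l * u = w" for l u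
      using w(1) by (simp add: that[symmetric] power_mult_distrib)
    show ?thesis using *[OF w(2)[OF \<sigma>]] by simp
  qed
  then show ?thesis using w(1) by (intro exI[of _ "1 / w\<^sup>2"]) (simp add: dvd_iff)
qed

end

section \<open>The curve over k and the sign character\<close>

locale twist_curve = twist_matrix +
  fixes v s :: "'a alg_closure" and E :: "'a alg_closure set" and G
  assumes v: "v \<noteq> 0" "\<And>\<sigma>. \<sigma> \<in> gal_set UNIV \<Longrightarrow> QM dvd gal_poly \<sigma> (const3 v * fM) - const3 v * fM"
    and s: "s\<^sup>2 = v" and E: "finite_galois E" and M_E: "\<And>i j. M $ i $ j \<in> E" and v_E: "v \<in> E"
    and degree_nz: "(of_nat (ext_degree E) :: 'a) \<noteq> 0"
    and G_def: "G = const3 (1 / of_nat (ext_degree E)) * (\<Sum>\<tau>\<in>gal_set E. gal_poly \<tau> (const3 v * fM))"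
begin

sublocale E: finite_galois_ext E by unfold_locales (rule E)

lemma sigma_v: "\<sigma> \<in> gal_set UNIV \<Longrightarrow> \<sigma> v = v * (lam \<sigma>)\<^sup>2"
  using v(2) dvd_iff by blast

lemma vfM_E: "coeffs_in E (const3 v * fM)"
  using F_over_k E.base_sub
  by (intro E.coeffs_in_mult E.coeffs_in_const v_E E.coeffs_in_subst3 M_E) (auto simp: coeffs_in_def poly_over_k_def)

text \<open>A restriction takes the value \<open>undefined\<close> outside E; since the
  coefficients, including 0, lie in E, it may be replaced by the automorphism.\<close>

lemma gal_poly_restrict: "gal_elem \<sigma> \<Longrightarrow> gal_poly (restrict \<sigma> E) (const3 v * fM) = gal_poly \<sigma> (const3 v * fM)"
proof -
  assume "gal_elem \<sigma>"
  then interpret gal_elem \<sigma> .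
  show ?thesis
    using vfM_E E.zero_mem by (intro poly_mapping_eqI) (simp add: gal_poly_def lookup_map_0 coeffs_in_def)
qed

lemma eval_G: assumes p: "eval3 Q (M *v p) = 0" shows "eval3 G p = v * eval3 F (M *v p)"
proof -
  have "eval3 (gal_poly \<tau> (const3 v * fM)) p = v * eval3 F (M *v p)" if \<tau>: "\<tau> \<in> gal_set E" for \<tau>
  proof -
    obtain \<sigma> where \<sigma>: "gal_elem \<sigma>" "\<tau> = restrict \<sigma> E" using \<tau> by (rule E.gal_set_extends)
    then have "\<sigma> \<in> gal_set UNIV" by (simp add: gal_elem_iff)
    then show ?thesis
      using F_gal_M[OF _ p, of \<sigma>] by (simp only: \<sigma> gal_poly_restrict eval3_gal_vfM sigma_v mult.assoc)
  qed
  \<comment> \<open>The size of the Galois group cancels against the degree by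
    \<open>card_gal_set\<close>; the degree is nonzero in the closure because it is so in k.\<close>
  then have "eval3 G p = 1 / of_nat (ext_degree E) * (of_nat (card (gal_set E)) * (v * eval3 F (M *v p)))"
    by (simp add: G_def)
  moreover have "(of_nat (ext_degree E) :: 'a alg_closure) \<noteq> 0"
    using degree_nz by (metis to_ac_of_nat to_ac_eq_0_iff)
  ultimately show ?thesis by (simp add: E.card_gal_set[OF perfect])
qed

text \<open>The coefficients of G are traces from E to k, divided by the degree.\<close>

lemma G_over_k: "poly_over_k G"
  unfolding poly_over_k_def
proof
  fix m
  let ?c = "Poly_Mapping.lookup (const3 v * fM) m"
  have "Poly_Mapping.lookup (gal_poly \<tau> (const3 v * fM)) m = \<tau> ?c" if \<tau>: "\<tau> \<in> gal_set E" for \<tau>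
  proof -
    obtain \<sigma> where \<sigma>: "gal_elem \<sigma>" "\<tau> = restrict \<sigma> E" using \<tau> by (rule E.gal_set_extends)
    then interpret gal_elem \<sigma> by simp
    show ?thesis using vfM_E unfolding \<sigma>(2) gal_poly_restrict[OF \<sigma>(1)] by (simp add: coeffs_in_def)
  qed
  then have "Poly_Mapping.lookup G m = 1 / of_nat (ext_degree E) * (\<Sum>\<tau>\<in>gal_set E. \<tau> ?c)"
    by (simp add: G_def const3_def mult_map_scale_conv_mult[symmetric] lookup_map_0 lookup_sum)
  moreover obtain c0 where "(\<Sum>\<tau>\<in>gal_set E. \<tau> ?c) = to_ac c0"
    using E.trace_in_base[of ?c] vfM_E by (auto simp: coeffs_in_def base_field_def)
  ultimately have "Poly_Mapping.lookup G m = to_ac (1 / of_nat (ext_degree E) * c0)" by simp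
  then show "Poly_Mapping.lookup G m \<in> base_field" unfolding base_field_def by blast
qed

lemma G_hom: "homogeneous3 (2 * n) G"
  unfolding G_def gal_poly_def
  by (intro homogeneous3_const_mult homogeneous3_sum homogeneous3_map homogeneous3_subst3 F_hom)

lemma s_nz: "s \<noteq> 0" using s v(1) by auto

lemma lam_nz: "\<sigma> \<in> gal_set UNIV \<Longrightarrow> lam \<sigma> \<noteq> 0"
  using mat_of_lam(1) by (auto simp: lift_of_def)

lemma iso:
  assumes r: "r\<^sup>2 = to_ac e" "e \<noteq> 0"
  shows "linear_model_iso (to_ac e) 1 (r / s) G QM F Q M"
proof
  show "r / s \<noteq> 0" using r s_nz by auto
  show "1 * (r / s * t)\<^sup>2 = eval3 F (M *v p) \<longleftrightarrow> to_ac e * t\<^sup>2 = eval3 G p" if "eval3 QM p = 0" for p t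
    using that v(1) by (simp add: eval_G power_mult_distrib power_divide r s field_simps)
qed (simp_all add: M(1))

text \<open>The conjugate of the isomorphism in \<open>iso\<close>, whose inverse enters the
  cocycle. The square of \<open>lam \<sigma>\<close> appears both in \<sigma>(s)^2 and in the value
  of G, and cancels.\<close>

lemma iso_conj:
  assumes r: "r\<^sup>2 = to_ac e" "e \<noteq> 0" and \<sigma>: "\<sigma> \<in> gal_set UNIV"
  shows "linear_model_iso (to_ac e) 1 (\<sigma> (r / s)) G QM F Q (gal_mat \<sigma> M)"
proof
  interpret gal_elem \<sigma> using \<sigma> by unfold_locales
  show "invertible (gal_mat \<sigma> M)" using M(1) by (rule invertible_gal_mat)
  show "\<sigma> (r / s) \<noteq> 0" using r s_nz by auto
  show "eval3 Q (gal_mat \<sigma> M *v p) = 0 \<longleftrightarrow> eval3 QM p = 0" for p by (simp add: Q_gal_M[OF \<sigma>])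
  show "1 * (\<sigma> (r / s) * t)\<^sup>2 = eval3 F (gal_mat \<sigma> M *v p) \<longleftrightarrow> to_ac e * t\<^sup>2 = eval3 G p" if "eval3 QM p = 0" for p t
  proof -
    have "(\<sigma> r)\<^sup>2 = to_ac e" "(\<sigma> s)\<^sup>2 = v * (lam \<sigma>)\<^sup>2"
      using r s sigma_v[OF \<sigma>] by (simp_all flip: power)
    moreover have "eval3 G p = v * (lam \<sigma>)\<^sup>2 * eval3 F (gal_mat \<sigma> M *v p)"
      using that F_gal_M[OF \<sigma>, of p] by (simp add: eval_G mult.assoc)
    ultimately show ?thesis using v(1) lam_nz[OF \<sigma>] by (simp add: power_mult_distrib power_divide field_simps)
  qed
qed

text \<open>The matrix part is M \<sigma>(M)^-1, and the factor is r / s over its conjugate. The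
  case r = 1 serves \<open>\<psi>0\<close>, and r a square root of e serves the final twist.\<close>

lemma twist_cocycle:
  assumes r: "r\<^sup>2 = to_ac e" "e \<noteq> 0" and \<sigma>: "\<sigma> \<in> gal_set UNIV"
    and Z: "Z = model n (to_ac e) G QM" and \<phi>: "\<phi> = restrict (wlin M (r / s)) Z"
  shows "compose C \<phi> (map_inv Z C (gal_map \<sigma> Z \<phi>)) = restrict (wlin (mat_of \<sigma>) (r / s * (1 / \<sigma> (r / s)))) C"
proof -
  interpret gal_elem \<sigma> using \<sigma> by unfold_locales
  interpret i: linear_model_iso n "to_ac e" 1 "\<sigma> (r / s)" G QM F Q "gal_mat \<sigma> M" by (rule iso_conj[OF r \<sigma>])
  have gm: "gal_map \<sigma> Z \<phi> = restrict (wlin (gal_mat \<sigma> M) (\<sigma> (r / s))) Z"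
    unfolding \<phi> by (rule gal_map_wlin[OF G_over_k QM_over_k Z])
  have mi: "map_inv Z C (gal_map \<sigma> Z \<phi>) = restrict (wlin (matrix_inv (gal_mat \<sigma> M)) (1 / \<sigma> (r / s))) C"
    unfolding gm unfolding Z C_def by (rule i.map_inv_wlin)
  show ?thesis
    unfolding mi unfolding \<phi> compose_def
  proof (rule restrict_ext)
    fix x assume x: "x \<in> C"
    then obtain p t where pt: "x = wpt n p t" using C_wpt by blast
    have "wlin (matrix_inv (gal_mat \<sigma> M)) (1 / \<sigma> (r / s)) x \<in> Z"
      using i.wlin_inverse_mem x unfolding Z C_def by blast
    then show "restrict (wlin M (r / s)) Z (restrict (wlin (matrix_inv (gal_mat \<sigma> M)) (1 / \<sigma> (r / s))) C x)
       = wlin (mat_of \<sigma>) (r / s * (1 / \<sigma> (r / s))) x"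
      using x unfolding M(2)[OF \<sigma>] by (simp add: pt wlin_wpt matrix_vector_mul_assoc mult.assoc)
  qed
qed

definition C0 where "C0 = model n 1 G QM"
definition \<psi>0 where "\<psi>0 = restrict (wlin M (1 / s)) C0"

lemma \<psi>0_iso: "curve_iso n C0 C \<psi>0"
proof -
  interpret linear_model_iso n "to_ac 1" 1 "1 / s" G QM F Q M by (rule iso) simp_all
  show ?thesis using curve_iso by (simp add: C0_def \<psi>0_def C_def)
qed

definition i where "i \<sigma> = compose C (map_inv C C (\<xi> \<sigma>)) (compose C \<psi>0 (map_inv C0 C (gal_map \<sigma> C0 \<psi>0)))"
definition eps where "eps \<sigma> = \<sigma> s / (s * lam \<sigma>)"

lemma eps_square: assumes "\<sigma> \<in> gal_set UNIV" shows "(eps \<sigma>)\<^sup>2 = 1"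
proof -
  interpret gal_elem \<sigma> using assms by unfold_locales
  have "(\<sigma> s)\<^sup>2 = v * (lam \<sigma>)\<^sup>2" using s sigma_v[OF assms] by (simp flip: power)
  then show ?thesis using v(1) s lam_nz[OF assms] by (simp add: eps_def power_divide power_mult_distrib)
qed

lemma eps_cases: "\<sigma> \<in> gal_set UNIV \<Longrightarrow> eps \<sigma> = 1 \<or> eps \<sigma> = - 1"
  using eps_square by (simp add: power2_eq_1_iff)

lemma i_eq: assumes \<sigma>: "\<sigma> \<in> gal_set UNIV" shows "i \<sigma> = restrict (wlin (mat 1) (eps \<sigma>)) C"
proof -
  interpret gal_elem \<sigma> using \<sigma> by unfold_locales
  interpret x: linear_model_iso n 1 1 "lam \<sigma>" F Q F Q "mat_of \<sigma>" by (rule lift_of_iso[OF mat_of_lam(1)[OF \<sigma>]])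
  have 1: "compose C \<psi>0 (map_inv C0 C (gal_map \<sigma> C0 \<psi>0)) = restrict (wlin (mat_of \<sigma>) (1 / s * (1 / \<sigma> (1 / s)))) C"
    by (rule twist_cocycle[of 1 1]) (simp_all add: \<sigma> C0_def \<psi>0_def)
  have "mat_of \<sigma> = mat_of \<sigma> ** mat 1" by simp
  \<comment> \<open>So this composite differs from \<open>\<xi> \<sigma>\<close> by a sign on t
    only; in particular it maps C to itself.\<close>
  moreover have "1 / s * (1 / \<sigma> (1 / s)) = lam \<sigma> * eps \<sigma>" using s_nz lam_nz[OF \<sigma>] by (simp add: eps_def)
  ultimately have 2: "lift_of (mat_of \<sigma>) (1 / s * (1 / \<sigma> (1 / s)))"
    using lift_of_mult[OF mat_of_lam(1)[OF \<sigma>] lift_of_1[OF eps_square[OF \<sigma>]]] by simp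
  have 3: "map_inv C C (\<xi> \<sigma>) = restrict (wlin (matrix_inv (mat_of \<sigma>)) (1 / lam \<sigma>)) C"
    unfolding mat_of_lam(2)[OF \<sigma>] by (rule x.map_inv_wlin[folded C_def])
  have "i \<sigma> = restrict (wlin (matrix_inv (mat_of \<sigma>) ** mat_of \<sigma>) (1 / lam \<sigma> * (1 / s * (1 / \<sigma> (1 / s))))) C"
    unfolding i_def 1 3 by (rule compose_wlin[OF lift_of_mem[OF 2] C_wpt])
  also have "1 / lam \<sigma> * (1 / s * (1 / \<sigma> (1 / s))) = eps \<sigma>" by (simp add: eps_def)
  also have "matrix_inv (mat_of \<sigma>) ** mat_of \<sigma> = mat 1"
    by (rule matrix_inv_inverse(2)[OF lift_of_invertible[OF mat_of_lam(1)[OF \<sigma>]]])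
  finally show ?thesis .
qed

lemma wlin_1: "restrict (wlin (mat 1) 1) C = (\<lambda>x\<in>C. x)"
proof (rule restrict_ext)
  fix x assume "x \<in> C"
  then obtain p t where "x = wpt n p t" using C_wpt by blast
  then show "wlin (mat 1) 1 x = x" by (simp add: wlin_wpt)
qed

lemma i_mem: "\<sigma> \<in> gal_set UNIV \<Longrightarrow> i \<sigma> \<in> carrier (involution_group C)"
  using eps_cases[of \<sigma>] generate.one[of "BijGroup C" "{hyp_involution C}"]
    generate.incl[of "hyp_involution C" "{hyp_involution C}" "BijGroup C"]
  by (auto simp: involution_group_def i_eq wlin_1 BijGroup_def hyp_involution_def)

text \<open>The quotient \<sigma>(s) / s is a coboundary and \<open>lam\<close> is a
  cocycle.\<close>

lemma eps_cocycle:
  assumes \<sigma>: "\<sigma> \<in> gal_set UNIV" and \<tau>: "\<tau> \<in> gal_set UNIV" shows "eps (\<sigma> \<circ> \<tau>) = eps \<sigma> * \<sigma> (eps \<tau>)"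
proof -
  interpret gal_elem \<sigma> using \<sigma> by unfold_locales
  show ?thesis using mat_of_lam_cocycle[OF \<sigma> \<tau>] s_nz by (simp add: eps_def)
qed

lemma i_hom: "i \<in> hom abs_gal (involution_group C)"
proof (rule homI)
  fix \<sigma> :: "'a alg_closure \<Rightarrow> 'a alg_closure" assume "\<sigma> \<in> carrier abs_gal"
  then show "i \<sigma> \<in> carrier (involution_group C)" by (simp add: i_mem carrier_abs_gal)
next
  fix \<sigma> \<tau> :: "'a alg_closure \<Rightarrow> 'a alg_closure" assume "\<sigma> \<in> carrier abs_gal" "\<tau> \<in> carrier abs_gal"
  then have \<sigma>: "\<sigma> \<in> gal_set UNIV" and \<tau>: "\<tau> \<in> gal_set UNIV" by (simp_all add: carrier_abs_gal)
  interpret gal_elem \<sigma> using \<sigma> by unfold_locales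
  \<comment> \<open>Signs lie in k, so for them the cocycle law is multiplicativity.\<close>
  have "\<sigma> (eps \<tau>) = eps \<tau>" using eps_cases[OF \<tau>] by auto
  then have eps: "eps (\<sigma> \<circ> \<tau>) = eps \<sigma> * eps \<tau>" using eps_cocycle[OF \<sigma> \<tau>] by simp
  note ls = lift_of_1[OF eps_square[OF \<sigma>]] and lt = lift_of_1[OF eps_square[OF \<tau>]]
  have "i \<sigma> \<otimes>\<^bsub>involution_group C\<^esub> i \<tau> = compose C (i \<sigma>) (i \<tau>)"
    using wlin_Bij[OF ls] wlin_Bij[OF lt] unfolding i_eq[OF \<sigma>] i_eq[OF \<tau>]
    by (simp add: involution_group_def BijGroup_def)
  also have "\<dots> = restrict (wlin (mat 1 ** mat 1) (eps \<sigma> * eps \<tau>)) C"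
    unfolding i_eq[OF \<sigma>] i_eq[OF \<tau>] by (rule compose_wlin[OF lift_of_mem[OF lt] C_wpt])
  finally show "i (\<sigma> \<otimes>\<^bsub>abs_gal\<^esub> \<tau>) = i \<sigma> \<otimes>\<^bsub>involution_group C\<^esub> i \<tau>"
    by (simp add: mult_abs_gal i_eq[OF gal_comp[OF \<sigma> \<tau>]] eps)
qed

lemma i_eq_1_iff: assumes "\<sigma> \<in> gal_set UNIV" shows "i \<sigma> = \<one>\<^bsub>involution_group C\<^esub> \<longleftrightarrow> eps \<sigma> = 1"
proof -
  have one: "\<one>\<^bsub>involution_group C\<^esub> = restrict (wlin (mat 1) 1) C"
    by (simp add: involution_group_def BijGroup_def wlin_1)
  show ?thesis
    unfolding one i_eq[OF assms]
    using lift_of_unique[OF lift_of_1[OF eps_square[OF assms]] lift_of_1[of 1]] by auto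
qed

text \<open>Hilbert 90 for \<open>eps\<close> provides an element on which \<open>\<sigma>\<close> acts as \<open>eps \<sigma>\<close>; it lies in \<open>k(r)\<close>, so that
  \<open>\<sigma> r = r\<close> forces \<open>eps \<sigma> = 1\<close>.\<close>

lemma sigma_r:
  assumes r: "r\<^sup>2 = to_ac e" "e \<noteq> 0"
    and adj: "adjoin r = fixed_field (kernel abs_gal (involution_group C) i)"
    and \<sigma>: "\<sigma> \<in> gal_set UNIV"
  shows "\<sigma> r = eps \<sigma> * r"
proof -
  interpret gal_elem \<sigma> using \<sigma> by unfold_locales
  have ker: "\<tau> \<in> kernel abs_gal (involution_group C) i \<longleftrightarrow> \<tau> \<in> gal_set UNIV \<and> eps \<tau> = 1" for \<tau>
    by (auto simp: kernel_def carrier_abs_gal i_eq_1_iff)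
  have r_adj: "r \<in> adjoin r" by (auto simp: adjoin_def)
  have "(\<sigma> r)\<^sup>2 = r\<^sup>2" using r by (simp flip: power)
  then have pm: "\<sigma> r = r \<or> \<sigma> r = - r" by (simp add: power2_eq_iff)
  show ?thesis
  proof (cases "eps \<sigma> = 1")
    case True
    \<comment> \<open>Here \<sigma> lies in the kernel, whose fixed field contains r.\<close>
    then have "\<sigma> r = r" using r_adj \<sigma> unfolding adj by (auto simp: fixed_field_def ker)
    then show ?thesis using True by simp
  next
    case False
    then have e: "eps \<sigma> = - 1" using eps_cases[OF \<sigma>] by blast
    obtain B where B: "finite B" "\<And>\<sigma> \<tau>. \<sigma> \<in> gal_set UNIV \<Longrightarrow> \<tau> \<in> gal_set UNIV \<Longrightarrow> restrict \<sigma> B = restrict \<tau> B \<Longrightarrow>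
      mat_of \<sigma> = mat_of \<tau> \<and> lam \<sigma> = lam \<tau>" using mat_of_lam_finite by blast
    \<comment> \<open>The sign \<open>eps \<sigma>\<close> is computed from \<sigma>(s) and
      \<open>lam \<sigma>\<close>, hence depends only on the values of \<sigma> on s and B.\<close>
    interpret gc: gal_class "insert s B" by unfold_locales (simp add: B)
    have "\<exists>w. w \<noteq> 0 \<and> (\<forall>\<sigma>\<in>gal_set UNIV. eps \<sigma> * \<sigma> w = w)"
    proof (rule gc.hilbert90_units)
      fix \<sigma> \<tau> assume st: "\<sigma> \<in> gal_set UNIV" "\<tau> \<in> gal_set UNIV" "restrict \<sigma> (insert s B) = restrict \<tau> (insert s B)"
      then have agree: "\<forall>x\<in>insert s B. \<sigma> x = \<tau> x" by (metis restrict_apply')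
      then have "restrict \<sigma> B = restrict \<tau> B" by (intro restrict_ext) blast
      then have "lam \<sigma> = lam \<tau>" using B(2)[OF st(1,2)] by blast
      moreover have "\<sigma> s = \<tau> s" using agree by blast
      ultimately show "eps \<sigma> = eps \<tau>" unfolding eps_def by (simp only:)
    next
      show "eps \<sigma> \<noteq> 0" if "\<sigma> \<in> gal_set UNIV" for \<sigma> using eps_cases[OF that] by auto
    qed (rule eps_cocycle)
    then obtain w where w: "w \<noteq> 0" "\<And>\<sigma>. \<sigma> \<in> gal_set UNIV \<Longrightarrow> eps \<sigma> * \<sigma> w = w" by blast
    \<comment> \<open>The kernel fixes w, and k(r) is by assumption everything that the kernel
      fixes.\<close>
    have "\<tau> w = w" if "\<tau> \<in> kernel abs_gal (involution_group C) i" for \<tau>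
      using w(2)[of \<tau>] that by (simp add: ker)
    then have "w \<in> adjoin r" unfolding adj by (simp add: fixed_field_def)
    have "\<sigma> r \<noteq> r"
    proof
      assume "\<sigma> r = r"
      then have "\<sigma> w = w" using adjoin_fixed[OF gal_elem_axioms _ \<open>w \<in> adjoin r\<close>] by blast
      then have "- w = w" using w(2)[OF \<sigma>] e by simp
      then have "2 * w = 0" by (metis add.right_inverse mult_2)
      then show False using w(1) two by simp
    qed
    then show ?thesis using pm e by simp
  qed
qed

text \<open>Both \<sigma>(r) and \<sigma>(s) carry the sign \<open>eps \<sigma>\<close>; it cancels
  in r / s over its conjugate, which leaves exactly \<open>lam \<sigma>\<close>, the factor of
  \<open>\<xi> \<sigma>\<close>.\<close>

lemma twist:
  assumes r: "r\<^sup>2 = to_ac e" "e \<noteq> 0"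
    and adj: "adjoin r = fixed_field (kernel abs_gal (involution_group C) i)"
    and Z: "Z = model n (to_ac e) G QM" and \<phi>: "\<phi> = restrict (wlin M (r / s)) Z"
  shows "locus_over_k n Z \<and> curve_iso n Z C \<phi> \<and>
    (\<forall>\<sigma>\<in>gal_set UNIV. compose C \<phi> (map_inv Z C (gal_map \<sigma> Z \<phi>)) = \<xi> \<sigma>)"
proof (intro conjI ballI)
  have QM_hom: "homogeneous3 2 QM" by (intro homogeneous3_subst3 Q_hom)
  have zero: "poly_over_k 0" and const: "poly_over_k (const3 (to_ac e))"
    by (auto simp: poly_over_k_def const3_def lookup_single when_def base_field_def image_iff intro: exI[of _ 0] exI[of _ e])
  have uminus: "poly_over_k (- G)"
    using G_over_k unfolding poly_over_k_def base_field_def by (auto simp: image_iff) (metis to_ac_minus)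
  have "whomogeneous n 2 [:QM:]"
    using QM_hom by (auto simp: whomogeneous_def coeff_pCons homogeneous3_def split: nat.split)
  \<comment> \<open>As t has weight n, both e t^2 and G have weight 2 n.\<close>
  moreover have "whomogeneous n (2 * n) [:- G, 0, const3 (to_ac e):]"
    using G_hom homogeneous3_const[of "to_ac e"]
    by (auto simp: whomogeneous_def coeff_pCons homogeneous3_def split: nat.split)
  moreover have "poly_over_k (Polynomial.coeff [:QM:] j)" for j
    using QM_over_k zero by (auto simp: coeff_pCons split: nat.split)
  moreover have "poly_over_k (Polynomial.coeff [:- G, 0, const3 (to_ac e):] j)" for j
    using uminus zero const by (auto simp: coeff_pCons split: nat.split)
  ultimately show "locus_over_k n Z"
    unfolding locus_over_k_def Z model_def
    by (intro exI[of _ "model_eqs (to_ac e) G QM"]) (auto simp: model_eqs_def)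
  show "curve_iso n Z C \<phi>"
    unfolding \<phi> Z C_def by (rule linear_model_iso.curve_iso[OF iso[OF r]])
next
  fix \<sigma> :: "'a alg_closure \<Rightarrow> 'a alg_closure" assume \<sigma>: "\<sigma> \<in> gal_set UNIV"
  then interpret gal_elem \<sigma> by unfold_locales
  have "r \<noteq> 0" "eps \<sigma> \<noteq> 0" using r eps_cases[OF \<sigma>] by auto
  moreover have "\<sigma> s = eps \<sigma> * (s * lam \<sigma>)" using s_nz lam_nz[OF \<sigma>] by (simp add: eps_def)
  ultimately have "r / s * (1 / \<sigma> (r / s)) = lam \<sigma>"
    using s_nz by (simp add: sigma_r[OF r adj \<sigma>])
  then show "compose C \<phi> (map_inv Z C (gal_map \<sigma> Z \<phi>)) = \<xi> \<sigma>"
    using twist_cocycle[OF r \<sigma> Z \<phi>] mat_of_lam(2)[OF \<sigma>] by simp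
qed

end

text \<open>If \<open>F\<close> vanished on the conic, it would be divisible by \<open>Q\<close>, so that \<open>t\<^sup>2\<close> and hence \<open>t\<close> would lie in the
  ideal; but modulo \<open>x\<close>, \<open>y\<close>, \<open>z\<close> its elements are multiples of \<open>t\<^sup>2\<close>.\<close>

lemma prime_model_imp_nonvanishing:
  fixes F :: "'a::alg_closed_field mpoly3"
  assumes prime: "prime_ideal (module.span (*) (model_eqs 1 F (conicQ a b)))"
    and two: "(2::'a) \<noteq> 0" and a: "a \<noteq> 0" and F0: "eval3 F 0 = 0"
  shows "\<exists>p. eval3 (conicQ a b) p = 0 \<and> eval3 F p \<noteq> 0"
proof (rule ccontr)
  interpret R: Modules.module "(*) :: 'a mpoly3 poly \<Rightarrow> _"
    by unfold_locales (simp_all add: algebra_simps)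
  let ?I = "module.span (*) (model_eqs 1 F (conicQ a b))"
  assume "\<not> ?thesis"
  then have "conicQ a b dvd F" by (intro conicQ_dvdI[OF two a]) blast
  then obtain A where A: "F = conicQ a b * A" by (auto simp: dvd_def)
  have gen: "[: conicQ a b :] \<in> ?I" "[: - F, 0, const3 1 :] \<in> ?I"
    by (auto intro: R.span_base simp: model_eqs_def)
  \<comment> \<open>Adding A times Q cancels F and leaves t^2, so t lies in the prime ideal.\<close>
  have "[: A :] * [: conicQ a b :] + [: - F, 0, const3 1 :] \<in> ?I"
    by (intro R.span_add R.span_scale gen)
  also have "[: A :] * [: conicQ a b :] + [: - F, 0, const3 1 :] = [:0, 1:] * [:0, 1:]"
    by (simp add: A const3_1 mult.commute)
  finally have "[:0, 1:] \<in> ?I" using prime unfolding prime_ideal_def by blast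
  \<comment> \<open>Both generators have this property, because F and Q vanish at the origin; it is
    stable under multiples and sums, but fails for t.\<close>
  then have "eval3 (Polynomial.coeff [:0, 1:] 0) 0 = 0 \<and> eval3 (Polynomial.coeff [:0, 1 :: 'a mpoly3:] 1) 0 = 0"
  proof (induction rule: R.span_induct_alt)
    case (step c x y)
    then have "eval3 (Polynomial.coeff x 0) 0 = 0 \<and> eval3 (Polynomial.coeff x 1) 0 = 0"
      using F0 by (auto simp: model_eqs_def)
    then show ?case using step(2) by (simp add: coeff_mult)
  qed simp
  then show False by simp
qed

theorem theorem3p2:
  fixes a b :: "'k::field"
    and f :: "'k mpoly3"
    and g d n :: nat
    and L :: "'k alg_closure set"
    and \<xi> :: "('k alg_closure \<Rightarrow> 'k alg_closure) \<Rightarrow> 'k alg_closure wpoint \<Rightarrow> 'k alg_closure wpoint"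
    and C :: "'k alg_closure wpoint set"
  assumes d_def: "d = (if odd g then g + 1 else g + 2)"
    and n_def: "n = d div 2"
    and fbar_def: "fbar = Poly_Mapping.map to_ac f"
    and Q_def: "Q = conicQ (to_ac a) (to_ac b)"
    and C_def: "C = model n 1 fbar Q"
    and xibar_def: "\<xi>bar = (\<lambda>\<sigma>. normalized_matrix n C Q (\<xi> \<sigma>))"
    and "perfect_field TYPE('k)"
    and "CHAR('k) \<noteq> 2"
    and "a \<noteq> 0" and "b \<noteq> 0"
    and "homogeneous3 d f"
    and "hyperelliptic_model g n fbar Q"
    and "cocycle n C \<xi>"
    and "continuous_map krull_topology (discrete_topology (carrier (aut_group n C))) \<xi>"
    and "finite_galois L"
    and "\<exists>\<xi>'. \<forall>\<sigma>\<in>carrier abs_gal. \<xi> \<sigma> = \<xi>' (restrict \<sigma> L)"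
    and "\<forall>\<sigma>\<in>carrier abs_gal. \<exists>N l. invertible N \<and> l \<noteq> 0 \<and> \<xi> \<sigma> = restrict (wlin N l) C"
  shows "(\<forall>\<sigma>\<in>carrier abs_gal. \<exists>!N. is_normalized_matrix n C Q (\<xi> \<sigma>) N) \<and>
    (\<exists>M. invertible M \<and> (\<forall>\<sigma>\<in>carrier abs_gal. \<xi>bar \<sigma> = M ** matrix_inv (gal_mat \<sigma> M))) \<and>
    (\<forall>M. invertible M \<and> (\<forall>\<sigma>\<in>carrier abs_gal. \<xi>bar \<sigma> = M ** matrix_inv (gal_mat \<sigma> M)) \<longrightarrow>
      (let QM = subst3 M Q; fM = subst3 M fbar
       in poly_over_k QM \<and>
        (\<exists>v. v \<noteq> 0 \<and> (\<forall>\<sigma>\<in>carrier abs_gal.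
            QM dvd gal_poly \<sigma> (const3 v * fM) - const3 v * fM)) \<and>
        (\<forall>v s L'. v \<noteq> 0 \<and> (\<forall>\<sigma>\<in>carrier abs_gal.
            QM dvd gal_poly \<sigma> (const3 v * fM) - const3 v * fM) \<and>
          s\<^sup>2 = v \<and>
          finite_galois L' \<and> L \<subseteq> L' \<and> (\<forall>i j. M $ i $ j \<in> L') \<and> v \<in> L' \<and>
          (of_nat (ext_degree L') :: 'k) \<noteq> 0 \<longrightarrow>
          (let G = const3 (1 / of_nat (ext_degree L')) *
                 (\<Sum>\<tau>\<in>gal_set L'. gal_poly \<tau> (const3 v * fM));
               C0 = model n 1 G QM;
               \<psi>0 = restrict (wlin M (1 / s)) C0;
               i = (\<lambda>\<sigma>. compose C (map_inv C C (\<xi> \<sigma>))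
                      (compose C \<psi>0 (map_inv C0 C (gal_map \<sigma> C0 \<psi>0))))
           in poly_over_k G \<and>
            curve_iso n C0 C \<psi>0 \<and>
            (\<forall>\<sigma>\<in>carrier abs_gal. i \<sigma> \<in> carrier (involution_group C)) \<and>
            i \<in> hom abs_gal (involution_group C) \<and>
            (\<forall>e r. e \<noteq> 0 \<and> r\<^sup>2 = to_ac e \<and>
              adjoin r = fixed_field (kernel abs_gal (involution_group C) i) \<and>
              ((\<forall>\<sigma>\<in>carrier abs_gal. i \<sigma> = \<one>\<^bsub>involution_group C\<^esub>) \<longrightarrow> e = 1) \<longrightarrow>
              (let C' = model n (to_ac e) G QM;
                   \<phi> = restrict (wlin M (r / s)) C'
               in locus_over_k n C' \<and>
                curve_iso n C' C \<phi> \<and>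
                (\<forall>\<sigma>\<in>carrier abs_gal.
                   compose C \<phi> (map_inv C' C (gal_map \<sigma> C' \<phi>)) = \<xi> \<sigma>)))))))"
proof -
  have two: "(2::'k) \<noteq> 0"
  proof
    assume "(2::'k) = 0"
    then have "CHAR('k) dvd 2" using of_nat_eq_0_iff_char_dvd[of 2, where 'a = 'k] by simp
    then have "CHAR('k) \<le> 2" "CHAR('k) \<noteq> 0" by (simp add: dvd_imp_le) (use \<open>CHAR('k) dvd 2\<close> in \<open>metis dvd_0_left zero_neq_numeral\<close>)
    then show False using assms(8) CHAR_not_1[where 'a = 'k] by linarith
  qed
  have two': "(2::'k alg_closure) \<noteq> 0" using two by (metis to_ac_numeral to_ac_eq_0_iff)
  have "g \<ge> 1" and prime: "prime_ideal (module.span (*) (model_eqs 1 fbar Q))"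
    using assms(12) by (simp_all add: hyperelliptic_model_def Let_def hyperelliptic_field_def)
  \<comment> \<open>Rounding g + 1 up to an even d makes d / 2 exact, and g \<ge> 1 makes it
    positive.\<close>
  then have n: "n > 0" "2 * n = d" unfolding n_def d_def by auto
  have over_k: "poly_over_k fbar"
    by (simp add: poly_over_k_def fbar_def lookup_map_0 base_field_def)
  have hom: "homogeneous3 (2 * n) fbar"
    unfolding n fbar_def using assms(11) by (rule homogeneous3_map)
  have "eval3 fbar 0 = 0" using eval3_scale[OF hom, of 0 0] n by (simp add: power_0_left)
  then have nz: "\<exists>p. eval3 Q p = 0 \<and> eval3 fbar p \<noteq> 0"
    using prime_model_imp_nonvanishing[OF prime[unfolded Q_def] two'] assms(9) unfolding Q_def by simp
  interpret hyperelliptic_twist a b fbar n L \<xi> Q C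
    by unfold_locales (fact assms two over_k hom n nz)+
  have xibar: "\<xi>bar \<sigma> = mat_of \<sigma>" if "\<sigma> \<in> gal_set UNIV" for \<sigma>
    using that by (simp add: xibar_def normalized_matrix_eq)
  show ?thesis
    unfolding carrier_abs_gal
  proof (intro conjI allI impI, goal_cases)
    case 1
    show ?case using is_normalized_iff by simp
  next
    case 2
    show ?case using exists_M by (simp add: xibar cong: ball_cong)
  next
    case (3 M)
    then interpret twist_matrix a b fbar n L \<xi> Q C M
      by unfold_locales (auto simp: xibar[symmetric])
    show ?case
      unfolding Let_def
    proof (intro conjI, goal_cases)
      case 1
      show ?case by (rule QM_over_k)
    next
      case 2
      show ?case by (rule exists_v)
    next
      case 3
      show ?case
      proof (intro allI impI, goal_cases)
        case (1 v s L')
        define G where "G = const3 (1 / of_nat (ext_degree L')) * (\<Sum>\<tau>\<in>gal_set L'. gal_poly \<tau> (const3 v * fM))"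
        interpret twist_curve a b fbar n L \<xi> Q C M v s L' G
          by unfold_locales (use 1 G_def in blast)+
        show ?case
          \<comment> \<open>The goal contains i both as an abstraction and applied to an
            automorphism; the two reversed forms of \<open>i_def\<close> fold these
            occurrences.\<close>
          unfolding G_def[symmetric] C0_def[symmetric] \<psi>0_def[symmetric] i_def[abs_def, symmetric]
            i_def[symmetric]
          using twist[OF _ _ _ refl refl] i_mem by (intro conjI G_over_k \<psi>0_iso i_hom) blast+
      qed
    qed
  qed
qed

end
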